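(* Suppose that $\Lambda$ is a row-finite $k$-graph with no sources, and that $\Lambda$ is aperiodic. Suppose that $\eta:\Lambda\to G$ is a functor into a group $G$, that $\sigma\in Z^2(G,\mathbb{T})$, and that $B$ is the Fell bundle over $G$ with fibres $B_g=\overline{\operatorname{span}}\{s_\lambda s_\mu^*:\eta(\lambda)\eta(\mu)^{-1}=g\}\subset C^*(\Lambda)$. Suppose that $\{T_\lambda:\lambda\in\Lambda\}$ are elements of a $C^*$-algebra $A$ satisfying (CK1) $\{Q_v:=T_v:v\in\Lambda^0\}$ consists of mutually orthogonal projections; (CK2) $T_\lambda T_\mu=\sigma(\eta(\lambda),\eta(\mu))T_{\lambda\mu}$ whenever $r(\mu)=s(\lambda)$; (CK3) $T_\lambda^*T_\lambda=Q_{s(\lambda)}$ for all $\lambda\in\Lambda$; (CK4) $Q_v=\sum_{\lambda\in v\Lambda^n}T_\lambda T_\lambda^*$ for all $v\in\Lambda^0$ and $n\in\mathbb{N}^k$; and that each $Q_v$ is nonzero. Then the corresponding homomorphism $\pi_T:C^*(B(\sigma))\to A$ is injective.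
   Context: All groups are discrete. A $k$-graph is a countable small category $\Lambda$ with a functor $d:\Lambda\to\mathbb{N}^k$ satisfying the factorisation property: if $d(\lambda)=m+n$, there are unique $\mu,\nu$ with $\lambda=\mu\nu$, $d(\mu)=m$, $d(\nu)=n$. Range and source (codomain and domain) are written $r,s$, so $\lambda\mu$ is defined exactly when $s(\lambda)=r(\mu)$. $\Lambda^n:=d^{-1}(n)$, $\Lambda^0$ is identified with the set of objects, $v\Lambda:=\{\lambda:r(\lambda)=v\}$, $v\Lambda^n:=v\Lambda\cap\Lambda^n$. For $0\le m\le n\le d(\lambda)$, $\lambda(m,n)$ is the unique path of degree $n-m$ with $\lambda=\lambda'\lambda(m,n)\lambda''$, $d(\lambda')=m$, $d(\lambda'')=d(\lambda)-n$. Row-finite with no sources means every $v\Lambda^n$ is finite and nonempty. $\Lambda$ is aperiodic if for every $v\in\Lambda^0$ and every $m,n\in\mathbb{N}^k$ with $m\ne n$ there exists $\lambda\in v\Lambda$ such that $d(\lambda)\ge m\vee n$ and $\lambda(m,m+d(\lambda)-(m\vee n))\ne\lambda(n,n+d(\lambda)-(m\vee n))$ ($\vee$ is coordinatewise maximum). $C^*(\Lambda)$ is the universal $C^*$-algebra generated by a Cuntz--Krieger family $\{s_\lambda\}$: the $p_v:=s_v$ ($v\in\Lambda^0$) are mutually orthogonal projections; $s_\lambda s_\mu=s_{\lambda\mu}$ if $s(\lambda)=r(\mu)$; $s_\lambda^*s_\lambda=p_{s(\lambda)}$; $p_v=\sum_{\lambda\in v\Lambda^n}s_\lambda s_\lambda^*$.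 A functor $\eta:\Lambda\to G$ is a map with $\eta(\lambda\mu)=\eta(\lambda)\eta(\mu)$ for composable $\lambda,\mu$ and $\eta(v)=e$ for $v\in\Lambda^0$. A Fell bundle over $G$ is a set $B$ with a map $p:B\to G$ whose fibres $B_g=p^{-1}(g)$ are complex Banach spaces, with an associative multiplication and an involution such that: $p(bc)=p(b)p(c)$; multiplication is bilinear $B_g\times B_h\to B_{gh}$ with $\|bc\|\le\|b\|\,\|c\|$; $b\mapsto b^*$ is conjugate linear $B_g\to B_{g^{-1}}$ with $(bc)^*=c^*b^*$, $\|b^*b\|=\|b\|^2$ (so $B_e$ is a $C^*$-algebra); and $b^*b\ge0$ in $B_e$. The subspaces $B_g\subset C^*(\Lambda)$ of the claim form such a bundle with the operations and norm of $C^*(\Lambda)$. $Z^2(G,\mathbb{T})$ is the set of $\sigma:G\times G\to\mathbb{T}$ with $\sigma(e,g)=\sigma(g,e)=1$ and $\sigma(g,h)\sigma(gh,k)=\sigma(g,hk)\sigma(h,k)$. The deformed bundle $B(\sigma)$ is the Fell bundle with the same set, projection and Banach space fibres as $B$, and operations $b\cdot_\sigma c=\sigma(g,h)bc$, $b^{*_\sigma}=\overline{\sigma(g,g^{-1})}b^*$ for $b\in B_g$, $c\in B_h$. A representation of a Fell bundle $B$ in a $C^*$-algebra $C$ consists of linear maps $\pi_g:B_g\to C$ with $\pi_{gh}(bc)=\pi_g(b)\pi_h(c)$, $\pi_g(b)^*=\pi_{g^{-1}}(b^* )$ and $\pi_e$ nondegenerate. $C^*(B)$ is the $C^*$-algebra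 generated by a universal such representation. With $\pi^\sigma$ the universal representation of $B(\sigma)$ and $t_\lambda:=\pi^\sigma_{\eta(\lambda)}(s_\lambda)$, the family $\{t_\lambda\}$ generates $C^*(B(\sigma))$ and is universal for families satisfying (CK1)--(CK4); $\pi_T$ is the homomorphism with $\pi_T(t_\lambda)=T_\lambda$ for all $\lambda\in\Lambda$. *)

theory Defs
  imports
    "HOL-Analysis.Analysis"
    "HOL-Algebra.Module"
    "HOL-Library.Function_Algebras"
begin

section \<open>C*-algebras\<close>

subsection \<open>C*-algebras on a carrier set\<close>

definition complex_ring :: "complex ring" where
  "complex_ring = \<lparr>carrier = UNIV, mult = (*), one = 1, zero = 0, add = (+)\<rparr>"

text \<open>
  Algebras need not be unital: the field \<^const>\<open>one\<close>, inherited from the library record, carries no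
  meaning here.  Likewise \<^const>\<open>mult\<close> carries no meaning when only a Banach space is considered.
\<close>

record 'a normed_space = "(complex, 'a) module" +
  nrm :: "'a \<Rightarrow> real"

record 'a cstar = "'a normed_space" +
  adj :: "'a \<Rightarrow> 'a"

definition ndist :: "('a, 'm) normed_space_scheme \<Rightarrow> 'a \<Rightarrow> 'a \<Rightarrow> real" where
  "ndist V x y = nrm V (x \<ominus>\<^bsub>V\<^esub> y)"

definition ntopology :: "('a, 'm) normed_space_scheme \<Rightarrow> 'a topology" where
  "ntopology V = Metric_space.mtopology (carrier V) (ndist V)"

locale banach_space_on = Module.module complex_ring V
  for V :: "('a, 'm) normed_space_scheme" (structure) +
  assumes nrm_nonneg: "x \<in> carrier V \<Longrightarrow> 0 \<le> nrm V x"
    and nrm_eq_0: "x \<in> carrier V \<Longrightarrow> nrm V x = 0 \<longleftrightarrow> x = \<zero>"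
    and nrm_triangle: "x \<in> carrier V \<Longrightarrow> y \<in> carrier V \<Longrightarrow> nrm V (x \<oplus> y) \<le> nrm V x + nrm V y"
    and nrm_smult: "x \<in> carrier V \<Longrightarrow> nrm V (c \<odot> x) = cmod c * nrm V x"
    and complete: "Metric_space.mcomplete (carrier V) (ndist V)"

locale cstar_algebra_on = banach_space_on A for A :: "'a cstar" (structure) +
  assumes mult_closed: "x \<in> carrier A \<Longrightarrow> y \<in> carrier A \<Longrightarrow> x \<otimes> y \<in> carrier A"
    and mult_assoc: "x \<in> carrier A \<Longrightarrow> y \<in> carrier A \<Longrightarrow> z \<in> carrier A
      \<Longrightarrow> (x \<otimes> y) \<otimes> z = x \<otimes> (y \<otimes> z)"
    and mult_l_distr: "x \<in> carrier A \<Longrightarrow> y \<in> carrier A \<Longrightarrow> z \<in> carrier A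
      \<Longrightarrow> (x \<oplus> y) \<otimes> z = x \<otimes> z \<oplus> y \<otimes> z"
    and mult_r_distr: "x \<in> carrier A \<Longrightarrow> y \<in> carrier A \<Longrightarrow> z \<in> carrier A
      \<Longrightarrow> x \<otimes> (y \<oplus> z) = x \<otimes> y \<oplus> x \<otimes> z"
    and smult_mult_left: "x \<in> carrier A \<Longrightarrow> y \<in> carrier A \<Longrightarrow> (c \<odot> x) \<otimes> y = c \<odot> (x \<otimes> y)"
    and smult_mult_right: "x \<in> carrier A \<Longrightarrow> y \<in> carrier A \<Longrightarrow> x \<otimes> (c \<odot> y) = c \<odot> (x \<otimes> y)"
    and adj_closed: "x \<in> carrier A \<Longrightarrow> adj A x \<in> carrier A"
    and adj_adj: "x \<in> carrier A \<Longrightarrow> adj A (adj A x) = x"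
    and adj_add: "x \<in> carrier A \<Longrightarrow> y \<in> carrier A \<Longrightarrow> adj A (x \<oplus> y) = adj A x \<oplus> adj A y"
    and adj_smult: "x \<in> carrier A \<Longrightarrow> adj A (c \<odot> x) = cnj c \<odot> adj A x"
    and adj_mult: "x \<in> carrier A \<Longrightarrow> y \<in> carrier A \<Longrightarrow> adj A (x \<otimes> y) = adj A y \<otimes> adj A x"
    and nrm_mult: "x \<in> carrier A \<Longrightarrow> y \<in> carrier A \<Longrightarrow> nrm A (x \<otimes> y) \<le> nrm A x * nrm A y"
    and cstar_identity: "x \<in> carrier A \<Longrightarrow> nrm A (adj A x \<otimes> x) = (nrm A x)\<^sup>2"

definition closed_span :: "('a, 'm) normed_space_scheme \<Rightarrow> 'a set \<Rightarrow> 'a set" where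
  "closed_span V S = ntopology V closure_of ((\<lambda>H. submodule H complex_ring V) hull S)"

definition cstar_subalgebra :: "'a set \<Rightarrow> 'a cstar \<Rightarrow> bool" where
  "cstar_subalgebra M A \<longleftrightarrow>
     submodule M complex_ring A \<and>
     (\<forall>x\<in>M. \<forall>y\<in>M. x \<otimes>\<^bsub>A\<^esub> y \<in> M) \<and>
     (\<forall>x\<in>M. adj A x \<in> M) \<and>
     closedin (ntopology A) M"

definition cstar_generates :: "'a cstar \<Rightarrow> 'a set \<Rightarrow> bool" where
  "cstar_generates A S \<longleftrightarrow>
     S \<subseteq> carrier A \<and> (\<forall>M. cstar_subalgebra M A \<and> S \<subseteq> M \<longrightarrow> M = carrier A)"

definition star_hom :: "'a cstar \<Rightarrow> 'b cstar \<Rightarrow> ('a \<Rightarrow> 'b) \<Rightarrow> bool" where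
  "star_hom A B \<phi> \<longleftrightarrow>
     \<phi> \<in> carrier A \<rightarrow> carrier B \<and>
     (\<forall>x\<in>carrier A. \<forall>y\<in>carrier A. \<phi> (x \<oplus>\<^bsub>A\<^esub> y) = \<phi> x \<oplus>\<^bsub>B\<^esub> \<phi> y) \<and>
     (\<forall>c. \<forall>x\<in>carrier A. \<phi> (c \<odot>\<^bsub>A\<^esub> x) = c \<odot>\<^bsub>B\<^esub> \<phi> x) \<and>
     (\<forall>x\<in>carrier A. \<forall>y\<in>carrier A. \<phi> (x \<otimes>\<^bsub>A\<^esub> y) = \<phi> x \<otimes>\<^bsub>B\<^esub> \<phi> y) \<and>
     (\<forall>x\<in>carrier A. \<phi> (adj A x) = adj B (\<phi> x))"

subsection \<open>C*-algebras as types\<close>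

text \<open>
  The algebras named in a theorem are types of the following class; \<open>full_algebra\<close> turns such a type
  into a C*-algebra in the sense of \<^locale>\<open>cstar_algebra_on\<close>.  Carrier sets are needed because the
  universal properties below quantify over C*-algebras.
\<close>

class cstar_algebra = real_normed_algebra + banach +
  fixes scaleC :: "complex \<Rightarrow> 'a \<Rightarrow> 'a"
    and star :: "'a \<Rightarrow> 'a"
  assumes scaleC_of_real: "scaleC (complex_of_real r) x = scaleR r x"
    and scaleC_add_right: "scaleC c (x + y) = scaleC c x + scaleC c y"
    and scaleC_add_left: "scaleC (c + d) x = scaleC c x + scaleC d x"
    and scaleC_scaleC: "scaleC c (scaleC d x) = scaleC (c * d) x"
    and mult_scaleC_left: "scaleC c x * y = scaleC c (x * y)"
    and mult_scaleC_right: "x * scaleC c y = scaleC c (x * y)"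
    and norm_scaleC: "norm (scaleC c x) = cmod c * norm x"
    and star_star: "star (star x) = x"
    and star_add: "star (x + y) = star x + star y"
    and star_scaleC: "star (scaleC c x) = scaleC (cnj c) (star x)"
    and star_mult: "star (x * y) = star y * star x"
    and norm_star_mult_self: "norm (star x * x) = (norm x)\<^sup>2"

definition full_algebra :: "'a::cstar_algebra cstar" where
  "full_algebra = \<lparr>carrier = UNIV, mult = (*), one = undefined, zero = 0, add = (+),
     smult = scaleC, nrm = norm, adj = star\<rparr>"

lemma full_algebra_simps [simp]:
  "carrier full_algebra = UNIV"
  "mult full_algebra = (*)"
  "zero full_algebra = 0"
  "add full_algebra = (+)"
  "smult full_algebra = scaleC"
  "nrm full_algebra = norm"
  "adj full_algebra = star"
  by (simp_all add: full_algebra_def)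

lemma cring_complex_ring: "cring complex_ring"
proof (rule cringI)
  show "abelian_group complex_ring"
  proof (rule abelian_groupI)
    fix x :: complex
    show "\<exists>y\<in>carrier complex_ring. y \<oplus>\<^bsub>complex_ring\<^esub> x = \<zero>\<^bsub>complex_ring\<^esub>"
      by (auto simp: complex_ring_def intro!: exI[of _ "- x"])
  qed (auto simp: complex_ring_def)
  show "Group.comm_monoid complex_ring"
    by unfold_locales (auto simp: complex_ring_def)
qed (auto simp: complex_ring_def algebra_simps)

lemma abelian_group_full_algebra: "abelian_group (full_algebra :: 'a::cstar_algebra cstar)"
proof (rule abelian_groupI)
  fix x :: 'a
  show "\<exists>y\<in>carrier full_algebra. y \<oplus>\<^bsub>full_algebra\<^esub> x = \<zero>\<^bsub>full_algebra\<^esub>"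
    by (auto intro!: exI[of _ "- x"])
qed (auto simp: add.assoc add.commute)

lemma a_minus_full_algebra [simp]: "x \<ominus>\<^bsub>full_algebra\<^esub> y = x - (y :: 'a::cstar_algebra)"
proof -
  interpret F: abelian_group "full_algebra :: 'a cstar"
    by (rule abelian_group_full_algebra)
  have "\<ominus>\<^bsub>full_algebra\<^esub> y = - y"
    using F.minus_equality[of "- y" y] by simp
  then show ?thesis
    by (simp add: a_minus_def)
qed

lemma ndist_full_algebra [simp]: "ndist (full_algebra :: 'a::cstar_algebra cstar) = dist"
  by (intro ext) (simp add: ndist_def dist_norm)

lemma ntopology_full_algebra [simp]:
  "ntopology (full_algebra :: 'a::cstar_algebra cstar) = euclidean"
  by (simp add: ntopology_def)

lemma module_full_algebra:
  "Module.module complex_ring (full_algebra :: 'a::cstar_algebra cstar)"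
proof (rule moduleI[OF cring_complex_ring abelian_group_full_algebra])
  fix x :: 'a
  show "\<one>\<^bsub>complex_ring\<^esub> \<odot>\<^bsub>full_algebra\<^esub> x = x"
    using scaleC_of_real[of 1 x] by (simp add: complex_ring_def)
qed (simp_all add: complex_ring_def scaleC_add_left scaleC_add_right scaleC_scaleC)

lemma cstar_algebra_on_full_algebra: "cstar_algebra_on (full_algebra :: 'a::cstar_algebra cstar)"
proof -
  have "banach_space_on (full_algebra :: 'a cstar)"
    by (intro banach_space_on.intro module_full_algebra banach_space_on_axioms.intro)
       (auto simp: norm_triangle_ineq norm_scaleC complete_UNIV)
  then show ?thesis
    by (intro cstar_algebra_on.intro cstar_algebra_on_axioms.intro)
       (auto simp: mult.assoc distrib_left distrib_right mult_scaleC_left mult_scaleC_right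
         star_star star_add star_scaleC star_mult norm_mult_ineq norm_star_mult_self)
qed


section \<open>Higher-rank graphs\<close>

text \<open>
  \<open>\<nat>\<^sup>k\<close> is represented by the functions \<open>nat \<Rightarrow> nat\<close> vanishing from \<open>k\<close> on, with the pointwise
  addition, subtraction, order and supremum (\<^const>\<open>sup\<close>, the coordinatewise maximum).
\<close>

definition Nk :: "nat \<Rightarrow> (nat \<Rightarrow> nat) set" where
  "Nk k = {n. \<forall>i\<ge>k. n i = 0}"

text \<open>
  A small category is given by its morphisms, an object being identified with its identity morphism;
  \<open>cmp \<Lambda> \<kappa> \<mu>\<close> is the composite \<open>\<kappa>\<mu>\<close>, and only matters if \<open>src \<Lambda> \<kappa> = rng \<Lambda> \<mu>\<close>.
\<close>

record 'l kgraph =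
  paths :: "'l set"
  rng :: "'l \<Rightarrow> 'l"
  src :: "'l \<Rightarrow> 'l"
  cmp :: "'l \<Rightarrow> 'l \<Rightarrow> 'l"
  deg :: "'l \<Rightarrow> nat \<Rightarrow> nat"

definition paths_of_degree :: "'l kgraph \<Rightarrow> (nat \<Rightarrow> nat) \<Rightarrow> 'l set" where
  "paths_of_degree \<Lambda> n = {\<kappa> \<in> paths \<Lambda>. deg \<Lambda> \<kappa> = n}"

abbreviation vertices :: "'l kgraph \<Rightarrow> 'l set" where
  "vertices \<Lambda> \<equiv> paths_of_degree \<Lambda> 0"

definition paths_into :: "'l kgraph \<Rightarrow> 'l \<Rightarrow> 'l set" where
  "paths_into \<Lambda> v = {\<kappa> \<in> paths \<Lambda>. rng \<Lambda> \<kappa> = v}"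

locale k_graph =
  fixes k :: nat and \<Lambda> :: "'l kgraph"
  assumes countable_paths: "countable (paths \<Lambda>)"
    and rng_closed: "\<kappa> \<in> paths \<Lambda> \<Longrightarrow> rng \<Lambda> \<kappa> \<in> paths \<Lambda>"
    and src_closed: "\<kappa> \<in> paths \<Lambda> \<Longrightarrow> src \<Lambda> \<kappa> \<in> paths \<Lambda>"
    and rng_rng: "\<kappa> \<in> paths \<Lambda> \<Longrightarrow> rng \<Lambda> (rng \<Lambda> \<kappa>) = rng \<Lambda> \<kappa>"
    and src_rng: "\<kappa> \<in> paths \<Lambda> \<Longrightarrow> src \<Lambda> (rng \<Lambda> \<kappa>) = rng \<Lambda> \<kappa>"
    and rng_src: "\<kappa> \<in> paths \<Lambda> \<Longrightarrow> rng \<Lambda> (src \<Lambda> \<kappa>) = src \<Lambda> \<kappa>"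
    and src_src: "\<kappa> \<in> paths \<Lambda> \<Longrightarrow> src \<Lambda> (src \<Lambda> \<kappa>) = src \<Lambda> \<kappa>"
    and cmp_closed: "\<kappa> \<in> paths \<Lambda> \<Longrightarrow> \<mu> \<in> paths \<Lambda> \<Longrightarrow> src \<Lambda> \<kappa> = rng \<Lambda> \<mu>
      \<Longrightarrow> cmp \<Lambda> \<kappa> \<mu> \<in> paths \<Lambda>"
    and rng_cmp: "\<kappa> \<in> paths \<Lambda> \<Longrightarrow> \<mu> \<in> paths \<Lambda> \<Longrightarrow> src \<Lambda> \<kappa> = rng \<Lambda> \<mu>
      \<Longrightarrow> rng \<Lambda> (cmp \<Lambda> \<kappa> \<mu>) = rng \<Lambda> \<kappa>"
    and src_cmp: "\<kappa> \<in> paths \<Lambda> \<Longrightarrow> \<mu> \<in> paths \<Lambda> \<Longrightarrow> src \<Lambda> \<kappa> = rng \<Lambda> \<mu>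
      \<Longrightarrow> src \<Lambda> (cmp \<Lambda> \<kappa> \<mu>) = src \<Lambda> \<mu>"
    and cmp_assoc: "\<kappa> \<in> paths \<Lambda> \<Longrightarrow> \<mu> \<in> paths \<Lambda> \<Longrightarrow> \<nu> \<in> paths \<Lambda>
      \<Longrightarrow> src \<Lambda> \<kappa> = rng \<Lambda> \<mu> \<Longrightarrow> src \<Lambda> \<mu> = rng \<Lambda> \<nu>
      \<Longrightarrow> cmp \<Lambda> (cmp \<Lambda> \<kappa> \<mu>) \<nu> = cmp \<Lambda> \<kappa> (cmp \<Lambda> \<mu> \<nu>)"
    and cmp_rng: "\<kappa> \<in> paths \<Lambda> \<Longrightarrow> cmp \<Lambda> (rng \<Lambda> \<kappa>) \<kappa> = \<kappa>"
    and cmp_src: "\<kappa> \<in> paths \<Lambda> \<Longrightarrow> cmp \<Lambda> \<kappa> (src \<Lambda> \<kappa>) = \<kappa>"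
    and deg_closed: "\<kappa> \<in> paths \<Lambda> \<Longrightarrow> deg \<Lambda> \<kappa> \<in> Nk k"
    and deg_cmp: "\<kappa> \<in> paths \<Lambda> \<Longrightarrow> \<mu> \<in> paths \<Lambda> \<Longrightarrow> src \<Lambda> \<kappa> = rng \<Lambda> \<mu>
      \<Longrightarrow> deg \<Lambda> (cmp \<Lambda> \<kappa> \<mu>) = deg \<Lambda> \<kappa> + deg \<Lambda> \<mu>"
    and deg_id: "\<kappa> \<in> paths \<Lambda> \<Longrightarrow> deg \<Lambda> (rng \<Lambda> \<kappa>) = 0 \<and> deg \<Lambda> (src \<Lambda> \<kappa>) = 0"
    and factorisation: "\<kappa> \<in> paths \<Lambda> \<Longrightarrow> m \<in> Nk k \<Longrightarrow> n \<in> Nk k \<Longrightarrow> deg \<Lambda> \<kappa> = m + n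
      \<Longrightarrow> \<exists>!p. fst p \<in> paths_of_degree \<Lambda> m \<and> snd p \<in> paths_of_degree \<Lambda> n \<and>
            src \<Lambda> (fst p) = rng \<Lambda> (snd p) \<and> \<kappa> = cmp \<Lambda> (fst p) (snd p)"
begin

lemma vertices_eq_identities: "vertices \<Lambda> = rng \<Lambda> ` paths \<Lambda>"
proof (intro equalityI subsetI)
  fix v assume v: "v \<in> vertices \<Lambda>"
  then have vp: "v \<in> paths \<Lambda>" and d: "deg \<Lambda> v = 0"
    by (auto simp: paths_of_degree_def)
  have "(0 :: nat \<Rightarrow> nat) \<in> Nk k"
    by (simp add: Nk_def)
  then have "\<exists>!p. fst p \<in> vertices \<Lambda> \<and> snd p \<in> vertices \<Lambda> \<and>
      src \<Lambda> (fst p) = rng \<Lambda> (snd p) \<and> v = cmp \<Lambda> (fst p) (snd p)"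
    using factorisation[OF vp, of 0 0] d by simp
  moreover have "rng \<Lambda> v \<in> vertices \<Lambda>" "src \<Lambda> v \<in> vertices \<Lambda>"
    using vp deg_id rng_closed src_closed by (auto simp: paths_of_degree_def)
  ultimately have "(rng \<Lambda> v, v) = (v, src \<Lambda> v)"
    using v vp src_rng rng_src cmp_rng cmp_src by (metis fst_conv snd_conv)
  then show "v \<in> rng \<Lambda> ` paths \<Lambda>"
    using vp by (metis Pair_inject imageI)
next
  fix v assume "v \<in> rng \<Lambda> ` paths \<Lambda>"
  then show "v \<in> vertices \<Lambda>"
    using deg_id rng_closed by (auto simp: paths_of_degree_def)
qed

end

definition row_finite_no_sources :: "nat \<Rightarrow> 'l kgraph \<Rightarrow> bool" where
  "row_finite_no_sources k \<Lambda> \<longleftrightarrow>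
     (\<forall>v\<in>vertices \<Lambda>. \<forall>n\<in>Nk k.
        finite (paths_into \<Lambda> v \<inter> paths_of_degree \<Lambda> n) \<and>
        paths_into \<Lambda> v \<inter> paths_of_degree \<Lambda> n \<noteq> {})"

text \<open>The segment \<open>\<kappa>(m,n)\<close>, for \<open>0 \<le> m \<le> n \<le> d(\<kappa>)\<close>.\<close>

definition segment :: "'l kgraph \<Rightarrow> 'l \<Rightarrow> (nat \<Rightarrow> nat) \<Rightarrow> (nat \<Rightarrow> nat) \<Rightarrow> 'l" where
  "segment \<Lambda> \<kappa> m n = (THE \<mu>. \<mu> \<in> paths_of_degree \<Lambda> (n - m) \<and>
     (\<exists>\<alpha>\<in>paths_of_degree \<Lambda> m. \<exists>\<beta>\<in>paths_of_degree \<Lambda> (deg \<Lambda> \<kappa> - n).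
        src \<Lambda> \<alpha> = rng \<Lambda> \<mu> \<and> src \<Lambda> \<mu> = rng \<Lambda> \<beta> \<and> \<kappa> = cmp \<Lambda> (cmp \<Lambda> \<alpha> \<mu>) \<beta>))"

definition aperiodic :: "nat \<Rightarrow> 'l kgraph \<Rightarrow> bool" where
  "aperiodic k \<Lambda> \<longleftrightarrow>
     (\<forall>v\<in>vertices \<Lambda>. \<forall>m\<in>Nk k. \<forall>n\<in>Nk k. m \<noteq> n \<longrightarrow>
        (\<exists>\<kappa>\<in>paths_into \<Lambda> v. sup m n \<le> deg \<Lambda> \<kappa> \<and>
           segment \<Lambda> \<kappa> m (m + (deg \<Lambda> \<kappa> - sup m n)) \<noteq> segment \<Lambda> \<kappa> n (n + (deg \<Lambda> \<kappa> - sup m n))))"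

definition functor_to_group :: "'l kgraph \<Rightarrow> ('g, 'n) monoid_scheme \<Rightarrow> ('l \<Rightarrow> 'g) \<Rightarrow> bool" where
  "functor_to_group \<Lambda> G \<eta> \<longleftrightarrow>
     \<eta> \<in> paths \<Lambda> \<rightarrow> carrier G \<and>
     (\<forall>\<kappa>\<in>paths \<Lambda>. \<forall>\<mu>\<in>paths \<Lambda>. src \<Lambda> \<kappa> = rng \<Lambda> \<mu> \<longrightarrow> \<eta> (cmp \<Lambda> \<kappa> \<mu>) = \<eta> \<kappa> \<otimes>\<^bsub>G\<^esub> \<eta> \<mu>) \<and>
     (\<forall>v\<in>vertices \<Lambda>. \<eta> v = \<one>\<^bsub>G\<^esub>)"

definition circle_cocycle :: "('g, 'n) monoid_scheme \<Rightarrow> ('g \<Rightarrow> 'g \<Rightarrow> complex) \<Rightarrow> bool" where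
  "circle_cocycle G \<sigma> \<longleftrightarrow>
     (\<forall>g\<in>carrier G. \<forall>h\<in>carrier G. cmod (\<sigma> g h) = 1) \<and>
     (\<forall>g\<in>carrier G. \<sigma> \<one>\<^bsub>G\<^esub> g = 1 \<and> \<sigma> g \<one>\<^bsub>G\<^esub> = 1) \<and>
     (\<forall>g\<in>carrier G. \<forall>h\<in>carrier G. \<forall>l\<in>carrier G.
        \<sigma> g h * \<sigma> (g \<otimes>\<^bsub>G\<^esub> h) l = \<sigma> g (h \<otimes>\<^bsub>G\<^esub> l) * \<sigma> h l)"


section \<open>Cuntz--Krieger families\<close>

text \<open>
  \<open>c\<close> is the scalar in the relation \<open>T\<^sub>\<kappa> T\<^sub>\<mu> = c(\<kappa>,\<mu>) T\<^sub>\<kappa>\<^sub>\<mu>\<close>.  Ordinary Cuntz--Krieger families have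
  \<open>c = 1\<close>, and the families of the twisted relations have \<open>c(\<kappa>,\<mu>) = \<sigma>(\<eta>(\<kappa>),\<eta>(\<mu>))\<close>.
\<close>

definition ck_relations ::
  "nat \<Rightarrow> 'l kgraph \<Rightarrow> ('l \<Rightarrow> 'l \<Rightarrow> complex) \<Rightarrow> 'a cstar \<Rightarrow> ('l \<Rightarrow> 'a) \<Rightarrow> bool" where
  "ck_relations k \<Lambda> c A T \<longleftrightarrow>
     T \<in> paths \<Lambda> \<rightarrow> carrier A \<and>
     (\<forall>v\<in>vertices \<Lambda>. T v \<otimes>\<^bsub>A\<^esub> T v = T v \<and> adj A (T v) = T v) \<and>
     (\<forall>v\<in>vertices \<Lambda>. \<forall>w\<in>vertices \<Lambda>. v \<noteq> w \<longrightarrow> T v \<otimes>\<^bsub>A\<^esub> T w = \<zero>\<^bsub>A\<^esub>) \<and>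
     (\<forall>\<kappa>\<in>paths \<Lambda>. \<forall>\<mu>\<in>paths \<Lambda>. src \<Lambda> \<kappa> = rng \<Lambda> \<mu> \<longrightarrow>
        T \<kappa> \<otimes>\<^bsub>A\<^esub> T \<mu> = c \<kappa> \<mu> \<odot>\<^bsub>A\<^esub> T (cmp \<Lambda> \<kappa> \<mu>)) \<and>
     (\<forall>\<kappa>\<in>paths \<Lambda>. adj A (T \<kappa>) \<otimes>\<^bsub>A\<^esub> T \<kappa> = T (src \<Lambda> \<kappa>)) \<and>
     (\<forall>v\<in>vertices \<Lambda>. \<forall>n\<in>Nk k.
        T v = (\<Oplus>\<^bsub>A\<^esub>\<kappa>\<in>paths_into \<Lambda> v \<inter> paths_of_degree \<Lambda> n. T \<kappa> \<otimes>\<^bsub>A\<^esub> adj A (T \<kappa>)))"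

definition cuntz_krieger_family :: "nat \<Rightarrow> 'l kgraph \<Rightarrow> 'a cstar \<Rightarrow> ('l \<Rightarrow> 'a) \<Rightarrow> bool" where
  "cuntz_krieger_family k \<Lambda> A S \<longleftrightarrow> ck_relations k \<Lambda> (\<lambda>_ _. 1) A S"

definition twisted_ck_family ::
  "nat \<Rightarrow> 'l kgraph \<Rightarrow> ('l \<Rightarrow> 'g) \<Rightarrow> ('g \<Rightarrow> 'g \<Rightarrow> complex) \<Rightarrow> 'a cstar \<Rightarrow> ('l \<Rightarrow> 'a) \<Rightarrow> bool" where
  "twisted_ck_family k \<Lambda> \<eta> \<sigma> A T \<longleftrightarrow> ck_relations k \<Lambda> (\<lambda>\<kappa> \<mu>. \<sigma> (\<eta> \<kappa>) (\<eta> \<mu>)) A T"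

text \<open>
  \<open>is_kgraph_algebra k \<Lambda> C s\<close> says that \<open>(C, s)\<close> is (a copy of) \<open>C\<^sup>*(\<Lambda>)\<close> with its canonical generators.
  The universal property ranges over all C*-algebras carried by subsets of the type of \<open>C\<close>, which is
  no restriction: a C*-algebra generated by a Cuntz--Krieger family of the countable \<open>\<Lambda>\<close> is separable,
  hence has at most continuum many elements, whereas the type has at least that many as soon as
  \<open>C \<noteq> {0}\<close>; so every such algebra has a copy carried by a subset of the type.
  (Only \<open>C = {0}\<close> on a type with fewer elements escapes; there no family with non-zero vertex
  projections can be an image of \<open>s\<close>, unless \<open>\<Lambda>\<close> is empty and \<open>C\<^sup>*(\<Lambda>) = {0}\<close>.)
\<close>

definition is_kgraph_algebra :: "nat \<Rightarrow> 'l kgraph \<Rightarrow> 'c cstar \<Rightarrow> ('l \<Rightarrow> 'c) \<Rightarrow> bool" where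
  "is_kgraph_algebra k \<Lambda> C s \<longleftrightarrow>
     cstar_algebra_on C \<and>
     cuntz_krieger_family k \<Lambda> C s \<and>
     cstar_generates C (s ` paths \<Lambda>) \<and>
     (\<forall>(E :: 'c cstar) S. cstar_algebra_on E \<and> cuntz_krieger_family k \<Lambda> E S \<longrightarrow>
        (\<exists>\<phi>. star_hom C E \<phi> \<and> (\<forall>\<kappa>\<in>paths \<Lambda>. \<phi> (s \<kappa>) = S \<kappa>)))"


section \<open>Fell bundles over discrete groups\<close>

text \<open>
  The projection is \<open>proj\<close>; the operations \<open>fzero g\<close>, \<open>fadd\<close>, \<open>fsmult\<close> and \<open>fnorm\<close> make up the normed
  spaces \<open>B\<^sub>g\<close>, addition being meaningful only within a fibre.
\<close>

record ('g, 'b) fell_bundle =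
  total :: "'b set"
  proj :: "'b \<Rightarrow> 'g"
  fzero :: "'g \<Rightarrow> 'b"
  fadd :: "'b \<Rightarrow> 'b \<Rightarrow> 'b"
  fsmult :: "complex \<Rightarrow> 'b \<Rightarrow> 'b"
  fnorm :: "'b \<Rightarrow> real"
  fmult :: "'b \<Rightarrow> 'b \<Rightarrow> 'b"
  fstar :: "'b \<Rightarrow> 'b"

definition fibre :: "('g, 'b) fell_bundle \<Rightarrow> 'g \<Rightarrow> 'b set" where
  "fibre B g = {b \<in> total B. proj B b = g}"

definition fibre_space :: "('g, 'b) fell_bundle \<Rightarrow> 'g \<Rightarrow> 'b normed_space" where
  "fibre_space B g = \<lparr>carrier = fibre B g, mult = undefined, one = undefined, zero = fzero B g,
     add = fadd B, smult = fsmult B, nrm = fnorm B\<rparr>"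

text \<open>
  Positivity in \<open>B\<^sub>e\<close> is expressed as being of the form \<open>a\<^sup>* a\<close> with \<open>a \<in> B\<^sub>e\<close>.  The bundles
  \<open>graph_bundle\<close> and \<open>deformed_bundle\<close> below are explicit, and that they satisfy these axioms is a
  consequence of their definition; no statement has to assume it.
\<close>

locale fell_bundle_over = group G
  for G :: "('g, 'n) monoid_scheme" (structure) and B :: "('g, 'b) fell_bundle" +
  assumes proj_closed: "b \<in> total B \<Longrightarrow> proj B b \<in> carrier G"
    and fibre_banach: "g \<in> carrier G \<Longrightarrow> banach_space_on (fibre_space B g)"
    and fmult_fibre: "b \<in> fibre B g \<Longrightarrow> c \<in> fibre B h \<Longrightarrow> fmult B b c \<in> fibre B (g \<otimes> h)"
    and fmult_assoc: "a \<in> total B \<Longrightarrow> b \<in> total B \<Longrightarrow> c \<in> total B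
      \<Longrightarrow> fmult B (fmult B a b) c = fmult B a (fmult B b c)"
    and fmult_add_left: "b \<in> fibre B g \<Longrightarrow> b' \<in> fibre B g \<Longrightarrow> c \<in> total B
      \<Longrightarrow> fmult B (fadd B b b') c = fadd B (fmult B b c) (fmult B b' c)"
    and fmult_add_right: "b \<in> total B \<Longrightarrow> c \<in> fibre B g \<Longrightarrow> c' \<in> fibre B g
      \<Longrightarrow> fmult B b (fadd B c c') = fadd B (fmult B b c) (fmult B b c')"
    and fmult_smult_left: "b \<in> total B \<Longrightarrow> c \<in> total B
      \<Longrightarrow> fmult B (fsmult B z b) c = fsmult B z (fmult B b c)"
    and fmult_smult_right: "b \<in> total B \<Longrightarrow> c \<in> total B
      \<Longrightarrow> fmult B b (fsmult B z c) = fsmult B z (fmult B b c)"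
    and fnorm_mult: "b \<in> total B \<Longrightarrow> c \<in> total B \<Longrightarrow> fnorm B (fmult B b c) \<le> fnorm B b * fnorm B c"
    and fstar_fibre: "b \<in> fibre B g \<Longrightarrow> fstar B b \<in> fibre B (inv g)"
    and fstar_fstar: "b \<in> total B \<Longrightarrow> fstar B (fstar B b) = b"
    and fstar_add: "b \<in> fibre B g \<Longrightarrow> c \<in> fibre B g
      \<Longrightarrow> fstar B (fadd B b c) = fadd B (fstar B b) (fstar B c)"
    and fstar_smult: "b \<in> total B \<Longrightarrow> fstar B (fsmult B z b) = fsmult B (cnj z) (fstar B b)"
    and fstar_mult: "b \<in> total B \<Longrightarrow> c \<in> total B
      \<Longrightarrow> fstar B (fmult B b c) = fmult B (fstar B c) (fstar B b)"
    and fnorm_fstar_mult: "b \<in> total B \<Longrightarrow> fnorm B (fmult B (fstar B b) b) = (fnorm B b)\<^sup>2"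
    and positive: "b \<in> total B
      \<Longrightarrow> \<exists>a\<in>fibre B \<one>. fmult B (fstar B b) b = fmult B (fstar B a) a"

definition deformed_bundle ::
  "('g, 'n) monoid_scheme \<Rightarrow> ('g \<Rightarrow> 'g \<Rightarrow> complex) \<Rightarrow> ('g, 'b) fell_bundle \<Rightarrow> ('g, 'b) fell_bundle" where
  "deformed_bundle G \<sigma> B = B\<lparr>
     fmult := \<lambda>b c. fsmult B (\<sigma> (proj B b) (proj B c)) (fmult B b c),
     fstar := \<lambda>b. fsmult B (cnj (\<sigma> (proj B b) (inv\<^bsub>G\<^esub> proj B b))) (fstar B b)\<rparr>"

text \<open>
  The subspaces \<open>B\<^sub>g \<subseteq> C\<close> below need not be disjoint as sets, so that a point of the bundle is a pair
  \<open>(g, b)\<close> with \<open>b \<in> B\<^sub>g\<close>.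
\<close>

definition graph_fibre ::
  "'l kgraph \<Rightarrow> ('g, 'n) monoid_scheme \<Rightarrow> ('l \<Rightarrow> 'g) \<Rightarrow> 'c cstar \<Rightarrow> ('l \<Rightarrow> 'c) \<Rightarrow> 'g \<Rightarrow> 'c set" where
  "graph_fibre \<Lambda> G \<eta> C s g = closed_span C
     {s \<kappa> \<otimes>\<^bsub>C\<^esub> adj C (s \<mu>) | \<kappa> \<mu>. \<kappa> \<in> paths \<Lambda> \<and> \<mu> \<in> paths \<Lambda> \<and> \<eta> \<kappa> \<otimes>\<^bsub>G\<^esub> inv\<^bsub>G\<^esub> \<eta> \<mu> = g}"

definition graph_bundle ::
  "'l kgraph \<Rightarrow> ('g, 'n) monoid_scheme \<Rightarrow> ('l \<Rightarrow> 'g) \<Rightarrow> 'c cstar \<Rightarrow> ('l \<Rightarrow> 'c)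
     \<Rightarrow> ('g, 'g \<times> 'c) fell_bundle" where
  "graph_bundle \<Lambda> G \<eta> C s = \<lparr>
     total = Sigma (carrier G) (graph_fibre \<Lambda> G \<eta> C s),
     proj = fst,
     fzero = (\<lambda>g. (g, \<zero>\<^bsub>C\<^esub>)),
     fadd = (\<lambda>b c. (fst b, snd b \<oplus>\<^bsub>C\<^esub> snd c)),
     fsmult = (\<lambda>z b. (fst b, z \<odot>\<^bsub>C\<^esub> snd b)),
     fnorm = (\<lambda>b. nrm C (snd b)),
     fmult = (\<lambda>b c. (fst b \<otimes>\<^bsub>G\<^esub> fst c, snd b \<otimes>\<^bsub>C\<^esub> snd c)),
     fstar = (\<lambda>b. (inv\<^bsub>G\<^esub> fst b, adj C (snd b)))\<rparr>"

text \<open>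
  A family of maps \<open>\<pi>\<^sub>g\<close> on the fibres is given as a single map \<open>\<pi>\<close> on the total set.  The last conjunct
  is nondegeneracy of \<open>\<pi>\<^sub>e\<close>: the products \<open>\<pi>\<^sub>e(b) x\<close> span a dense subspace of \<open>D\<close>.
\<close>

definition fell_representation ::
  "('g, 'n) monoid_scheme \<Rightarrow> ('g, 'b) fell_bundle \<Rightarrow> 'd cstar \<Rightarrow> ('b \<Rightarrow> 'd) \<Rightarrow> bool" where
  "fell_representation G B D \<pi> \<longleftrightarrow>
     \<pi> \<in> total B \<rightarrow> carrier D \<and>
     (\<forall>g\<in>carrier G. \<forall>b\<in>fibre B g. \<forall>c\<in>fibre B g. \<pi> (fadd B b c) = \<pi> b \<oplus>\<^bsub>D\<^esub> \<pi> c) \<and>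
     (\<forall>b\<in>total B. \<forall>z. \<pi> (fsmult B z b) = z \<odot>\<^bsub>D\<^esub> \<pi> b) \<and>
     (\<forall>b\<in>total B. \<forall>c\<in>total B. \<pi> (fmult B b c) = \<pi> b \<otimes>\<^bsub>D\<^esub> \<pi> c) \<and>
     (\<forall>b\<in>total B. \<pi> (fstar B b) = adj D (\<pi> b)) \<and>
     closed_span D {\<pi> b \<otimes>\<^bsub>D\<^esub> x | b x. b \<in> fibre B \<one>\<^bsub>G\<^esub> \<and> x \<in> carrier D} = carrier D"

text \<open>
  \<open>is_fell_bundle_algebra G B D \<pi>\<close> says that \<open>D\<close> is (a copy of) \<open>C\<^sup>*(B)\<close> with universal representation
  \<open>\<pi>\<close>.  As for \<^const>\<open>is_kgraph_algebra\<close>, letting the universal property range over the C*-algebras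
  carried by subsets of the type of \<open>D\<close> is no restriction for the bundles obtained from a
  countable \<open>\<Lambda>\<close>: their fibres are separable, and only countably many of them are non-zero.
\<close>

definition is_fell_bundle_algebra ::
  "('g, 'n) monoid_scheme \<Rightarrow> ('g, 'b) fell_bundle \<Rightarrow> 'd cstar \<Rightarrow> ('b \<Rightarrow> 'd) \<Rightarrow> bool" where
  "is_fell_bundle_algebra G B D \<pi> \<longleftrightarrow>
     cstar_algebra_on D \<and>
     fell_representation G B D \<pi> \<and>
     cstar_generates D (\<pi> ` total B) \<and>
     (\<forall>(E :: 'd cstar) \<rho>. cstar_algebra_on E \<and> fell_representation G B E \<rho> \<longrightarrow>
        (\<exists>\<phi>. star_hom D E \<phi> \<and> (\<forall>b\<in>total B. \<phi> (\<pi> b) = \<rho> b)))"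

end

theory Submission
  imports Defs
begin

text \<open>
  Both \<open>t\<close> and \<open>T\<close> are twisted Cuntz--Krieger families with non-zero vertex projections, and
  aperiodicity alone forces \<open>\<pi>\<^sub>T\<close> to be isometric on the span of the monomials \<open>t\<^sub>\<kappa> t\<^sub>\<mu>\<^sup>*\<close>; this span is
  dense and \<open>\<pi>\<^sub>T\<close> is contractive.  Grade the monomials by \<open>d(\<kappa>) - d(\<mu>)\<close>.  The part \<open>x\<^sub>0\<close> of degree \<open>0\<close>
  of an element \<open>x\<close> of the span lies in a sum of matrix algebras indexed by vertices, and aperiodicity
  provides, for each vertex, a compression in the range of \<open>\<pi>\<^sub>T\<close> that kills the parts of non-zero degree
  and preserves the norm of the corresponding block, so that \<open>\<parallel>x\<^sub>0\<parallel> \<le> \<parallel>\<pi>\<^sub>T x\<parallel>\<close>.  Applied to \<open>x\<^sub>n\<^sup>* x\<close> this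
  bounds every homogeneous part \<open>x\<^sub>n\<close>.  No gauge action is needed to reassemble \<open>x\<close>: an element with degrees in a box of
  size \<open>R\<close> satisfies \<open>\<parallel>x\<parallel> \<le> (2R+1)\<^sup>k \<parallel>\<pi>\<^sub>T x\<parallel>\<close>, and the polynomial factor disappears on passing to the
  elements \<open>(x\<^sup>*x)\<^sup>m\<close> with \<open>m = 2\<^sup>j\<close> and taking roots.
\<close>

section \<open>Elementary C*-algebra theory\<close>

text \<open>The inequality to prove is \<open>norm x \<le> norm (\<phi> x)\<close> on the monomial
  span, for one homomorphism \<phi> with \<open>\<phi> (T v) \<noteq> 0\<close>. The obstacle is
  that no expectation onto the degree-0 part is at hand beforehand in either algebra. It is replaced
  by compressions \<open>P * x * P\<close> built from paths of the graph, which \<phi> maps to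
  compressions by projections again. A finite level of the core is a direct sum of matrix blocks,
  one for each source vertex, and a path compresses only the block of its own range; so each block
  gets its own path, and a common bound for the blocks controls the level. The norm of a block is
  never computed: estimating by entries loses a factor that counts entries, and repeated squaring,
  the device that later absorbs the number of degrees, removes it. The cocycle changes products only
  by scalars of modulus one, so the estimates are made for arbitrary scalars of that kind.\<close>

lemma scaleC_zero_left [simp]: "scaleC 0 (x :: 'a::cstar_algebra) = 0"
  using scaleC_add_left[of 0 0 x] by simp

lemma scaleC_zero_right [simp]: "scaleC c (0 :: 'a::cstar_algebra) = 0"
  using scaleC_add_right[of c 0 "0::'a"] by simp

lemma scaleC_one [simp]: "scaleC 1 (x :: 'a::cstar_algebra) = x"
  using scaleC_of_real[of 1 x] by simp

lemma scaleC_minus_right [simp]: "scaleC c (- x :: 'a::cstar_algebra) = - scaleC c x"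
  using scaleC_add_right[of c x "- x"] by (simp add: eq_neg_iff_add_eq_0 add.commute)

lemma scaleC_diff_right: "scaleC c (x - y :: 'a::cstar_algebra) = scaleC c x - scaleC c y"
  using scaleC_add_right[of c x "- y"] by simp

lemma scaleC_minus_left [simp]: "scaleC (- c) (x :: 'a::cstar_algebra) = - scaleC c x"
  using scaleC_add_left[of c "- c" x] by (simp add: eq_neg_iff_add_eq_0 add.commute)

lemma scaleC_scaleR: "scaleC c (r *\<^sub>R x :: 'a::cstar_algebra) = r *\<^sub>R scaleC c x"
  by (simp add: scaleC_of_real[symmetric] scaleC_scaleC mult.commute)

lemma star_zero [simp]: "star (0 :: 'a::cstar_algebra) = 0"
  using star_add[of 0 "0::'a"] by simp

lemma star_minus [simp]: "star (- x :: 'a::cstar_algebra) = - star x"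
  using star_add[of x "- x"] by (simp add: eq_neg_iff_add_eq_0 add.commute)

lemma star_diff: "star (x - y :: 'a::cstar_algebra) = star x - star y"
  using star_add[of x "- y"] by simp

lemma star_scaleR: "star (r *\<^sub>R x :: 'a::cstar_algebra) = r *\<^sub>R star x"
  by (simp add: scaleC_of_real[symmetric] star_scaleC)

lemma star_sum: "star (\<Sum>i\<in>I. f i :: 'a::cstar_algebra) = (\<Sum>i\<in>I. star (f i))"
  by (induction I rule: infinite_finite_induct) (auto simp: star_add)

lemma norm_star [simp]: "norm (star x :: 'a::cstar_algebra) = norm x"
proof -
  have "norm x \<le> norm (star x)" for x :: 'a
  proof (cases "norm x = 0")
    case False
    have "norm x * norm x \<le> norm (star x) * norm x"
      using norm_mult_ineq[of "star x" x] by (simp add: norm_star_mult_self power2_eq_square)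
    then show ?thesis using False by simp
  qed simp
  from this[of x] this[of "star x"] show ?thesis by (simp add: star_star)
qed

lemma norm_self_adjoint_square: "star x = x \<Longrightarrow> norm (x * x :: 'a::cstar_algebra) = (norm x)\<^sup>2"
  using norm_star_mult_self[of x] by simp

lemma norm_projection:
  fixes p :: "'a::cstar_algebra"
  assumes "star p = p" "p * p = p" "p \<noteq> 0"
  shows "norm p = 1"
  using norm_self_adjoint_square[OF assms(1)] assms(2,3)
  by (simp add: power2_eq_square)

lemma norm_projection_le_one:
  fixes p :: "'a::cstar_algebra"
  assumes "star p = p" "p * p = p"
  shows "norm p \<le> 1"
  using norm_projection[OF assms] by (cases "p = 0") auto

lemma bounded_linear_star: "bounded_linear (star :: 'a::cstar_algebra \<Rightarrow> 'a)"
  by (rule bounded_linear_intro[where K = 1]) (auto simp: star_add star_scaleR)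

lemma bounded_linear_scaleC: "bounded_linear (scaleC c :: 'a::cstar_algebra \<Rightarrow> 'a)"
  by (rule bounded_linear_intro[where K = "cmod c"])
     (auto simp: scaleC_add_right scaleC_scaleR norm_scaleC)

lemmas continuous_on_star = bounded_linear.continuous_on[OF bounded_linear_star]

section \<open>Square roots, contractivity and positivity in algebras without a unit\<close>

definition star_subalgebra :: "'a::cstar_algebra set \<Rightarrow> bool" where
  "star_subalgebra M \<longleftrightarrow> subspace M \<and> (\<forall>x\<in>M. \<forall>y\<in>M. x * y \<in> M) \<and> (\<forall>x\<in>M. star x \<in> M)"

text \<open>
  \<open>1 - k\<close> is a square root of \<open>1 - y\<close>; the equation \<open>k = (y + k\<^sup>2) / 2\<close> is solved by iteration, which
  needs no unit.
\<close>
lemma square_root_ex: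
  fixes y :: "'a::cstar_algebra"
  assumes M: "star_subalgebra M" "closed M" and y: "y \<in> M" "star y = y" "norm y < 1"
  obtains k where "k \<in> M" "star k = k" "\<forall>z. y * z = z * y \<longrightarrow> k * z = z * k" "k + k = y + k * k"
proof -
  \<comment> \<open>The conditions defining \<open>S\<close> are closed and preserved by
    \<open>f\<close>, so the fixed point inherits them. The bound by \<open>norm y\<close> makes
    \<open>f\<close> a self-map and a contraction with constant \<open>norm y < 1\<close>.\<close>
  define S where "S = M \<inter> {k. star k = k} \<inter> cball 0 (norm y) \<inter>
    (\<Inter>z\<in>{z. y * z = z * y}. {k. k * z = z * k})"
  define f where "f k = (1/2) *\<^sub>R (y + k * k)" for k
  have "closed {k :: 'a. star k = k}"
    by (intro closed_Collect_eq continuous_on_star continuous_on_id)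
  moreover have "closed {k. k * z = z * k}" for z :: 'a
    by (intro closed_Collect_eq continuous_on_mult_left continuous_on_mult_right continuous_on_id)
  ultimately have "closed S"
    unfolding S_def using M(2) by (simp add: closed_Int closed_INT)
  then have S: "complete S"
    by (simp add: complete_eq_closed)
  have M0: "0 \<in> M" and Madd: "\<And>a b. a \<in> M \<Longrightarrow> b \<in> M \<Longrightarrow> a + b \<in> M"
    and Mscale: "\<And>r a. a \<in> M \<Longrightarrow> r *\<^sub>R a \<in> M" and Mmult: "\<And>a b. a \<in> M \<Longrightarrow> b \<in> M \<Longrightarrow> a * b \<in> M"
    using M(1) by (auto simp: star_subalgebra_def subspace_def)
  have S_iff: "k \<in> S \<longleftrightarrow> k \<in> M \<and> star k = k \<and> norm k \<le> norm y \<and> (\<forall>z. y * z = z * y \<longrightarrow> k * z = z * k)" for k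
    unfolding S_def Int_iff INT_iff mem_Collect_eq mem_cball_0 by blast
  have "0 \<in> S"
    by (simp add: S_iff M0)
  then have ne: "S \<noteq> {}" by blast
  have fS: "f k \<in> S" if k: "k \<in> S" for k
  proof -
    have kn: "norm k \<le> norm y" and kM: "k \<in> M" and sk: "star k = k" using k by (simp_all only: S_iff)
    have "norm (k * k) \<le> norm k * norm k" by (rule norm_mult_ineq)
    also have "\<dots> \<le> norm y * norm y" using kn by (intro mult_mono) simp_all
    also have "\<dots> \<le> norm y"
      using y(3) by (simp add: mult_left_le)
    finally have "norm (y + k * k) \<le> 2 * norm y"
      using norm_triangle_ineq[of y "k * k"] by simp
    then have "norm (f k) \<le> norm y"
      by (simp add: f_def)
    moreover have "f k * z = z * f k" if z: "y * z = z * y" for z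
    proof -
      have "k * z = z * k" using k z by (simp only: S_iff)
      then have "k * k * z = z * (k * k)"
        by (simp add: mult.assoc) (simp add: mult.assoc[symmetric])
      then show ?thesis using z by (simp add: f_def distrib_left distrib_right)
    qed
    moreover have "star (f k) = f k" "f k \<in> M"
      by (simp_all add: f_def star_scaleR star_add star_mult sk y kM Madd Mscale Mmult)
    ultimately show ?thesis
      by (simp only: S_iff) blast
  qed
  have contr: "dist (f k) (f l) \<le> norm y * dist k l" if "k \<in> S" "l \<in> S" for k l
  proof -
    have "f k - f l = (1/2) *\<^sub>R (k * (k - l) + (k - l) * l)"
      by (simp add: f_def algebra_simps)
    then have "norm (f k - f l) \<le> (1/2) * (norm (k * (k - l)) + norm ((k - l) * l))"
      using norm_triangle_ineq[of "k * (k - l)" "(k - l) * l"] by simp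
    also have "\<dots> \<le> (1/2) * (norm k * norm (k - l) + norm (k - l) * norm l)"
      by (intro mult_left_mono add_mono norm_mult_ineq) auto
    also have "\<dots> \<le> (1/2) * (norm y * norm (k - l) + norm (k - l) * norm y)"
      using that by (intro mult_left_mono add_mono mult_right_mono) (simp_all add: S_iff)
    finally show ?thesis
      by (simp add: dist_norm algebra_simps)
  qed
  obtain k where k: "k \<in> S" "f k = k"
    using Banach_fix[OF S ne _ y(3), of f] fS contr by (auto simp: image_subset_iff)
  show ?thesis
  proof
    show "k \<in> M" "star k = k" "\<forall>z. y * z = z * y \<longrightarrow> k * z = z * k"
      using k(1) by (simp_all only: S_iff) blast
    have "k + k = 2 *\<^sub>R f k" by (simp add: k(2) scaleR_2)
    also have "\<dots> = y + k * k" by (simp add: f_def)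
    finally show "k + k = y + k * k" .
  qed
qed

text \<open>In a unitisation the hypothesis on \<open>b + b\<close> reads
  \<open>a^2 + (1 - b)^2 = 1\<close>, so \<open>1 - b + i a\<close> and \<open>1 - b - i a\<close>
  are unitary and \<open>a\<close> is the imaginary part of a unitary. The unitaries are replaced by
  the isometric maps sending \<open>x\<close> to \<open>x + (scaleC z a - b) * x\<close>, with
  \<open>z\<close> one of i and -i.\<close>

lemma norm_le_one_of_circle:
  fixes a b :: "'a::cstar_algebra"
  assumes a: "star a = a" and b: "star b = b" and ab: "a * b = b * a" and sum: "b + b = a * a + b * b"
  shows "norm a \<le> 1"
proof -
  have iso: "norm (x + (scaleC z a - b) * x) = norm x" if z: "cnj z * z = 1" "cnj z + z = 0" for x z
  proof -
    define v where "v = scaleC z a - b"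
    have sv: "star v = scaleC (cnj z) a - b"
      by (simp add: v_def star_diff star_scaleC a b)
    have "star v * v = (scaleC (cnj z) a - b) * (scaleC z a - b)"
      unfolding sv by (simp only: v_def)
    also have "\<dots> = scaleC (cnj z * z) (a * a) - scaleC (cnj z + z) (a * b) + b * b"
      unfolding left_diff_distrib right_diff_distrib mult_scaleC_left scaleC_diff_right
          mult_scaleC_right scaleC_scaleC scaleC_add_left ab by (simp add: mult.commute)
    finally have "star v * v = a * a + b * b"
      by (simp add: z)
    moreover have "v + star v = scaleC (cnj z + z) a - (b + b)"
      unfolding sv by (simp add: v_def scaleC_add_left)
    ultimately have "star v * v + v + star v = 0"
      using sum by (simp add: z add.assoc)
    moreover have "star (x + v * x) * (x + v * x) = star x * x + star x * (star v * v + v + star v) * x"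
      by (simp add: star_add star_mult algebra_simps)
    ultimately have "(norm (x + v * x))\<^sup>2 = (norm x)\<^sup>2"
      by (simp only: norm_star_mult_self[symmetric]) simp
    then show ?thesis by (simp add: v_def)
  qed
  \<comment> \<open>The two isometric images of \<open>a\<close> itself differ by
    \<open>2 i a^2\<close>, so that \<open>(norm a)^2 \<le> norm a\<close>.\<close>
  have "(a + (scaleC \<i> a - b) * a) - (a + (scaleC (- \<i>) a - b) * a) = scaleC (2 * \<i>) (a * a)"
    using scaleC_add_left[of \<i> \<i> "a * a"] by (simp add: left_diff_distrib mult_scaleC_left)
  then have "norm (scaleC (2 * \<i>) (a * a)) \<le> norm a + norm a"
    using norm_triangle_ineq4[of "a + (scaleC \<i> a - b) * a" "a + (scaleC (- \<i>) a - b) * a"]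
    using iso[of \<i> a] iso[of "- \<i>" a] by simp
  then have "(norm a)\<^sup>2 \<le> norm a"
    using norm_self_adjoint_square[OF a] by (simp add: norm_scaleC norm_mult)
  then show ?thesis
    by (cases "a = 0") (auto simp: power2_eq_square)
qed

text \<open>An algebraic identity replaces spectral theory: \<open>h = star x * x / r^2\<close> has
  norm below 1, there is \<open>k\<close> with \<open>(1 - k)^2 = 1 - h^2\<close> (written without a
  unit), and \<phi> transports this relation to \<open>\<phi> h\<close> and \<open>\<phi> k\<close>,
  where \<open>norm_le_one_of_circle\<close> applies. The domain is a closed subalgebra
  \<open>M\<close> because the unit fibre of the bundle is one of the applications.\<close>

lemma star_homomorphism_contractive:
  fixes \<phi> :: "'a::cstar_algebra \<Rightarrow> 'b::cstar_algebra"
  assumes M: "star_subalgebra M" "closed M"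
    and add: "\<And>x y. x \<in> M \<Longrightarrow> y \<in> M \<Longrightarrow> \<phi> (x + y) = \<phi> x + \<phi> y"
    and scale: "\<And>x r. x \<in> M \<Longrightarrow> \<phi> (r *\<^sub>R x) = r *\<^sub>R \<phi> x"
    and mult: "\<And>x y. x \<in> M \<Longrightarrow> y \<in> M \<Longrightarrow> \<phi> (x * y) = \<phi> x * \<phi> y"
    and star: "\<And>x. x \<in> M \<Longrightarrow> \<phi> (star x) = star (\<phi> x)"
    and x: "x \<in> M"
  shows "norm (\<phi> x) \<le> norm x"
proof (rule dense_ge)
  fix r assume r: "norm x < r"
  then have r0: "r > 0" by (meson norm_ge_zero order_le_less_trans)
  define h where "h = (1 / r\<^sup>2) *\<^sub>R (star x * x)"
  have Mscale: "\<And>r a. a \<in> M \<Longrightarrow> r *\<^sub>R a \<in> M" and Mmult: "\<And>a b. a \<in> M \<Longrightarrow> b \<in> M \<Longrightarrow> a * b \<in> M"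
    and Mstar: "\<And>a. a \<in> M \<Longrightarrow> star a \<in> M"
    using M(1) by (auto simp: star_subalgebra_def subspace_def)
  have h: "h \<in> M" "star h = h"
    using x by (auto simp: h_def Mscale Mmult Mstar star_scaleR star_mult star_star)
  have "(norm x)\<^sup>2 < r\<^sup>2"
    using r by (intro power_strict_mono) auto
  moreover have "norm h = (norm x)\<^sup>2 / r\<^sup>2"
    by (simp add: h_def norm_star_mult_self)
  ultimately have "norm h < 1"
    using r0 by (simp add: divide_less_eq)
  then have hh: "norm (h * h) < 1"
    using norm_self_adjoint_square[OF h(2)] abs_square_less_1[of "norm h"] by simp
  have "h * h \<in> M" "star (h * h) = h * h" by (simp_all add: star_mult h Mmult)
  from square_root_ex[OF M this hh] obtain k where k: "k \<in> M" "star k = k"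
    "\<forall>z. h * h * z = z * (h * h) \<longrightarrow> k * z = z * k" "k + k = h * h + k * k"
    .
  have "norm (\<phi> h) \<le> 1"
  proof (rule norm_le_one_of_circle[of _ "\<phi> k"])
    show "star (\<phi> h) = \<phi> h" "star (\<phi> k) = \<phi> k"
      using star[OF h(1)] star[OF k(1)] h(2) k(2) by simp_all
    have "k * h = h * k" by (rule k(3)[rule_format]) (simp add: mult.assoc)
    then show "\<phi> h * \<phi> k = \<phi> k * \<phi> h"
      using mult[OF h(1) k(1)] mult[OF k(1) h(1)] by simp
    have "\<phi> (k + k) = \<phi> (h * h + k * k)" by (simp only: k(4))
    then show "\<phi> k + \<phi> k = \<phi> h * \<phi> h + \<phi> k * \<phi> k"
      by (simp add: add mult h(1) k(1) Mmult)
  qed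
  moreover have "\<phi> h = (1 / r\<^sup>2) *\<^sub>R (star (\<phi> x) * \<phi> x)"
    using x by (simp add: h_def scale Mmult Mstar mult star)
  ultimately have "(norm (\<phi> x))\<^sup>2 / r\<^sup>2 \<le> 1"
    by (simp add: norm_star_mult_self)
  then have "(norm (\<phi> x))\<^sup>2 \<le> r\<^sup>2"
    using r0 by (simp add: divide_le_eq)
  then show "norm (\<phi> x) \<le> r"
    by (rule power2_le_imp_le) (use r0 in simp)
qed

text \<open>
  The hypotheses say \<open>0 \<le> h \<le> 2e\<close> and \<open>-2m e \<le> h \<le> 0\<close>.  For \<open>s < 1\<close> there are commuting square roots
  \<open>w, u\<close> of \<open>e - s (e - h)\<close> and \<open>e - s (e + h/m)\<close>, and \<open>w\<^sup>2 + m u\<^sup>2\<close> tends to \<open>0\<close> as \<open>s\<close> tends to \<open>1\<close>.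
\<close>
lemma positive_and_negative_imp_zero:
  fixes e h :: "'a::cstar_algebra" and m :: real
  assumes e: "star e = e" "e * e = e" and h: "star h = h" "e * h = h" "h * e = h"
    and m: "m > 0" and pos: "norm (e - h) \<le> 1" and neg: "norm (m *\<^sub>R e + h) \<le> m"
  shows "h = 0"
proof -
  \<comment> \<open>The corner of \<open>e\<close>: there \<open>e\<close> is a unit, so that
    \<open>e - k\<close>, with \<open>k\<close> from \<open>square_root_ex\<close>, is a genuine
    square root.\<close>
  define M where "M = {x :: 'a. e * x = x \<and> x * e = x}"
  have M: "star_subalgebra M"
    unfolding star_subalgebra_def
  proof (intro conjI ballI)
    show "subspace M" by (auto simp: M_def subspace_def algebra_simps)
    fix x assume "x \<in> M"
    then show "star x \<in> M"
      using e(1) star_mult[of e x] star_mult[of x e] by (auto simp: M_def)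
    fix y assume "y \<in> M"
    then show "x * y \<in> M" using \<open>x \<in> M\<close> by (simp add: M_def mult.assoc) (simp add: mult.assoc[symmetric])
  qed
  have "closed M"
    unfolding M_def by (intro closed_Collect_conj closed_Collect_eq continuous_intros)
  have eM: "e \<in> M" and hM: "h \<in> M" using e h by (auto simp: M_def)
  have est: "s * norm h \<le> (1 - s) * (2 + m)" if s: "0 < s" "s < 1" for s
  proof -
    define a where "a = s *\<^sub>R (e - h)"
    define b where "b = s *\<^sub>R (e + (1/m) *\<^sub>R h)"
    have aM: "a \<in> M" "b \<in> M"
      using M eM hM by (auto simp: a_def b_def star_subalgebra_def subspace_add subspace_diff subspace_scale)
    have sa: "star a = a" "star b = b"
      by (simp_all add: a_def b_def star_scaleR star_diff star_add e h)
    have "norm a \<le> s" using pos s by (simp add: a_def)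
    then have na: "norm a < 1" using s by simp
    have "e + (1/m) *\<^sub>R h = (1/m) *\<^sub>R (m *\<^sub>R e + h)"
      using m by (simp add: algebra_simps)
    then have "norm (e + (1/m) *\<^sub>R h) \<le> 1"
      using neg m by simp
    then have "norm b \<le> s" using s by (simp add: b_def)
    then have nb: "norm b < 1" using s by simp
    obtain k where k: "k \<in> M" "star k = k" "\<forall>z. a * z = z * a \<longrightarrow> k * z = z * k" "k + k = a + k * k"
      using square_root_ex[OF M \<open>closed M\<close> aM(1) sa(1) na] .
    obtain l where l: "l \<in> M" "star l = l" "\<forall>z. b * z = z * b \<longrightarrow> l * z = z * l" "l + l = b + l * l"
      using square_root_ex[OF M \<open>closed M\<close> aM(2) sa(2) nb] .
    define w where "w = e - k"
    define v where "v = sqrt m *\<^sub>R (e - l)"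
    have "a * b = b * a"
      using eM hM by (simp add: a_def b_def M_def algebra_simps)
    then have "k * b = b * k" by (rule k(3)[rule_format])
    then have "k * l = l * k" using l(3)[rule_format, of k] by simp
    then have wv: "w * v = v * w"
      using k(1) l(1) e by (simp add: w_def v_def M_def algebra_simps)
    have sw: "star w = w" "star v = v"
      by (simp_all add: w_def v_def star_diff star_scaleR e k l)
    have "w * w = e - (k + k) + k * k"
      using k(1) e by (simp add: w_def M_def algebra_simps)
    then have ww: "w * w = e - a" using k(4) by simp
    have "v * v = m *\<^sub>R (e - (l + l) + l * l)"
      using l(1) e m by (simp add: v_def M_def algebra_simps)
    then have vv: "v * v = m *\<^sub>R (e - b)" using l(4) by simp
    \<comment> \<open>The weight \<open>m\<close> makes the terms in \<open>h\<close> cancel. As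
      \<open>w\<close> and \<open>v\<close> commute, this sum also equals \<open>star u * u\<close>
      for \<open>u = w + scaleC z v\<close> with \<open>z\<close> one of i and -i; so both such
      \<open>u\<close>, and with them \<open>w\<close>, tend to 0 as \<open>s\<close> tends to
      1.\<close>
    have sum: "w * w + v * v = ((1 - s) * (1 + m)) *\<^sub>R e"
      unfolding ww vv using m by (simp add: a_def b_def algebra_simps)
    have ne: "norm e \<le> 1" using e by (rule norm_projection_le_one)
    have wn: "norm (w + scaleC z v) \<le> sqrt ((1 - s) * (1 + m))" if z: "cnj z + z = 0" "cnj z * z = 1" for z
    proof -
      have "star (w + scaleC z v) * (w + scaleC z v)
          = w * w + scaleC (cnj z + z) (w * v) + scaleC (cnj z * z) (v * v)"
        unfolding star_add star_scaleC sw distrib_left distrib_right mult_scaleC_left scaleC_add_right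
            mult_scaleC_right scaleC_scaleC scaleC_add_left wv by (simp add: mult.commute)
      also have "\<dots> = ((1 - s) * (1 + m)) *\<^sub>R e" by (simp add: z sum)
      finally have "(norm (w + scaleC z v))\<^sup>2 = (1 - s) * (1 + m) * norm e"
        using s m by (simp add: norm_star_mult_self[symmetric])
      also have "\<dots> \<le> (1 - s) * (1 + m)"
        using s m ne by (simp add: mult_left_le)
      finally show ?thesis by (rule real_le_rsqrt)
    qed
    have "norm (w + w) \<le> norm (w + scaleC \<i> v) + norm (w + scaleC (-\<i>) v)"
      using norm_triangle_ineq[of "w + scaleC \<i> v" "w + scaleC (-\<i>) v"] by simp
    also have "\<dots> \<le> 2 * sqrt ((1 - s) * (1 + m))"
      using wn[of \<i>] wn[of "- \<i>"] by simp
    finally have "norm w \<le> sqrt ((1 - s) * (1 + m))"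
      by (simp add: scaleR_2[symmetric])
    then have "(norm w)\<^sup>2 \<le> (sqrt ((1 - s) * (1 + m)))\<^sup>2"
      by (rule power_mono) simp
    also have "\<dots> = (1 - s) * (1 + m)"
      using s m by (intro real_sqrt_pow2) simp
    finally have "(norm w)\<^sup>2 \<le> (1 - s) * (1 + m)" .
    then have "norm ((1 - s) *\<^sub>R e + s *\<^sub>R h) \<le> (1 - s) * (1 + m)"
      using norm_self_adjoint_square[OF sw(1)] by (simp add: ww a_def algebra_simps)
    then have "norm (s *\<^sub>R h) \<le> (1 - s) * (1 + m) + norm ((1 - s) *\<^sub>R e)"
      using norm_triangle_ineq4[of "(1 - s) *\<^sub>R e + s *\<^sub>R h" "(1 - s) *\<^sub>R e"] by simp
    also have "\<dots> \<le> (1 - s) * (1 + m) + (1 - s)"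
      using s ne by (simp add: mult_left_le)
    finally show ?thesis using s by (simp add: algebra_simps)
  qed
  have "((\<lambda>s. s * norm h) \<longlongrightarrow> 1 * norm h) (at_left 1)"
    by (intro tendsto_intros)
  moreover have "((\<lambda>s. (1 - s) * (2 + m)) \<longlongrightarrow> (1 - 1) * (2 + m)) (at_left 1)"
    by (intro tendsto_intros)
  moreover have "\<forall>\<^sub>F s in at_left 1. s * norm h \<le> (1 - s) * (2 + m)"
    unfolding eventually_at_left_field using est by (intro exI[of _ 0]) auto
  ultimately have "1 * norm h \<le> (1 - 1) * (2 + m)"
    by (intro tendsto_le) auto
  then show ?thesis by simp
qed

text \<open>For self-adjoint \<open>h\<close> in the corner of \<open>e\<close>,
  \<open>norm (e - h) \<le> 1\<close> encodes \<open>0 \<le> h \<le> 2 e\<close>. If the sum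
  vanishes, \<open>h i\<close> is minus the sum of the other \<open>m\<close> terms, hence also
  negative, with \<open>norm (m e + h i) \<le> m\<close>.\<close>

lemma sum_of_positive_eq_zero:
  fixes e :: "'a::cstar_algebra" and h :: "'i \<Rightarrow> 'a"
  assumes e: "star e = e" "e * e = e"
    and h: "\<And>i. i \<in> I \<Longrightarrow> star (h i) = h i" "\<And>i. i \<in> I \<Longrightarrow> e * h i = h i" "\<And>i. i \<in> I \<Longrightarrow> h i * e = h i"
    and pos: "\<And>i. i \<in> I \<Longrightarrow> norm (e - h i) \<le> 1"
    and I: "finite I" "i \<in> I" and sum: "(\<Sum>i\<in>I. h i) = 0"
  shows "h i = 0"
proof -
  define m where "m = real (card (I - {i}))"
  have hi: "h i = - (\<Sum>j\<in>I - {i}. h j)"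
    using sum I by (simp add: sum.remove[of I i] eq_neg_iff_add_eq_0)
  show ?thesis
  proof (cases "I - {i} = {}")
    case False
    then have "m > 0" using I(1) unfolding m_def of_nat_0_less_iff card_gt_0_iff by blast
    have "m *\<^sub>R e + h i = (\<Sum>j\<in>I - {i}. e - h j)"
      by (simp add: hi m_def sum_subtractf sum_constant_scaleR)
    also have "norm \<dots> \<le> m"
      using sum_norm_le[of "I - {i}" "\<lambda>j. e - h j" "\<lambda>_. 1"] pos by (simp add: m_def)
    finally show ?thesis
      by (rule positive_and_negative_imp_zero[OF e h[OF I(2)] \<open>m > 0\<close> pos[OF I(2)]])
  next
    case True
    show ?thesis unfolding hi True by simp
  qed
qed

text \<open>In a unitisation \<open>1 - 2 q\<close> is unitary, so \<open>x - 2 q x\<close> has the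
  norm of \<open>x\<close>, and \<open>x - q x\<close> is the mean of the two.\<close>

lemma norm_diff_projection_le:
  fixes q x :: "'a::cstar_algebra"
  assumes q: "star q = q" "q * q = q"
  shows "norm (x - q * x) \<le> norm x"
proof -
  have qq: "q * (q * x) = q * x" by (simp add: mult.assoc[symmetric] q)
  have "star (x - 2 *\<^sub>R (q * x)) * (x - 2 *\<^sub>R (q * x)) = star x * x"
    by (simp add: star_diff star_scaleR star_mult q algebra_simps qq scaleR_left_distrib[symmetric])
  then have "(norm (x - 2 *\<^sub>R (q * x)))\<^sup>2 = (norm x)\<^sup>2"
    by (simp only: norm_star_mult_self[symmetric])
  then have "norm (x - 2 *\<^sub>R (q * x)) = norm x" by simp
  then have "norm (x + (x - 2 *\<^sub>R (q * x))) \<le> 2 * norm x"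
    using norm_triangle_ineq[of x "x - 2 *\<^sub>R (q * x)"] by simp
  moreover have "x + (x - 2 *\<^sub>R (q * x)) = 2 *\<^sub>R (x - q * x)"
    by (simp add: algebra_simps scaleR_2)
  ultimately show ?thesis by simp
qed

section \<open>Sharpening norm bounds by repeated squaring\<close>

text \<open>These are the powers of \<open>star x * x\<close> with exponents \<open>2 ^ j\<close>:
  for a self-adjoint element the norm of the square is exactly the square of the norm.\<close>

primrec iterated_square :: "'a::cstar_algebra \<Rightarrow> nat \<Rightarrow> 'a" where
  "iterated_square x 0 = star x * x"
| "iterated_square x (Suc j) = iterated_square x j * iterated_square x j"

lemma star_iterated_square: "star (iterated_square x j) = iterated_square x j"
  by (induction j) (auto simp: star_mult star_star)

lemma norm_iterated_square: "norm (iterated_square x j) = norm x ^ (2 ^ Suc j)"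
proof (induction j)
  case (Suc j)
  show ?case
    using norm_self_adjoint_square[OF star_iterated_square, of x j] Suc
    by (simp add: power_mult[symmetric] mult.commute)
qed (simp add: norm_star_mult_self)

text \<open>A bound that is lossy by a subexponential factor is sharpened by passing to large powers.\<close>
lemma norm_le_of_iterated_square_bound:
  fixes x :: "'a::cstar_algebra" and K C R :: real
  assumes K: "K \<ge> 0" and bound: "\<And>j. norm (iterated_square x j) \<le> C * R ^ j * K ^ (2 ^ Suc j)"
  shows "norm x \<le> K"
proof (rule dense_ge)
  fix L assume "K < L"
  show "norm x \<le> L"
  proof (rule ccontr)
    assume "\<not> norm x \<le> L"
    then have L: "L < norm x" by simp
    have L0: "L > 0" using \<open>K < L\<close> K by simp
    define q where "q = norm x / L"
    have q: "q > 1" using L L0 by (simp add: q_def)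
    have qb: "q ^ (2 ^ Suc j) \<le> \<bar>C\<bar> * \<bar>R\<bar> ^ j" for j
    proof -
      have "norm x ^ (2 ^ Suc j) \<le> C * R ^ j * K ^ (2 ^ Suc j)"
        using bound[of j] by (simp only: norm_iterated_square)
      also have "\<dots> \<le> \<bar>C * R ^ j\<bar> * K ^ (2 ^ Suc j)"
        by (rule mult_right_mono[OF abs_ge_self]) (simp add: K)
      also have "\<dots> \<le> \<bar>C * R ^ j\<bar> * L ^ (2 ^ Suc j)"
        using K \<open>K < L\<close> by (intro mult_left_mono power_mono abs_ge_zero) simp_all
      finally have "norm x ^ (2 ^ Suc j) / L ^ (2 ^ Suc j) \<le> \<bar>C * R ^ j\<bar>"
        by (subst pos_divide_le_eq) (use L0 in simp_all)
      then show ?thesis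
        by (simp only: q_def power_divide abs_mult power_abs)
    qed
    \<comment> \<open>Makes \<open>q ^ (2 ^ Suc j)\<close> at least \<open>(q ^ j) ^ j\<close>. Once
      \<open>q ^ j\<close> has reached \<open>2 * (\<bar>R\<bar> + 1)\<close> and
      \<open>2 ^ j\<close> exceeds \<open>\<bar>C\<bar>\<close>, this beats
      \<open>\<bar>C\<bar> * \<bar>R\<bar> ^ j\<close>.\<close>
    have sq: "j * j \<le> 2 ^ Suc j" for j :: nat
    proof (induction j)
      case (Suc j)
      have "2 * j + 1 \<le> 2 ^ Suc j"
      proof (induction j)
        case (Suc j)
        have "2 * j + 1 \<le> 2 * p \<Longrightarrow> 1 \<le> p \<Longrightarrow> 2 * Suc j + 1 \<le> 2 * (2 * p)" for p :: nat by arith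
        from this[of "2 ^ j"] Suc show ?case by simp
      qed simp
      with Suc show ?case by simp
    qed simp
    obtain j1 where j1: "2 * (\<bar>R\<bar> + 1) < q ^ j1"
      using real_arch_pow[OF q] by blast
    obtain j2 where j2: "\<bar>C\<bar> < 2 ^ j2"
      using real_arch_pow[of "2::real" "\<bar>C\<bar>"] by auto
    define j where "j = max j1 j2"
    have "2 ^ j2 \<le> (2::real) ^ j" "q ^ j1 \<le> q ^ j"
      using q by (intro power_increasing; simp add: j_def)+
    with j1 j2 have "\<bar>C\<bar> < 2 ^ j" and qj: "2 * (\<bar>R\<bar> + 1) \<le> q ^ j"
      by linarith+
    from \<open>\<bar>C\<bar> < 2 ^ j\<close> have "\<bar>C\<bar> * \<bar>R\<bar> ^ j \<le> \<bar>C\<bar> * (\<bar>R\<bar> + 1) ^ j" "\<bar>C\<bar> * (\<bar>R\<bar> + 1) ^ j < 2 ^ j * (\<bar>R\<bar> + 1) ^ j"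
      by (simp_all add: mult_left_mono power_mono)
    then have "\<bar>C\<bar> * \<bar>R\<bar> ^ j < 2 ^ j * (\<bar>R\<bar> + 1) ^ j" by (rule order_le_less_trans)
    also have "\<dots> = (2 * (\<bar>R\<bar> + 1)) ^ j" by (simp only: power_mult_distrib)
    also have "\<dots> \<le> (q ^ j) ^ j"
      using qj by (rule power_mono) simp
    also have "\<dots> \<le> q ^ (2 ^ Suc j)"
      unfolding power_mult[symmetric] using q sq[of j] by (intro power_increasing) auto
    finally have "\<exists>j. \<bar>C\<bar> * \<bar>R\<bar> ^ j < q ^ (2 ^ Suc j)"
      by blast
    then show False using qb by (meson not_le)
  qed
qed

section \<open>Twisted Cuntz--Krieger families\<close>

lemma eq_zero_of_star_mult_self: "star x * x = 0 \<Longrightarrow> x = (0 :: 'a::cstar_algebra)"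
  using norm_star_mult_self[of x] by simp

lemma finsum_full_algebra:
  fixes f :: "'i \<Rightarrow> 'a::cstar_algebra"
  assumes "finite I"
  shows "finsum full_algebra f I = sum f I"
  using assms
proof (induction I)
  case empty
  interpret F: abelian_group "full_algebra :: 'a cstar" by (rule abelian_group_full_algebra)
  show ?case using F.finsum_empty by simp
next
  case (insert i I)
  interpret F: abelian_group "full_algebra :: 'a cstar" by (rule abelian_group_full_algebra)
  show ?case using F.finsum_insert[of I i f] insert by simp
qed

section \<open>Degrees and unique factorisation in the k-graph\<close>

lemma Nk_add: "m \<in> Nk k \<Longrightarrow> n \<in> Nk k \<Longrightarrow> m + n \<in> Nk k"
  and Nk_diff: "m \<in> Nk k \<Longrightarrow> m - n \<in> Nk k"
  and Nk_sup: "m \<in> Nk k \<Longrightarrow> n \<in> Nk k \<Longrightarrow> sup m n \<in> Nk k"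
  and Nk_zero: "0 \<in> Nk k"
  by (auto simp: Nk_def sup_max)

lemma fun_le_add_diff: "m \<le> n \<Longrightarrow> m + (n - m) = n" for m n :: "'i \<Rightarrow> nat"
  by (auto simp: le_fun_def fun_eq_iff)

lemma ex1_unique: "\<exists>!x. P x \<Longrightarrow> P x \<Longrightarrow> P y \<Longrightarrow> x = y"
  by blast

context k_graph begin

lemma rng_vertex: "\<kappa> \<in> paths \<Lambda> \<Longrightarrow> rng \<Lambda> \<kappa> \<in> vertices \<Lambda>"
  and src_vertex: "\<kappa> \<in> paths \<Lambda> \<Longrightarrow> src \<Lambda> \<kappa> \<in> vertices \<Lambda>"
  using deg_id rng_closed src_closed by (auto simp: paths_of_degree_def)

lemma vertex_path: "v \<in> vertices \<Lambda> \<Longrightarrow> v \<in> paths \<Lambda>"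
  by (simp add: paths_of_degree_def)

lemma rng_of_vertex: "v \<in> vertices \<Lambda> \<Longrightarrow> rng \<Lambda> v = v"
  using rng_rng by (auto simp: vertices_eq_identities)

lemma factorise:
  assumes "\<kappa> \<in> paths \<Lambda>" "m \<in> Nk k" "m \<le> deg \<Lambda> \<kappa>"
  obtains \<alpha> \<beta> where "\<alpha> \<in> paths \<Lambda>" "\<beta> \<in> paths \<Lambda>" "deg \<Lambda> \<alpha> = m" "deg \<Lambda> \<beta> = deg \<Lambda> \<kappa> - m"
    "src \<Lambda> \<alpha> = rng \<Lambda> \<beta>" "\<kappa> = cmp \<Lambda> \<alpha> \<beta>"
proof -
  have "deg \<Lambda> \<kappa> - m \<in> Nk k" "deg \<Lambda> \<kappa> = m + (deg \<Lambda> \<kappa> - m)"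
    using assms fun_le_add_diff[of m] by (auto intro: Nk_diff deg_closed)
  from ex1_implies_ex[OF factorisation[OF assms(1,2) this]] obtain p where
    "fst p \<in> paths_of_degree \<Lambda> m \<and> snd p \<in> paths_of_degree \<Lambda> (deg \<Lambda> \<kappa> - m) \<and>
       src \<Lambda> (fst p) = rng \<Lambda> (snd p) \<and> \<kappa> = cmp \<Lambda> (fst p) (snd p)" by blast
  then show ?thesis using that[of "fst p" "snd p"] by (simp add: paths_of_degree_def)
qed

lemma factorisation_unique:
  assumes "\<alpha> \<in> paths \<Lambda>" "\<beta> \<in> paths \<Lambda>" "src \<Lambda> \<alpha> = rng \<Lambda> \<beta>"
    and "\<alpha>' \<in> paths \<Lambda>" "\<beta>' \<in> paths \<Lambda>" "src \<Lambda> \<alpha>' = rng \<Lambda> \<beta>'"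
    and "cmp \<Lambda> \<alpha> \<beta> = cmp \<Lambda> \<alpha>' \<beta>'" "deg \<Lambda> \<alpha> = deg \<Lambda> \<alpha>'"
  shows "\<alpha> = \<alpha>'" "\<beta> = \<beta>'"
proof -
  have d: "deg \<Lambda> (cmp \<Lambda> \<alpha> \<beta>) = deg \<Lambda> \<alpha> + deg \<Lambda> \<beta>" "deg \<Lambda> (cmp \<Lambda> \<alpha> \<beta>) = deg \<Lambda> \<alpha>' + deg \<Lambda> \<beta>'"
    using deg_cmp[OF assms(1-3)] deg_cmp[OF assms(4-6)] assms(7) by simp_all
  then have \<beta>': "deg \<Lambda> \<beta>' = deg \<Lambda> \<beta>"
    using assms(8) by (simp add: fun_eq_iff)
  have "\<exists>!p. fst p \<in> paths_of_degree \<Lambda> (deg \<Lambda> \<alpha>) \<and> snd p \<in> paths_of_degree \<Lambda> (deg \<Lambda> \<beta>) \<and>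
      src \<Lambda> (fst p) = rng \<Lambda> (snd p) \<and> cmp \<Lambda> \<alpha> \<beta> = cmp \<Lambda> (fst p) (snd p)"
    by (rule factorisation[OF cmp_closed[OF assms(1-3)] deg_closed[OF assms(1)] deg_closed[OF assms(2)] d(1)])
  then have "(\<alpha>, \<beta>) = (\<alpha>', \<beta>')"
    by (rule ex1_unique) (simp_all add: paths_of_degree_def assms \<beta>')
  then show "\<alpha> = \<alpha>'" "\<beta> = \<beta>'" by simp_all
qed

text \<open>Replaces the definite description in \<open>segment\<close> by the middle factor of an
  actual factorisation; uniqueness comes from cancelling first the tail and then the head.\<close>

lemma factorise_segment:
  assumes \<kappa>: "\<kappa> \<in> paths \<Lambda>" and mj: "m \<in> Nk k" "j \<in> Nk k" "m + j \<le> deg \<Lambda> \<kappa>"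
  obtains \<alpha> \<mu> \<beta> where "\<alpha> \<in> paths \<Lambda>" "\<mu> \<in> paths \<Lambda>" "\<beta> \<in> paths \<Lambda>" "deg \<Lambda> \<alpha> = m" "deg \<Lambda> \<mu> = j"
    "src \<Lambda> \<alpha> = rng \<Lambda> \<mu>" "src \<Lambda> \<mu> = rng \<Lambda> \<beta>" "\<kappa> = cmp \<Lambda> (cmp \<Lambda> \<alpha> \<mu>) \<beta>"
    "segment \<Lambda> \<kappa> m (m + j) = \<mu>"
proof -
  obtain \<gamma> \<beta> where 1: "\<gamma> \<in> paths \<Lambda>" "\<beta> \<in> paths \<Lambda>" "deg \<Lambda> \<gamma> = m + j"
    "deg \<Lambda> \<beta> = deg \<Lambda> \<kappa> - (m + j)" "src \<Lambda> \<gamma> = rng \<Lambda> \<beta>" "\<kappa> = cmp \<Lambda> \<gamma> \<beta>"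
    using factorise[OF \<kappa> _ mj(3)] Nk_add[OF mj(1,2)] by metis
  have "m \<le> deg \<Lambda> \<gamma>" by (simp add: 1 le_fun_def)
  then obtain \<alpha> \<mu> where 2: "\<alpha> \<in> paths \<Lambda>" "\<mu> \<in> paths \<Lambda>" "deg \<Lambda> \<alpha> = m" "deg \<Lambda> \<mu> = deg \<Lambda> \<gamma> - m"
    "src \<Lambda> \<alpha> = rng \<Lambda> \<mu>" "\<gamma> = cmp \<Lambda> \<alpha> \<mu>"
    using factorise[OF 1(1) mj(1)] by metis
  have d: "deg \<Lambda> \<mu> = j" "m + j - m = j" using 1(3) by (simp_all add: 2(4) fun_eq_iff)
  have s: "src \<Lambda> \<mu> = rng \<Lambda> \<beta>" using 1 2 src_cmp by metis
  have seg: "segment \<Lambda> \<kappa> m (m + j) = \<mu>"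
    unfolding segment_def
  proof (rule the_equality)
    show "\<mu> \<in> paths_of_degree \<Lambda> (m + j - m) \<and>
     (\<exists>\<alpha>\<in>paths_of_degree \<Lambda> m. \<exists>\<beta>\<in>paths_of_degree \<Lambda> (deg \<Lambda> \<kappa> - (m + j)).
        src \<Lambda> \<alpha> = rng \<Lambda> \<mu> \<and> src \<Lambda> \<mu> = rng \<Lambda> \<beta> \<and> \<kappa> = cmp \<Lambda> (cmp \<Lambda> \<alpha> \<mu>) \<beta>)"
      using 1 2 d s by (intro conjI bexI[of _ \<alpha>] bexI[of _ \<beta>]) (simp_all add: paths_of_degree_def)
  next
    fix \<mu>' assume "\<mu>' \<in> paths_of_degree \<Lambda> (m + j - m) \<and>
     (\<exists>\<alpha>\<in>paths_of_degree \<Lambda> m. \<exists>\<beta>\<in>paths_of_degree \<Lambda> (deg \<Lambda> \<kappa> - (m + j)).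
        src \<Lambda> \<alpha> = rng \<Lambda> \<mu>' \<and> src \<Lambda> \<mu>' = rng \<Lambda> \<beta> \<and> \<kappa> = cmp \<Lambda> (cmp \<Lambda> \<alpha> \<mu>') \<beta>)"
    then obtain \<alpha>' \<beta>' where 3: "\<mu>' \<in> paths \<Lambda>" "deg \<Lambda> \<mu>' = j" "\<alpha>' \<in> paths \<Lambda>" "deg \<Lambda> \<alpha>' = m" "\<beta>' \<in> paths \<Lambda>"
      "src \<Lambda> \<alpha>' = rng \<Lambda> \<mu>'" "src \<Lambda> \<mu>' = rng \<Lambda> \<beta>'" "\<kappa> = cmp \<Lambda> (cmp \<Lambda> \<alpha>' \<mu>') \<beta>'"
      by (auto simp: paths_of_degree_def d)
    have "cmp \<Lambda> \<alpha>' \<mu>' = \<gamma>"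
      by (rule factorisation_unique[of _ \<beta>' _ \<beta>]) (use 1 3 in \<open>auto simp: cmp_closed src_cmp deg_cmp\<close>)
    then show "\<mu>' = \<mu>"
      using factorisation_unique(2)[of \<alpha>' \<mu>' \<alpha> \<mu>] 2 3 by simp
  qed
  have "\<kappa> = cmp \<Lambda> (cmp \<Lambda> \<alpha> \<mu>) \<beta>"
    using 1(6) unfolding 2(6) .
  then show ?thesis
    by (rule that[OF 2(1,2) 1(2) 2(3) d(1) 2(5) s _ seg])
qed

text \<open>As their prefixes \<open>A \<noteq> B\<close> have equal degree, \<open>\<alpha>\<kappa>\<close> and \<open>\<beta>\<kappa>\<close> have no common extension.\<close>
lemma aperiodic_separation:
  assumes ap: "aperiodic k \<Lambda>"
    and \<alpha>: "\<alpha> \<in> paths \<Lambda>" "src \<Lambda> \<alpha> = v" and \<beta>: "\<beta> \<in> paths \<Lambda>" "src \<Lambda> \<beta> = v"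
    and ne: "deg \<Lambda> \<alpha> \<noteq> deg \<Lambda> \<beta>"
  obtains \<kappa> A A' B B' where "\<kappa> \<in> paths \<Lambda>" "rng \<Lambda> \<kappa> = v" "A \<in> paths \<Lambda>" "A' \<in> paths \<Lambda>" "B \<in> paths \<Lambda>" "B' \<in> paths \<Lambda>"
    "src \<Lambda> A = rng \<Lambda> A'" "src \<Lambda> B = rng \<Lambda> B'" "cmp \<Lambda> \<alpha> \<kappa> = cmp \<Lambda> A A'" "cmp \<Lambda> \<beta> \<kappa> = cmp \<Lambda> B B'"
    "deg \<Lambda> A = deg \<Lambda> B" "A \<noteq> B"
proof -
  define l where "l = sup (deg \<Lambda> \<alpha>) (deg \<Lambda> \<beta>)"
  \<comment> \<open>These paddings bring \<alpha> and \<beta> to the common degree \<open>l\<close>: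
    the segments of \<kappa> starting at \<open>m\<close> and at \<open>n\<close> both start at
    position \<open>l\<close>, in \<alpha>\<kappa> and \<beta>\<kappa> respectively.\<close>
  define m where "m = l - deg \<Lambda> \<alpha>"
  define n where "n = l - deg \<Lambda> \<beta>"
  have lm: "l = deg \<Lambda> \<alpha> + m" and ln: "l = deg \<Lambda> \<beta> + n"
    unfolding m_def n_def by (simp_all add: l_def fun_le_add_diff)
  have lmn: "deg \<Lambda> \<alpha> + m = deg \<Lambda> \<beta> + n" by (simp only: lm[symmetric] ln[symmetric])
  have "l \<in> Nk k" unfolding l_def by (intro Nk_sup deg_closed \<alpha>(1) \<beta>(1))
  then have mn: "m \<in> Nk k" "n \<in> Nk k" by (simp_all add: m_def n_def Nk_diff)
  have "m \<noteq> n"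
  proof
    assume "m = n"
    with lmn have "deg \<Lambda> \<alpha> = deg \<Lambda> \<beta>" by (simp add: fun_eq_iff)
    with ne show False by contradiction
  qed
  moreover have "v \<in> vertices \<Lambda>" using src_vertex \<alpha> by blast
  ultimately obtain \<kappa> where \<kappa>: "\<kappa> \<in> paths \<Lambda>" "rng \<Lambda> \<kappa> = v" "sup m n \<le> deg \<Lambda> \<kappa>"
    and seg: "segment \<Lambda> \<kappa> m (m + (deg \<Lambda> \<kappa> - sup m n)) \<noteq> segment \<Lambda> \<kappa> n (n + (deg \<Lambda> \<kappa> - sup m n))"
    using ap mn unfolding aperiodic_def paths_into_def by blast
  define j where "j = deg \<Lambda> \<kappa> - sup m n"
  have j: "j \<in> Nk k" unfolding j_def by (intro Nk_diff deg_closed \<kappa>(1))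
  have "sup m n + j = deg \<Lambda> \<kappa>"
    unfolding j_def by (rule fun_le_add_diff[OF \<kappa>(3)])
  moreover have "m + j \<le> sup m n + j" "n + j \<le> sup m n + j"
    by (simp_all add: le_fun_def)
  ultimately have le: "m + j \<le> deg \<Lambda> \<kappa>" "n + j \<le> deg \<Lambda> \<kappa>"
    by simp_all
  obtain a1 a2 a3 where a: "a1 \<in> paths \<Lambda>" "a2 \<in> paths \<Lambda>" "a3 \<in> paths \<Lambda>" "deg \<Lambda> a1 = m" "deg \<Lambda> a2 = j"
    "src \<Lambda> a1 = rng \<Lambda> a2" "src \<Lambda> a2 = rng \<Lambda> a3" "\<kappa> = cmp \<Lambda> (cmp \<Lambda> a1 a2) a3"
    "segment \<Lambda> \<kappa> m (m + j) = a2"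
    by (rule factorise_segment[OF \<kappa>(1) mn(1) j le(1)])
  obtain b1 b2 b3 where b: "b1 \<in> paths \<Lambda>" "b2 \<in> paths \<Lambda>" "b3 \<in> paths \<Lambda>" "deg \<Lambda> b1 = n" "deg \<Lambda> b2 = j"
    "src \<Lambda> b1 = rng \<Lambda> b2" "src \<Lambda> b2 = rng \<Lambda> b3" "\<kappa> = cmp \<Lambda> (cmp \<Lambda> b1 b2) b3"
    "segment \<Lambda> \<kappa> n (n + j) = b2"
    by (rule factorise_segment[OF \<kappa>(1) mn(2) j le(2)])
  have "rng \<Lambda> \<kappa> = rng \<Lambda> a1" "rng \<Lambda> \<kappa> = rng \<Lambda> b1"
    by (subst a(8), use a(1-7) in \<open>simp add: cmp_closed src_cmp rng_cmp\<close>)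
       (subst b(8), use b(1-7) in \<open>simp add: cmp_closed src_cmp rng_cmp\<close>)
  then have s: "src \<Lambda> \<alpha> = rng \<Lambda> a1" "src \<Lambda> \<beta> = rng \<Lambda> b1" using \<alpha> \<beta> \<kappa>(2) by simp_all
  \<comment> \<open>The prefixes of degree \<open>l + j\<close>; their last pieces \<open>a2\<close>
    and \<open>b2\<close> are the segments that aperiodicity tells apart.\<close>
  define A where "A = cmp \<Lambda> (cmp \<Lambda> \<alpha> a1) a2"
  define B where "B = cmp \<Lambda> (cmp \<Lambda> \<beta> b1) b2"
  have AB: "A \<in> paths \<Lambda>" "B \<in> paths \<Lambda>" "src \<Lambda> A = rng \<Lambda> a3" "src \<Lambda> B = rng \<Lambda> b3"
    using \<alpha>(1) \<beta>(1) a(1-7) b(1-7) s by (simp_all add: A_def B_def cmp_closed src_cmp)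
  have "cmp \<Lambda> \<alpha> \<kappa> = cmp \<Lambda> A a3" "cmp \<Lambda> \<beta> \<kappa> = cmp \<Lambda> B b3"
    unfolding A_def B_def
    by (subst a(8), use \<alpha>(1) a(1-7) s in \<open>simp add: cmp_assoc cmp_closed src_cmp rng_cmp\<close>)
       (subst b(8), use \<beta>(1) b(1-7) s in \<open>simp add: cmp_assoc cmp_closed src_cmp rng_cmp\<close>)
  moreover have "deg \<Lambda> A = deg \<Lambda> B"
    using \<alpha>(1) \<beta>(1) a(1-7) b(1-7) s lmn by (simp add: A_def B_def deg_cmp cmp_closed src_cmp)
  moreover have "A \<noteq> B"
  proof
    assume "A = B"
    then have "a2 = b2"
      unfolding A_def B_def
      by (rule factorisation_unique(2)[rotated 6]) (use \<alpha>(1) \<beta>(1) a(1-7) b(1-7) s lmn in \<open>simp_all add: cmp_closed src_cmp deg_cmp\<close>)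
    then show False using seg a(9) b(9) by (simp add: j_def)
  qed
  ultimately show ?thesis using that[OF \<kappa>(1,2) AB(1) a(3) AB(2) b(3) AB(3,4)] by simp
qed

end

section \<open>Consequences of the twisted relations\<close>

text \<open>The scalars \<open>c\<close> stay abstract so that the same results serve the ordinary
  family \<open>s\<close>, where \<open>c = 1\<close>, and the twisted family \<open>t\<close>. A
  cocycle is seen here through its modulus and its value 1 at vertices.\<close>

locale ck_family = k_graph k \<Lambda> for k and \<Lambda> :: "'l kgraph" +
  fixes c :: "'l \<Rightarrow> 'l \<Rightarrow> complex" and T :: "'l \<Rightarrow> 'a::cstar_algebra"
  assumes row_finite: "row_finite_no_sources k \<Lambda>"
    and relations: "ck_relations k \<Lambda> c full_algebra T"
    and cmod_c: "\<kappa> \<in> paths \<Lambda> \<Longrightarrow> \<mu> \<in> paths \<Lambda> \<Longrightarrow> src \<Lambda> \<kappa> = rng \<Lambda> \<mu> \<Longrightarrow> cmod (c \<kappa> \<mu>) = 1"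
    and c_rng: "\<kappa> \<in> paths \<Lambda> \<Longrightarrow> c (rng \<Lambda> \<kappa>) \<kappa> = 1"
    and c_src: "\<kappa> \<in> paths \<Lambda> \<Longrightarrow> c \<kappa> (src \<Lambda> \<kappa>) = 1"
begin

lemma T_vertex: "v \<in> vertices \<Lambda> \<Longrightarrow> T v * T v = T v" "v \<in> vertices \<Lambda> \<Longrightarrow> star (T v) = T v"
  and T_vertex_orthogonal: "v \<in> vertices \<Lambda> \<Longrightarrow> w \<in> vertices \<Lambda> \<Longrightarrow> v \<noteq> w \<Longrightarrow> T v * T w = 0"
  and T_mult: "\<kappa> \<in> paths \<Lambda> \<Longrightarrow> \<mu> \<in> paths \<Lambda> \<Longrightarrow> src \<Lambda> \<kappa> = rng \<Lambda> \<mu> \<Longrightarrow>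
    T \<kappa> * T \<mu> = scaleC (c \<kappa> \<mu>) (T (cmp \<Lambda> \<kappa> \<mu>))"
  and T_star_mult_self: "\<kappa> \<in> paths \<Lambda> \<Longrightarrow> star (T \<kappa>) * T \<kappa> = T (src \<Lambda> \<kappa>)"
  using relations unfolding ck_relations_def by simp_all

lemma finite_paths: "v \<in> vertices \<Lambda> \<Longrightarrow> n \<in> Nk k \<Longrightarrow> finite (paths_into \<Lambda> v \<inter> paths_of_degree \<Lambda> n)"
  using row_finite by (simp add: row_finite_no_sources_def)

lemma T_vertex_sum:
  assumes "v \<in> vertices \<Lambda>" "n \<in> Nk k"
  shows "T v = (\<Sum>\<kappa>\<in>paths_into \<Lambda> v \<inter> paths_of_degree \<Lambda> n. T \<kappa> * star (T \<kappa>))"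
  using relations assms finite_paths[OF assms]
  unfolding ck_relations_def by (simp add: finsum_full_algebra)

lemma T_src: "\<kappa> \<in> paths \<Lambda> \<Longrightarrow> T \<kappa> * T (src \<Lambda> \<kappa>) = T \<kappa>"
  using T_mult[of \<kappa> "src \<Lambda> \<kappa>"] by (simp add: src_closed rng_src c_src cmp_src)

lemma T_rng: "\<kappa> \<in> paths \<Lambda> \<Longrightarrow> T (rng \<Lambda> \<kappa>) * T \<kappa> = T \<kappa>"
  using T_mult[of "rng \<Lambda> \<kappa>" \<kappa>] by (simp add: rng_closed src_rng c_rng cmp_rng)

lemma star_T_rng: "\<kappa> \<in> paths \<Lambda> \<Longrightarrow> star (T \<kappa>) * T (rng \<Lambda> \<kappa>) = star (T \<kappa>)"
  using arg_cong[OF T_rng, of \<kappa> star] by (simp add: star_mult T_vertex(2) rng_vertex)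

lemma star_T_src: "\<kappa> \<in> paths \<Lambda> \<Longrightarrow> T (src \<Lambda> \<kappa>) * star (T \<kappa>) = star (T \<kappa>)"
  using arg_cong[OF T_src, of \<kappa> star] by (simp add: star_mult T_vertex(2) src_vertex)

lemma star_T_mult_eq_0:
  assumes "\<kappa> \<in> paths \<Lambda>" "\<mu> \<in> paths \<Lambda>" "rng \<Lambda> \<kappa> \<noteq> rng \<Lambda> \<mu>"
  shows "star (T \<kappa>) * T \<mu> = 0"
proof -
  have "star (T \<kappa>) * T \<mu> = star (T \<kappa>) * T (rng \<Lambda> \<kappa>) * (T (rng \<Lambda> \<mu>) * T \<mu>)"
    by (simp only: star_T_rng T_rng assms)
  also have "\<dots> = star (T \<kappa>) * (T (rng \<Lambda> \<kappa>) * T (rng \<Lambda> \<mu>)) * T \<mu>" by (simp only: mult.assoc)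
  finally show ?thesis using assms by (simp add: T_vertex_orthogonal rng_vertex)
qed

lemma T_mult_star_eq_0:
  assumes "\<kappa> \<in> paths \<Lambda>" "\<mu> \<in> paths \<Lambda>" "src \<Lambda> \<kappa> \<noteq> src \<Lambda> \<mu>"
  shows "T \<kappa> * star (T \<mu>) = 0"
proof -
  have "T \<kappa> * star (T \<mu>) = T \<kappa> * T (src \<Lambda> \<kappa>) * (T (src \<Lambda> \<mu>) * star (T \<mu>))"
    by (simp only: T_src star_T_src assms)
  also have "\<dots> = T \<kappa> * (T (src \<Lambda> \<kappa>) * T (src \<Lambda> \<mu>)) * star (T \<mu>)" by (simp only: mult.assoc)
  finally show ?thesis using assms by (simp add: T_vertex_orthogonal src_vertex)
qed

lemma T_cmp:
  assumes "\<kappa> \<in> paths \<Lambda>" "\<mu> \<in> paths \<Lambda>" "src \<Lambda> \<kappa> = rng \<Lambda> \<mu>"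
  shows "T (cmp \<Lambda> \<kappa> \<mu>) = scaleC (cnj (c \<kappa> \<mu>)) (T \<kappa> * T \<mu>)"
proof -
  have "cnj (c \<kappa> \<mu>) * c \<kappa> \<mu> = 1"
    using cmod_c[OF assms] complex_norm_square[of "c \<kappa> \<mu>"] by (simp add: mult.commute)
  then show ?thesis by (simp add: T_mult assms scaleC_scaleC)
qed

lemma norm_T_le_1: "\<kappa> \<in> paths \<Lambda> \<Longrightarrow> norm (T \<kappa>) \<le> 1"
  using norm_projection_le_one[of "T (src \<Lambda> \<kappa>)"] norm_star_mult_self[of "T \<kappa>"]
  by (simp add: T_star_mult_self T_vertex src_vertex abs_square_le_1)

lemma range_projection:
  assumes "\<kappa> \<in> paths \<Lambda>"
  shows "(T \<kappa> * star (T \<kappa>)) * (T \<kappa> * star (T \<kappa>)) = T \<kappa> * star (T \<kappa>)"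
proof -
  have "(T \<kappa> * star (T \<kappa>)) * (T \<kappa> * star (T \<kappa>)) = T \<kappa> * (star (T \<kappa>) * T \<kappa>) * star (T \<kappa>)"
    by (simp only: mult.assoc)
  then show ?thesis using assms by (simp add: T_star_mult_self T_src)
qed

text \<open>
  The orthogonality of the range projections is not among the relations: it holds because
  projections that sum to a projection are mutually orthogonal.
\<close>
lemma star_T_mult_same_degree:
  assumes \<kappa>: "\<kappa> \<in> paths \<Lambda>" and \<mu>: "\<mu> \<in> paths \<Lambda>" and deg: "deg \<Lambda> \<kappa> = deg \<Lambda> \<mu>"
  shows "star (T \<kappa>) * T \<mu> = (if \<kappa> = \<mu> then T (src \<Lambda> \<kappa>) else 0)"
proof (cases "\<kappa> = \<mu>")
  case True
  then show ?thesis using \<kappa> by (simp add: T_star_mult_self)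
next
  case ne: False
  show ?thesis
  proof (cases "rng \<Lambda> \<kappa> = rng \<Lambda> \<mu>")
    case False
    then show ?thesis using ne star_T_mult_eq_0 \<kappa> \<mu> by simp
  next
    case True
    define v where "v = rng \<Lambda> \<mu>"
    define X where "X = paths_into \<Lambda> v \<inter> paths_of_degree \<Lambda> (deg \<Lambda> \<mu>)"
    \<comment> \<open>Each \<open>h \<nu>\<close> is positive in the corner of \<open>e\<close>.
      Summed over \<open>X\<close> they give \<open>e\<close>, which is already the single term
      \<open>h \<mu>\<close>; so the others sum to 0 and vanish one by one.\<close>
    define h where "h \<nu> = star (T \<mu>) * (T \<nu> * star (T \<nu>)) * T \<mu>" for \<nu>
    define e where "e = T (src \<Lambda> \<mu>)"
    have v: "v \<in> vertices \<Lambda>" using \<mu> rng_vertex v_def by blast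
    have fin: "finite X" unfolding X_def by (rule finite_paths[OF v deg_closed[OF \<mu>]])
    have e: "star e = e" "e * e = e" using \<mu> by (simp_all add: e_def T_vertex src_vertex)
    have eT: "T \<mu> * e = T \<mu>" "e * star (T \<mu>) = star (T \<mu>)" using \<mu> by (simp_all add: e_def T_src star_T_src)
    have mem: "\<mu> \<in> X" "\<kappa> \<in> X - {\<mu>}"
      using \<kappa> \<mu> True deg ne by (auto simp: X_def v_def paths_into_def paths_of_degree_def)
    have "(\<Sum>\<nu>\<in>X. h \<nu>) = star (T \<mu>) * T v * T \<mu>"
      unfolding h_def T_vertex_sum[OF v deg_closed[OF \<mu>]] X_def[symmetric]
      by (simp add: sum_distrib_left sum_distrib_right)
    also have "\<dots> = e" using \<mu> by (simp add: v_def star_T_rng T_star_mult_self e_def)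
    also have "\<dots> = h \<mu>"
    proof -
      have "h \<mu> = (star (T \<mu>) * T \<mu>) * (star (T \<mu>) * T \<mu>)" by (simp add: h_def mult.assoc)
      then show ?thesis using \<mu> e(2) by (simp add: T_star_mult_self e_def[symmetric])
    qed
    finally have sum: "(\<Sum>\<nu>\<in>X - {\<mu>}. h \<nu>) = 0"
      using fin mem(1) by (simp add: sum.remove)
    \<comment> \<open>Here \<open>e - h \<nu>\<close> is \<open>star y * y\<close> for
      \<open>y = T \<mu> - q * T \<mu>\<close>, and subtracting \<open>q * T \<mu>\<close> does not
      increase the norm of \<open>T \<mu>\<close>.\<close>
    have pos: "norm (e - h \<nu>) \<le> 1" if "\<nu> \<in> X - {\<mu>}" for \<nu>
    proof -
      have \<nu>: "\<nu> \<in> paths \<Lambda>" using that by (auto simp: X_def paths_into_def)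
      define q where "q = T \<nu> * star (T \<nu>)"
      have q: "star q = q" "q * q = q"
        using range_projection[OF \<nu>] by (simp_all add: q_def star_mult star_star)
      have "star (T \<mu> - q * T \<mu>) * (T \<mu> - q * T \<mu>)
          = star (T \<mu>) * T \<mu> - star (T \<mu>) * q * T \<mu> - star (T \<mu>) * q * T \<mu> + star (T \<mu>) * (q * q) * T \<mu>"
        by (simp add: star_diff star_mult q(1) algebra_simps)
      also have "\<dots> = e - h \<nu>"
        unfolding q(2) using \<mu> by (simp add: T_star_mult_self e_def h_def q_def)
      finally have "norm (e - h \<nu>) = (norm (T \<mu> - q * T \<mu>))\<^sup>2"
        by (simp only: norm_star_mult_self[symmetric])
      also have "\<dots> \<le> 1\<^sup>2"
        using norm_diff_projection_le[OF q, of "T \<mu>"] norm_T_le_1[OF \<mu>] by (intro power_mono) auto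
      finally show ?thesis by simp
    qed
    have "h \<kappa> = 0"
    proof (rule sum_of_positive_eq_zero[where I = "X - {\<mu>}" and h = h, OF e])
      show "star (h \<nu>) = h \<nu>" "e * h \<nu> = h \<nu>" "h \<nu> * e = h \<nu>" for \<nu>
        by (simp_all add: h_def star_mult star_star mult.assoc eT(1)) (simp_all add: mult.assoc[symmetric] eT(2))
    qed (use fin mem sum pos in auto)
    then have "star (star (T \<kappa>) * T \<mu>) * (star (T \<kappa>) * T \<mu>) = 0"
      by (simp add: h_def star_mult star_star mult.assoc)
    then show ?thesis using ne eq_zero_of_star_mult_self by simp
  qed
qed

end

section \<open>Norm estimates on the span of the monomials\<close>

text \<open>The weight of a monomial under the gauge action, an element of Z^k; integers because
  subtraction of natural numbers truncates.\<close>

definition ddeg :: "'l kgraph \<Rightarrow> 'l \<times> 'l \<Rightarrow> nat \<Rightarrow> int" where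
  "ddeg \<Lambda> p = (\<lambda>i. int (deg \<Lambda> (fst p) i) - int (deg \<Lambda> (snd p) i))"

text \<open>Pairs with different sources give the zero monomial; a common source lets both paths be
  extended by the same tail.\<close>

definition cofinal_pairs :: "'l kgraph \<Rightarrow> ('l \<times> 'l) set" where
  "cofinal_pairs \<Lambda> = {p. fst p \<in> paths \<Lambda> \<and> snd p \<in> paths \<Lambda> \<and> src \<Lambda> (fst p) = src \<Lambda> (snd p)}"

section \<open>The linear span of the monomials\<close>

context ck_family begin

definition monomials :: "('l \<times> 'l) set \<Rightarrow> 'a set" where
  "monomials E = {scaleC z (T (fst p) * star (T (snd p))) | z p. p \<in> E}"

text \<open>Closed under complex scalars although \<^const>\<open>span\<close> is the real span.\<close>
definition mspan :: "('l \<times> 'l) set \<Rightarrow> 'a set" where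
  "mspan E = span (monomials E)"

lemma subspace_mspan: "subspace (mspan E)"
  by (simp add: mspan_def)

lemma mspan_mono: "E \<subseteq> E' \<Longrightarrow> mspan E \<subseteq> mspan E'"
  unfolding mspan_def by (rule span_mono) (auto simp: monomials_def)

lemma monomial_in_mspan: "p \<in> E \<Longrightarrow> scaleC z (T (fst p) * star (T (snd p))) \<in> mspan E"
  unfolding mspan_def monomials_def by (rule span_base) blast

lemma mspan_induct [consumes 1, case_names monomial zero add scale]:
  assumes "x \<in> mspan E"
    and "\<And>z p. p \<in> E \<Longrightarrow> P (scaleC z (T (fst p) * star (T (snd p))))"
    and "P 0" and "\<And>x y. P x \<Longrightarrow> P y \<Longrightarrow> P (x + y)" and "\<And>r x. P x \<Longrightarrow> P (r *\<^sub>R x)"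
  shows "P x"
  using assms(1) unfolding mspan_def
proof (induction rule: span_induct)
  case base
  show ?case using assms(3-5) by (simp add: subspace_def)
next
  case (step x)
  then show ?case using assms(2) by (auto simp: monomials_def)
qed

lemma mspan_scaleC: "x \<in> mspan E \<Longrightarrow> scaleC z x \<in> mspan E"
proof (induction rule: mspan_induct)
  case (monomial w p)
  then show ?case using monomial_in_mspan[of p E "z * w"] by (simp add: scaleC_scaleC)
qed (simp_all add: scaleC_add_right scaleC_scaleR subspace_mspan subspace_0 subspace_add subspace_scale)

lemma mspan_star: "x \<in> mspan E \<Longrightarrow> star x \<in> mspan (prod.swap ` E)"
proof (induction rule: mspan_induct)
  case (monomial w p)
  then show ?case
    using monomial_in_mspan[of "prod.swap p" "prod.swap ` E" "cnj w"]
    by (simp add: star_scaleC star_mult star_star)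
qed (simp_all add: star_add star_scaleR subspace_mspan subspace_0 subspace_add subspace_scale)

lemma mspan_sandwich:
  assumes "x \<in> mspan E"
    and "\<And>p. p \<in> E \<Longrightarrow> a * (T (fst p) * star (T (snd p))) * b \<in> mspan E'"
  shows "a * x * b \<in> mspan E'"
  using assms(1)
proof (induction rule: mspan_induct)
  case (monomial w p)
  then show ?case using mspan_scaleC[OF assms(2)] by (simp add: mult_scaleC_left mult_scaleC_right)
qed (simp_all add: distrib_left distrib_right subspace_mspan subspace_0 subspace_add subspace_scale)

lemma mspan_mult:
  assumes "x \<in> mspan E" "y \<in> mspan E'"
    and "\<And>p q. p \<in> E \<Longrightarrow> q \<in> E' \<Longrightarrow>
      (T (fst p) * star (T (snd p))) * (T (fst q) * star (T (snd q))) \<in> mspan E''"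
  shows "x * y \<in> mspan E''"
  using assms(1)
proof (induction rule: mspan_induct)
  case (monomial w p)
  have "(T (fst p) * star (T (snd p))) * y \<in> mspan E''"
    using assms(2)
  proof (induction rule: mspan_induct)
    case (monomial v q)
    then show ?case
      using mspan_scaleC[OF assms(3)[OF \<open>p \<in> E\<close> monomial]] by (simp add: mult_scaleC_right)
  qed (simp_all add: distrib_left subspace_mspan subspace_0 subspace_add subspace_scale)
  then show ?case using mspan_scaleC by (simp add: mult_scaleC_left)
qed (simp_all add: distrib_right subspace_mspan subspace_0 subspace_add subspace_scale)

lemma mspan_finite_support:
  assumes "x \<in> mspan E"
  shows "\<exists>E'. finite E' \<and> E' \<subseteq> E \<and> x \<in> mspan E'"
  using assms
proof (induction rule: mspan_induct)
  case (monomial z p)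
  then show ?case using monomial_in_mspan[of p "{p}"] by (intro exI[of _ "{p}"]) auto
next
  case (add x y)
  then obtain E1 E2 where E: "finite E1" "E1 \<subseteq> E" "x \<in> mspan E1" "finite E2" "E2 \<subseteq> E" "y \<in> mspan E2"
    by blast
  then have "x \<in> mspan (E1 \<union> E2)" "y \<in> mspan (E1 \<union> E2)"
    using mspan_mono[of E1 "E1 \<union> E2"] mspan_mono[of E2 "E1 \<union> E2"] by auto
  then have "x + y \<in> mspan (E1 \<union> E2)"
    by (rule subspace_add[OF subspace_mspan])
  with E show ?case by (intro exI[of _ "E1 \<union> E2"]) auto
next
  case (scale r x)
  then show ?case using subspace_scale[OF subspace_mspan] by blast
qed (use subspace_0[OF subspace_mspan, of "{}"] in blast)

text \<open>Homogeneous parts are obtained by a choice of representation; the estimates for them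
  hold for every choice.\<close>

lemma mspan_UN_decompose:
  assumes "x \<in> mspan (\<Union>n\<in>I. E n)" and I: "finite I"
  shows "\<exists>f. (\<forall>n\<in>I. f n \<in> mspan (E n)) \<and> x = (\<Sum>n\<in>I. f n)"
  using assms(1)
proof (induction rule: mspan_induct)
  case (monomial z p)
  then obtain m where m: "m \<in> I" "p \<in> E m" by blast
  define g where "g = scaleC z (T (fst p) * star (T (snd p)))"
  have "\<forall>n\<in>I. (if n = m then g else 0) \<in> mspan (E n)"
    using monomial_in_mspan[OF m(2)] subspace_0[OF subspace_mspan] by (simp add: g_def)
  moreover have "g = (\<Sum>n\<in>I. if n = m then g else 0)"
    using m(1) I by simp
  ultimately show ?case unfolding g_def[symmetric] by (intro exI[of _ "\<lambda>n. if n = m then g else 0"] conjI)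
next
  case zero
  show ?case using subspace_0[OF subspace_mspan] by (intro exI[of _ "\<lambda>_. 0"]) auto
next
  case (add x y)
  then obtain f g where "\<forall>n\<in>I. f n \<in> mspan (E n)" "x = sum f I" "\<forall>n\<in>I. g n \<in> mspan (E n)" "y = sum g I"
    by blast
  then show ?case
    using subspace_add[OF subspace_mspan] by (intro exI[of _ "\<lambda>n. f n + g n"]) (simp add: sum.distrib)
next
  case (scale r x)
  then obtain f where "\<forall>n\<in>I. f n \<in> mspan (E n)" "x = sum f I" by blast
  then show ?case
    using subspace_scale[OF subspace_mspan] by (intro exI[of _ "\<lambda>n. r *\<^sub>R f n"]) (simp add: scaleR_sum_right)
qed

section \<open>Products of monomials\<close>

text \<open>Paths of equal degree are orthogonal unless they coincide, so the inner product of the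
  padded paths is 0 or a multiple of a vertex projection, which the outer factors absorb.\<close>

lemma T_star_mult_cmp:
  assumes \<mu>: "\<mu> \<in> paths \<Lambda>" and \<alpha>: "\<alpha> \<in> paths \<Lambda>" and s: "src \<Lambda> \<mu> = rng \<Lambda> \<alpha>"
    and \<kappa>: "\<kappa> \<in> paths \<Lambda>" and \<beta>: "\<beta> \<in> paths \<Lambda>" and s': "src \<Lambda> \<kappa> = rng \<Lambda> \<beta>"
    and d: "deg \<Lambda> \<mu> + deg \<Lambda> \<alpha> = deg \<Lambda> \<kappa> + deg \<Lambda> \<beta>"
  shows "T \<alpha> * (star (T \<mu> * T \<alpha>) * (T \<kappa> * T \<beta>)) * star (T \<beta>) = 0 \<or>
    src \<Lambda> \<alpha> = src \<Lambda> \<beta> \<and> cmp \<Lambda> \<mu> \<alpha> = cmp \<Lambda> \<kappa> \<beta> \<and>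
    (\<exists>z. T \<alpha> * (star (T \<mu> * T \<alpha>) * (T \<kappa> * T \<beta>)) * star (T \<beta>) = scaleC z (T \<alpha> * star (T \<beta>)))"
proof -
  define z where "z = cnj (c \<mu> \<alpha>) * c \<kappa> \<beta>"
  have p: "cmp \<Lambda> \<mu> \<alpha> \<in> paths \<Lambda>" "cmp \<Lambda> \<kappa> \<beta> \<in> paths \<Lambda>"
    using cmp_closed[OF \<mu> \<alpha> s] cmp_closed[OF \<kappa> \<beta> s'] by simp_all
  have dd: "deg \<Lambda> (cmp \<Lambda> \<mu> \<alpha>) = deg \<Lambda> (cmp \<Lambda> \<kappa> \<beta>)"
    using d by (simp only: deg_cmp[OF \<mu> \<alpha> s] deg_cmp[OF \<kappa> \<beta> s'])
  have e: "star (T \<mu> * T \<alpha>) * (T \<kappa> * T \<beta>) = scaleC z (star (T (cmp \<Lambda> \<mu> \<alpha>)) * T (cmp \<Lambda> \<kappa> \<beta>))"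
    by (simp add: T_mult[OF \<mu> \<alpha> s] T_mult[OF \<kappa> \<beta> s'] star_scaleC mult_scaleC_left mult_scaleC_right
        scaleC_scaleC z_def mult.commute)
  show ?thesis
  proof (cases "cmp \<Lambda> \<mu> \<alpha> = cmp \<Lambda> \<kappa> \<beta>")
    case False
    then show ?thesis by (simp add: e star_T_mult_same_degree[OF p dd])
  next
    case True
    have s'': "src \<Lambda> \<alpha> = src \<Lambda> \<beta>"
      using True src_cmp[OF \<mu> \<alpha> s] src_cmp[OF \<kappa> \<beta> s'] by simp
    have "star (T (cmp \<Lambda> \<mu> \<alpha>)) * T (cmp \<Lambda> \<kappa> \<beta>) = T (src \<Lambda> \<alpha>)"
      using star_T_mult_same_degree[OF p dd] True src_cmp[OF \<mu> \<alpha> s] by simp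
    then have "T \<alpha> * (star (T \<mu> * T \<alpha>) * (T \<kappa> * T \<beta>)) * star (T \<beta>) = scaleC z (T \<alpha> * star (T \<beta>))"
      by (simp only: e mult_scaleC_left mult_scaleC_right T_src[OF \<alpha>])
    with s'' True show ?thesis by blast
  qed
qed

text \<open>Relation (CK4) at both sources, inserted in the degrees that pad \<mu> and \<kappa> to
  the join \<open>N\<close>, leaves only paths of equal degree; the surviving terms belong to the
  minimal common extensions of \<mu> and \<kappa>.\<close>

lemma star_T_mult_in_mspan:
  assumes \<mu>: "\<mu> \<in> paths \<Lambda>" and \<kappa>: "\<kappa> \<in> paths \<Lambda>"
  shows "star (T \<mu>) * T \<kappa> \<in> mspan {p \<in> cofinal_pairs \<Lambda>. rng \<Lambda> (fst p) = src \<Lambda> \<mu> \<and>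
    rng \<Lambda> (snd p) = src \<Lambda> \<kappa> \<and> cmp \<Lambda> \<mu> (fst p) = cmp \<Lambda> \<kappa> (snd p)}" (is "_ \<in> mspan ?E")
proof -
  define N where "N = sup (deg \<Lambda> \<mu>) (deg \<Lambda> \<kappa>)"
  define m where "m = N - deg \<Lambda> \<mu>"
  define n where "n = N - deg \<Lambda> \<kappa>"
  have N: "N \<in> Nk k" unfolding N_def by (intro Nk_sup deg_closed \<mu> \<kappa>)
  have mn: "m \<in> Nk k" "n \<in> Nk k" unfolding m_def n_def by (intro Nk_diff N)+
  have Nm: "deg \<Lambda> \<mu> + m = N" and Nn: "deg \<Lambda> \<kappa> + n = N"
    unfolding m_def n_def by (intro fun_le_add_diff; simp add: N_def)+
  define A where "A = paths_into \<Lambda> (src \<Lambda> \<mu>) \<inter> paths_of_degree \<Lambda> m"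
  define B where "B = paths_into \<Lambda> (src \<Lambda> \<kappa>) \<inter> paths_of_degree \<Lambda> n"
  have sA: "T (src \<Lambda> \<mu>) = (\<Sum>\<alpha>\<in>A. T \<alpha> * star (T \<alpha>))"
    unfolding A_def by (rule T_vertex_sum[OF src_vertex[OF \<mu>] mn(1)])
  have sB: "T (src \<Lambda> \<kappa>) = (\<Sum>\<beta>\<in>B. T \<beta> * star (T \<beta>))"
    unfolding B_def by (rule T_vertex_sum[OF src_vertex[OF \<kappa>] mn(2)])
  have "star (T \<mu>) * T \<kappa> = (T (src \<Lambda> \<mu>) * star (T \<mu>)) * (T \<kappa> * T (src \<Lambda> \<kappa>))"
    by (simp only: star_T_src[OF \<mu>] T_src[OF \<kappa>])
  also have "\<dots> = (\<Sum>\<alpha>\<in>A. \<Sum>\<beta>\<in>B. T \<alpha> * (star (T \<mu> * T \<alpha>) * (T \<kappa> * T \<beta>)) * star (T \<beta>))"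
    unfolding sA sB sum_distrib_left sum_distrib_right
    by (subst sum.swap) (simp add: star_mult mult.assoc)
  also have "\<dots> \<in> mspan ?E"
  proof (intro subspace_sum[OF subspace_mspan])
    fix \<alpha> \<beta> assume "\<alpha> \<in> A" "\<beta> \<in> B"
    then have \<alpha>: "\<alpha> \<in> paths \<Lambda>" "rng \<Lambda> \<alpha> = src \<Lambda> \<mu>" "deg \<Lambda> \<alpha> = m"
      and \<beta>: "\<beta> \<in> paths \<Lambda>" "rng \<Lambda> \<beta> = src \<Lambda> \<kappa>" "deg \<Lambda> \<beta> = n"
      by (simp_all add: A_def B_def paths_into_def paths_of_degree_def)
    have dd: "deg \<Lambda> \<mu> + deg \<Lambda> \<alpha> = deg \<Lambda> \<kappa> + deg \<Lambda> \<beta>"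
      by (simp only: \<alpha>(3) \<beta>(3) Nm Nn)
    have E: "src \<Lambda> \<alpha> = src \<Lambda> \<beta> \<Longrightarrow> cmp \<Lambda> \<mu> \<alpha> = cmp \<Lambda> \<kappa> \<beta> \<Longrightarrow> (\<alpha>, \<beta>) \<in> ?E"
      using \<alpha>(1,2) \<beta>(1,2) by (simp add: cofinal_pairs_def)
    show "T \<alpha> * (star (T \<mu> * T \<alpha>) * (T \<kappa> * T \<beta>)) * star (T \<beta>) \<in> mspan ?E"
      using T_star_mult_cmp[OF \<mu> \<alpha>(1) \<alpha>(2)[symmetric] \<kappa> \<beta>(1) \<beta>(2)[symmetric] dd]
    proof (elim disjE conjE exE)
      fix z assume "src \<Lambda> \<alpha> = src \<Lambda> \<beta>" "cmp \<Lambda> \<mu> \<alpha> = cmp \<Lambda> \<kappa> \<beta>"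
        and z: "T \<alpha> * (star (T \<mu> * T \<alpha>) * (T \<kappa> * T \<beta>)) * star (T \<beta>) = scaleC z (T \<alpha> * star (T \<beta>))"
      then show ?thesis unfolding z using monomial_in_mspan[OF E, of z] by simp
    qed (simp add: subspace_0[OF subspace_mspan])
  qed
  finally show ?thesis .
qed

text \<open>The index set retains the equation \<open>cmp \<Lambda> (snd p) \<alpha> = cmp \<Lambda>
  (fst q) \<beta>\<close>: applying \<open>deg\<close> to it gives multiplicativity of the
  Z^k-grading, applying \<eta> that of the fibres of the bundle.\<close>

lemma monomial_mult:
  assumes p: "p \<in> cofinal_pairs \<Lambda>" and q: "q \<in> cofinal_pairs \<Lambda>"
  shows "(T (fst p) * star (T (snd p))) * (T (fst q) * star (T (snd q)))
    \<in> mspan {(cmp \<Lambda> (fst p) \<alpha>, cmp \<Lambda> (snd q) \<beta>) | \<alpha> \<beta>.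
      \<alpha> \<in> paths \<Lambda> \<and> \<beta> \<in> paths \<Lambda> \<and> src \<Lambda> \<alpha> = src \<Lambda> \<beta> \<and> rng \<Lambda> \<alpha> = src \<Lambda> (snd p) \<and>
      rng \<Lambda> \<beta> = src \<Lambda> (fst q) \<and> cmp \<Lambda> (snd p) \<alpha> = cmp \<Lambda> (fst q) \<beta>}" (is "_ \<in> mspan ?E")
proof -
  have P: "fst p \<in> paths \<Lambda>" "snd p \<in> paths \<Lambda>" "src \<Lambda> (fst p) = src \<Lambda> (snd p)"
    "fst q \<in> paths \<Lambda>" "snd q \<in> paths \<Lambda>" "src \<Lambda> (fst q) = src \<Lambda> (snd q)"
    using p q by (simp_all add: cofinal_pairs_def)
  have "T (fst p) * (star (T (snd p)) * T (fst q)) * star (T (snd q)) \<in> mspan ?E"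
  proof (rule mspan_sandwich[OF star_T_mult_in_mspan[OF P(2,4)]])
    fix r assume r: "r \<in> {r \<in> cofinal_pairs \<Lambda>. rng \<Lambda> (fst r) = src \<Lambda> (snd p) \<and>
        rng \<Lambda> (snd r) = src \<Lambda> (fst q) \<and> cmp \<Lambda> (snd p) (fst r) = cmp \<Lambda> (fst q) (snd r)}"
    define \<alpha> where "\<alpha> = fst r"
    define \<beta> where "\<beta> = snd r"
    have R: "\<alpha> \<in> paths \<Lambda>" "\<beta> \<in> paths \<Lambda>" "src \<Lambda> (fst p) = rng \<Lambda> \<alpha>" "src \<Lambda> (snd q) = rng \<Lambda> \<beta>"
      using r P by (simp_all add: cofinal_pairs_def \<alpha>_def \<beta>_def)
    have "T (fst p) * (T \<alpha> * star (T \<beta>)) * star (T (snd q)) = (T (fst p) * T \<alpha>) * star (T (snd q) * T \<beta>)"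
      by (simp add: star_mult mult.assoc)
    also have "\<dots> = scaleC (c (fst p) \<alpha> * cnj (c (snd q) \<beta>)) (T (cmp \<Lambda> (fst p) \<alpha>) * star (T (cmp \<Lambda> (snd q) \<beta>)))"
      by (simp add: T_mult[OF P(1) R(1,3)] T_mult[OF P(5) R(2,4)] star_scaleC mult_scaleC_left mult_scaleC_right
          scaleC_scaleC mult.commute)
    also have "\<dots> \<in> mspan ?E"
    proof -
      have "(cmp \<Lambda> (fst p) \<alpha>, cmp \<Lambda> (snd q) \<beta>) \<in> ?E"
        using r by (auto simp: cofinal_pairs_def \<alpha>_def \<beta>_def)
      from monomial_in_mspan[OF this] show ?thesis by simp
    qed
    finally show "T (fst p) * (T (fst r) * star (T (snd r))) * star (T (snd q)) \<in> mspan ?E"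
      by (simp only: \<alpha>_def \<beta>_def)
  qed
  then show ?thesis by (simp only: mult.assoc)
qed

lemma monomial_mult_in_mspan:
  assumes p: "p \<in> cofinal_pairs \<Lambda>" and q: "q \<in> cofinal_pairs \<Lambda>"
  shows "(T (fst p) * star (T (snd p))) * (T (fst q) * star (T (snd q)))
    \<in> mspan {r \<in> cofinal_pairs \<Lambda>. ddeg \<Lambda> r = ddeg \<Lambda> p + ddeg \<Lambda> q}"
proof (rule subsetD[OF mspan_mono monomial_mult[OF p q]], clarify, intro conjI)
  have P: "fst p \<in> paths \<Lambda>" "snd p \<in> paths \<Lambda>" "src \<Lambda> (fst p) = src \<Lambda> (snd p)"
    "fst q \<in> paths \<Lambda>" "snd q \<in> paths \<Lambda>" "src \<Lambda> (fst q) = src \<Lambda> (snd q)"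
    using p q by (simp_all add: cofinal_pairs_def)
  fix \<alpha> \<beta> assume R: "\<alpha> \<in> paths \<Lambda>" "\<beta> \<in> paths \<Lambda>" "src \<Lambda> \<alpha> = src \<Lambda> \<beta>" "rng \<Lambda> \<alpha> = src \<Lambda> (snd p)"
    "rng \<Lambda> \<beta> = src \<Lambda> (fst q)" and e: "cmp \<Lambda> (snd p) \<alpha> = cmp \<Lambda> (fst q) \<beta>"
  have S: "src \<Lambda> (fst p) = rng \<Lambda> \<alpha>" "src \<Lambda> (snd q) = rng \<Lambda> \<beta>" "src \<Lambda> (snd p) = rng \<Lambda> \<alpha>" "src \<Lambda> (fst q) = rng \<Lambda> \<beta>"
    by (simp_all only: R P)
  show "(cmp \<Lambda> (fst p) \<alpha>, cmp \<Lambda> (snd q) \<beta>) \<in> cofinal_pairs \<Lambda>"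
    using cmp_closed[OF P(1) R(1) S(1)] cmp_closed[OF P(5) R(2) S(2)] R(3)
    by (simp add: cofinal_pairs_def src_cmp[OF P(1) R(1) S(1)] src_cmp[OF P(5) R(2) S(2)])
  have "deg \<Lambda> (snd p) i + deg \<Lambda> \<alpha> i = deg \<Lambda> (fst q) i + deg \<Lambda> \<beta> i" for i
    using arg_cong[OF e, of "\<lambda>\<kappa>. deg \<Lambda> \<kappa> i"]
    by (simp add: deg_cmp[OF P(2) R(1) S(3)] deg_cmp[OF P(4) R(2) S(4)])
  then have "int (deg \<Lambda> (snd p) i) + int (deg \<Lambda> \<alpha> i) = int (deg \<Lambda> (fst q) i) + int (deg \<Lambda> \<beta> i)" for i
    by (simp only: of_nat_add[symmetric])
  then show "ddeg \<Lambda> (cmp \<Lambda> (fst p) \<alpha>, cmp \<Lambda> (snd q) \<beta>) = ddeg \<Lambda> p + ddeg \<Lambda> q"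
    by (simp add: ddeg_def fun_eq_iff deg_cmp[OF P(1) R(1) S(1)] deg_cmp[OF P(5) R(2) S(2)])
       (simp add: algebra_simps)
qed

section \<open>Finite levels of the core\<close>

text \<open>The monomials of these pairs multiply like matrix units, with one block for each source
  vertex.\<close>

definition level_pairs :: "(nat \<Rightarrow> nat) \<Rightarrow> ('l \<times> 'l) set" where
  "level_pairs N = {p \<in> cofinal_pairs \<Lambda>. deg \<Lambda> (fst p) = N \<and> deg \<Lambda> (snd p) = N}"

text \<open>Relation (CK4) at the common source extends \<kappa> and \<mu> by the same tails of
  degree \<open>N - n\<close>, so lower levels lie in higher ones.\<close>

lemma monomial_in_level:
  assumes P: "\<kappa> \<in> paths \<Lambda>" "\<mu> \<in> paths \<Lambda>" "src \<Lambda> \<kappa> = src \<Lambda> \<mu>"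
    and d: "deg \<Lambda> \<kappa> = n" "deg \<Lambda> \<mu> = n" and N: "N \<in> Nk k" "n \<le> N"
  shows "T \<kappa> * star (T \<mu>) \<in> mspan (level_pairs N)"
proof -
  define A where "A = paths_into \<Lambda> (src \<Lambda> \<kappa>) \<inter> paths_of_degree \<Lambda> (N - n)"
  have Nn: "n + (N - n) = N" by (rule fun_le_add_diff[OF N(2)])
  have sA: "T (src \<Lambda> \<kappa>) = (\<Sum>\<alpha>\<in>A. T \<alpha> * star (T \<alpha>))"
    unfolding A_def by (rule T_vertex_sum[OF src_vertex[OF P(1)] Nk_diff[OF N(1)]])
  have "T \<kappa> * star (T \<mu>) = T \<kappa> * T (src \<Lambda> \<kappa>) * star (T \<mu>)"
    by (simp only: T_src[OF P(1)])
  also have "\<dots> = (\<Sum>\<alpha>\<in>A. T \<kappa> * T \<alpha> * star (T \<mu> * T \<alpha>))"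
    unfolding sA sum_distrib_left sum_distrib_right by (simp add: star_mult mult.assoc)
  also have "\<dots> \<in> mspan (level_pairs N)"
  proof (rule subspace_sum[OF subspace_mspan])
    fix \<alpha> assume "\<alpha> \<in> A"
    then have \<alpha>: "\<alpha> \<in> paths \<Lambda>" "src \<Lambda> \<kappa> = rng \<Lambda> \<alpha>" "src \<Lambda> \<mu> = rng \<Lambda> \<alpha>" "deg \<Lambda> \<alpha> = N - n"
      using P(3) by (simp_all add: A_def paths_into_def paths_of_degree_def)
    have "(cmp \<Lambda> \<kappa> \<alpha>, cmp \<Lambda> \<mu> \<alpha>) \<in> level_pairs N"
      using cmp_closed[OF P(1) \<alpha>(1,2)] cmp_closed[OF P(2) \<alpha>(1,3)]
      by (simp add: level_pairs_def cofinal_pairs_def src_cmp[OF P(1) \<alpha>(1,2)] src_cmp[OF P(2) \<alpha>(1,3)]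
          deg_cmp[OF P(1) \<alpha>(1,2)] deg_cmp[OF P(2) \<alpha>(1,3)] d \<alpha>(4) Nn)
    from monomial_in_mspan[OF this, of "c \<kappa> \<alpha> * cnj (c \<mu> \<alpha>)"]
    show "T \<kappa> * T \<alpha> * star (T \<mu> * T \<alpha>) \<in> mspan (level_pairs N)"
      by (simp add: T_mult[OF P(1) \<alpha>(1,2)] T_mult[OF P(2) \<alpha>(1,3)] star_scaleC mult_scaleC_left mult_scaleC_right
          scaleC_scaleC mult.commute)
  qed
  finally show ?thesis .
qed

text \<open>Having all large \<open>N\<close> leaves room to raise the level above the degrees that
  occur in the part of non-zero degree.\<close>

lemma degree_zero_in_level:
  assumes "x \<in> mspan {p \<in> cofinal_pairs \<Lambda>. ddeg \<Lambda> p = 0}"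
  shows "\<exists>N0\<in>Nk k. \<forall>N\<in>Nk k. N0 \<le> N \<longrightarrow> x \<in> mspan (level_pairs N)"
  using assms
proof (induction rule: mspan_induct)
  case (monomial z p)
  then have p: "fst p \<in> paths \<Lambda>" "snd p \<in> paths \<Lambda>" "src \<Lambda> (fst p) = src \<Lambda> (snd p)" and d: "ddeg \<Lambda> p = 0"
    by (simp_all add: cofinal_pairs_def)
  have "deg \<Lambda> (snd p) = deg \<Lambda> (fst p)"
  proof
    fix i show "deg \<Lambda> (snd p) i = deg \<Lambda> (fst p) i"
      using fun_cong[OF d, of i] by (simp add: ddeg_def)
  qed
  from monomial_in_level[OF p refl this] show ?case
    by (intro bexI[of _ "deg \<Lambda> (fst p)"] ballI impI mspan_scaleC deg_closed p(1))
next
  case zero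
  show ?case using Nk_zero subspace_0[OF subspace_mspan] by blast
next
  case (add x y)
  then obtain N1 N2 where N: "N1 \<in> Nk k" "N2 \<in> Nk k"
    "\<And>N. N \<in> Nk k \<Longrightarrow> N1 \<le> N \<Longrightarrow> x \<in> mspan (level_pairs N)"
    "\<And>N. N \<in> Nk k \<Longrightarrow> N2 \<le> N \<Longrightarrow> y \<in> mspan (level_pairs N)"
    by blast
  show ?case
    by (intro bexI[of _ "sup N1 N2"] ballI impI subspace_add[OF subspace_mspan] N Nk_sup)
       (simp_all add: le_fun_def)
next
  case (scale r x)
  then show ?case using subspace_scale[OF subspace_mspan] by blast
qed

end

section \<open>Compression to the core\<close>

context ck_family begin

section \<open>Paths that annihilate products of non-zero degree\<close>

text \<open>Extended by the path from \<open>aperiodic_separation\<close>, \<alpha> and \<beta>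
  acquire distinct prefixes of equal degree, whose ranges are orthogonal; the scalars merely
  multiply a zero.\<close>

lemma aperiodic_orthogonal:
  assumes ap: "aperiodic k \<Lambda>"
    and \<alpha>: "\<alpha> \<in> paths \<Lambda>" "src \<Lambda> \<alpha> = v" and \<beta>: "\<beta> \<in> paths \<Lambda>" "src \<Lambda> \<beta> = v"
    and ne: "deg \<Lambda> \<alpha> \<noteq> deg \<Lambda> \<beta>"
  shows "\<exists>\<kappa>\<in>paths \<Lambda>. rng \<Lambda> \<kappa> = v \<and> star (T \<alpha> * T \<kappa>) * (T \<beta> * T \<kappa>) = 0"
proof -
  obtain \<kappa> A A' B B' where \<kappa>: "\<kappa> \<in> paths \<Lambda>" "rng \<Lambda> \<kappa> = v"
    and A: "A \<in> paths \<Lambda>" "A' \<in> paths \<Lambda>" and B: "B \<in> paths \<Lambda>" "B' \<in> paths \<Lambda>"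
    and s: "src \<Lambda> A = rng \<Lambda> A'" "src \<Lambda> B = rng \<Lambda> B'"
    and eq: "cmp \<Lambda> \<alpha> \<kappa> = cmp \<Lambda> A A'" "cmp \<Lambda> \<beta> \<kappa> = cmp \<Lambda> B B'"
    and AB: "deg \<Lambda> A = deg \<Lambda> B" "A \<noteq> B"
    by (rule aperiodic_separation[OF ap \<alpha> \<beta> ne])
  have sk: "src \<Lambda> \<alpha> = rng \<Lambda> \<kappa>" "src \<Lambda> \<beta> = rng \<Lambda> \<kappa>"
    by (simp_all only: \<alpha>(2) \<beta>(2) \<kappa>(2))
  define a where "a = c \<alpha> \<kappa> * cnj (c A A')"
  define b where "b = c \<beta> \<kappa> * cnj (c B B')"
  have "T \<alpha> * T \<kappa> = scaleC a (T A * T A')"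
    by (simp only: T_mult[OF \<alpha>(1) \<kappa>(1) sk(1)] eq T_cmp[OF A s(1)] scaleC_scaleC a_def)
  moreover have "T \<beta> * T \<kappa> = scaleC b (T B * T B')"
    by (simp only: T_mult[OF \<beta>(1) \<kappa>(1) sk(2)] eq T_cmp[OF B s(2)] scaleC_scaleC b_def)
  ultimately have "star (T \<alpha> * T \<kappa>) * (T \<beta> * T \<kappa>)
      = scaleC (cnj a * b) (star (T A') * (star (T A) * T B) * T B')"
    by (simp add: star_scaleC star_mult mult_scaleC_left mult_scaleC_right scaleC_scaleC mult.assoc mult.commute[of b])
  also have "\<dots> = 0"
    using star_T_mult_same_degree[OF A(1) B(1) AB(1)] AB(2) by simp
  finally show ?thesis using \<kappa> by blast
qed

text \<open>Induction over \<open>Y\<close> by lengthening \<tau>: what \<tau> kills stays killed by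
  \<tau>\<kappa>, and \<alpha>\<tau> and \<beta>\<tau> still differ in degree, so aperiodicity
  applies again at the source of \<tau>. The alternative \<open>a = 0\<close> admits compressed
  products that vanish outright.\<close>

lemma aperiodic_annihilates_finite:
  assumes ap: "aperiodic k \<Lambda>" and v: "v \<in> vertices \<Lambda>" and Y: "finite Y"
    and "\<And>a. a \<in> Y \<Longrightarrow> a = 0 \<or> (\<exists>z \<alpha> \<beta>. \<alpha> \<in> paths \<Lambda> \<and> \<beta> \<in> paths \<Lambda> \<and> src \<Lambda> \<alpha> = v \<and> src \<Lambda> \<beta> = v \<and>
      deg \<Lambda> \<alpha> \<noteq> deg \<Lambda> \<beta> \<and> a = scaleC z (star (T \<alpha>) * T \<beta>))"
  shows "\<exists>\<tau>\<in>paths \<Lambda>. rng \<Lambda> \<tau> = v \<and> (\<forall>a\<in>Y. star (T \<tau>) * a * T \<tau> = 0)"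
  using Y assms(4)
proof (induction Y)
  case empty
  show ?case using vertex_path[OF v] rng_of_vertex[OF v] by blast
next
  case (insert a Y)
  then obtain \<tau> where \<tau>: "\<tau> \<in> paths \<Lambda>" "rng \<Lambda> \<tau> = v" "\<And>b. b \<in> Y \<Longrightarrow> star (T \<tau>) * b * T \<tau> = 0"
    by blast
  consider "a = 0" | z \<alpha> \<beta> where "\<alpha> \<in> paths \<Lambda>" "\<beta> \<in> paths \<Lambda>" "src \<Lambda> \<alpha> = v" "src \<Lambda> \<beta> = v"
    "deg \<Lambda> \<alpha> \<noteq> deg \<Lambda> \<beta>" "a = scaleC z (star (T \<alpha>) * T \<beta>)"
    using insert.prems[of a] by blast
  then show ?case
  proof cases
    case 1
    then show ?thesis using \<tau> by (intro bexI[of _ \<tau>]) auto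
  next
    case 2
    have s: "src \<Lambda> \<alpha> = rng \<Lambda> \<tau>" "src \<Lambda> \<beta> = rng \<Lambda> \<tau>" by (simp_all only: 2 \<tau>(2))
    define \<alpha>' where "\<alpha>' = cmp \<Lambda> \<alpha> \<tau>"
    define \<beta>' where "\<beta>' = cmp \<Lambda> \<beta> \<tau>"
    have P: "\<alpha>' \<in> paths \<Lambda>" "\<beta>' \<in> paths \<Lambda>" "src \<Lambda> \<alpha>' = src \<Lambda> \<tau>" "src \<Lambda> \<beta>' = src \<Lambda> \<tau>"
      unfolding \<alpha>'_def \<beta>'_def
      by (rule cmp_closed[OF 2(1) \<tau>(1) s(1)] cmp_closed[OF 2(2) \<tau>(1) s(2)]
          src_cmp[OF 2(1) \<tau>(1) s(1)] src_cmp[OF 2(2) \<tau>(1) s(2)])+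
    have "deg \<Lambda> \<alpha>' \<noteq> deg \<Lambda> \<beta>'"
      unfolding \<alpha>'_def \<beta>'_def deg_cmp[OF 2(1) \<tau>(1) s(1)] deg_cmp[OF 2(2) \<tau>(1) s(2)]
      using 2(5) by (simp add: fun_eq_iff)
    from aperiodic_orthogonal[OF ap P(1,3) P(2,4) this]
    obtain \<kappa> where \<kappa>: "\<kappa> \<in> paths \<Lambda>" "rng \<Lambda> \<kappa> = src \<Lambda> \<tau>" "star (T \<alpha>' * T \<kappa>) * (T \<beta>' * T \<kappa>) = 0"
      by blast
    define \<tau>' where "\<tau>' = cmp \<Lambda> \<tau> \<kappa>"
    have \<tau>': "\<tau>' \<in> paths \<Lambda>" "rng \<Lambda> \<tau>' = v"
      unfolding \<tau>'_def using cmp_closed[OF \<tau>(1) \<kappa>(1)] rng_cmp[OF \<tau>(1) \<kappa>(1)] \<kappa>(2) \<tau>(2) by simp_all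
    define w where "w = cnj (c \<tau> \<kappa>)"
    have "T \<tau>' = scaleC w (T \<tau> * T \<kappa>)"
      unfolding \<tau>'_def w_def by (rule T_cmp[OF \<tau>(1) \<kappa>(1) \<kappa>(2)[symmetric]])
    then have sand: "star (T \<tau>') * b * T \<tau>' = scaleC (cnj w * w) (star (T \<kappa>) * (star (T \<tau>) * b * T \<tau>) * T \<kappa>)" for b
      by (simp add: star_scaleC star_mult mult_scaleC_left mult_scaleC_right scaleC_scaleC mult.assoc mult.commute)
    define u where "u = cnj (c \<alpha> \<tau>) * c \<beta> \<tau>"
    have "star (T \<tau>) * a * T \<tau> = scaleC z (star (T \<alpha> * T \<tau>) * (T \<beta> * T \<tau>))"
      by (simp add: 2(6) star_mult mult_scaleC_left mult_scaleC_right mult.assoc)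
    also have "\<dots> = scaleC (z * u) (star (T \<alpha>') * T \<beta>')"
      unfolding T_mult[OF 2(1) \<tau>(1) s(1)] T_mult[OF 2(2) \<tau>(1) s(2)] \<alpha>'_def \<beta>'_def u_def
      by (simp add: star_scaleC mult_scaleC_left mult_scaleC_right scaleC_scaleC mult_ac)
    finally have "star (T \<tau>') * a * T \<tau>' = scaleC (cnj w * w * (z * u)) (star (T \<alpha>' * T \<kappa>) * (T \<beta>' * T \<kappa>))"
      unfolding sand by (simp add: star_mult mult_scaleC_left mult_scaleC_right scaleC_scaleC mult.assoc)
    then have "star (T \<tau>') * a * T \<tau>' = 0" by (simp only: \<kappa>(3) scaleC_zero_right)
    moreover have "star (T \<tau>') * b * T \<tau>' = 0" if "b \<in> Y" for b
      using \<tau>(3)[OF that] by (simp add: sand)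
    ultimately show ?thesis using \<tau>' by (intro bexI[of _ \<tau>']) auto
  qed
qed

text \<open>Cut \<kappa> at the degree of \<mu>: the product survives only if the initial piece is
  \<mu> itself, and then the tail remains.\<close>

lemma star_T_mult_prefix:
  assumes \<kappa>: "\<kappa> \<in> paths \<Lambda>" and \<mu>: "\<mu> \<in> paths \<Lambda>" and le: "deg \<Lambda> \<mu> \<le> deg \<Lambda> \<kappa>"
  shows "star (T \<kappa>) * T \<mu> = 0 \<or> (\<exists>z \<alpha>. \<alpha> \<in> paths \<Lambda> \<and> src \<Lambda> \<alpha> = src \<Lambda> \<kappa> \<and> deg \<Lambda> \<alpha> = deg \<Lambda> \<kappa> - deg \<Lambda> \<mu> \<and>
    star (T \<kappa>) * T \<mu> = scaleC z (star (T \<alpha>)))"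
proof -
  obtain \<mu>' \<alpha> where P: "\<mu>' \<in> paths \<Lambda>" "\<alpha> \<in> paths \<Lambda>" "deg \<Lambda> \<mu>' = deg \<Lambda> \<mu>"
    "deg \<Lambda> \<alpha> = deg \<Lambda> \<kappa> - deg \<Lambda> \<mu>" "src \<Lambda> \<mu>' = rng \<Lambda> \<alpha>" "\<kappa> = cmp \<Lambda> \<mu>' \<alpha>"
    by (rule factorise[OF \<kappa> deg_closed[OF \<mu>] le])
  define z where "z = cnj (cnj (c \<mu>' \<alpha>))"
  have src: "src \<Lambda> \<alpha> = src \<Lambda> \<kappa>"
    unfolding P(6) by (rule src_cmp[OF P(1,2,5), symmetric])
  have "T \<kappa> = scaleC (cnj (c \<mu>' \<alpha>)) (T \<mu>' * T \<alpha>)"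
    unfolding P(6) by (rule T_cmp[OF P(1,2,5)])
  then have e: "star (T \<kappa>) * T \<mu> = scaleC z (star (T \<alpha>) * (star (T \<mu>') * T \<mu>))"
    by (simp only: star_scaleC star_mult mult_scaleC_left z_def mult.assoc)
  show ?thesis
  proof (cases "\<mu>' = \<mu>")
    case False
    then show ?thesis by (simp add: e star_T_mult_same_degree[OF P(1) \<mu> P(3)])
  next
    case True
    have "star (T \<mu>') * T \<mu> = T (rng \<Lambda> \<alpha>)"
      using T_star_mult_self[OF P(1)] unfolding P(5) by (simp only: True)
    then have "star (T \<kappa>) * T \<mu> = scaleC z (star (T \<alpha>))"
      by (simp only: e star_T_rng[OF P(2)])
    with P(2,4) src show ?thesis by blast
  qed
qed

text \<open>As both degrees lie below \<open>N\<close>, the tails left by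
  \<open>star_T_mult_prefix\<close> have the untruncated degrees
  \<open>N - deg \<Lambda> \<mu>\<close> and \<open>N - deg \<Lambda> \<mu>'\<close>, which differ.
  This is the form that \<open>aperiodic_annihilates_finite\<close> expects.\<close>

lemma compressed_monomial:
  assumes \<kappa>: "\<kappa> \<in> paths \<Lambda>" "src \<Lambda> \<kappa> = v" and \<nu>: "\<nu> \<in> paths \<Lambda>" "src \<Lambda> \<nu> = v"
    and N: "deg \<Lambda> \<kappa> = N" "deg \<Lambda> \<nu> = N"
    and \<mu>: "\<mu> \<in> paths \<Lambda>" "deg \<Lambda> \<mu> \<le> N" and \<mu>': "\<mu>' \<in> paths \<Lambda>" "deg \<Lambda> \<mu>' \<le> N"
    and ne: "deg \<Lambda> \<mu> \<noteq> deg \<Lambda> \<mu>'" and a: "a = star (T \<kappa>) * (T \<mu> * star (T \<mu>')) * T \<nu>"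
  shows "a = 0 \<or> (\<exists>z \<alpha> \<beta>. \<alpha> \<in> paths \<Lambda> \<and> \<beta> \<in> paths \<Lambda> \<and> src \<Lambda> \<alpha> = v \<and> src \<Lambda> \<beta> = v \<and>
      deg \<Lambda> \<alpha> \<noteq> deg \<Lambda> \<beta> \<and> a = scaleC z (star (T \<alpha>) * T \<beta>))"
proof -
  have a': "a = (star (T \<kappa>) * T \<mu>) * star (star (T \<nu>) * T \<mu>')"
    by (simp add: a star_mult star_star mult.assoc)
  have le: "deg \<Lambda> \<mu> \<le> deg \<Lambda> \<kappa>" "deg \<Lambda> \<mu>' \<le> deg \<Lambda> \<nu>" using \<mu>(2) \<mu>'(2) N by simp_all
  show ?thesis
  proof (rule ccontr)
    assume contra: "\<not> ?thesis"
    then have "star (T \<kappa>) * T \<mu> \<noteq> 0" "star (T \<nu>) * T \<mu>' \<noteq> 0" by (auto simp: a')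
    then obtain z \<alpha> w \<beta> where
      \<alpha>: "\<alpha> \<in> paths \<Lambda>" "src \<Lambda> \<alpha> = v" "deg \<Lambda> \<alpha> = N - deg \<Lambda> \<mu>" "star (T \<kappa>) * T \<mu> = scaleC z (star (T \<alpha>))" and
      \<beta>: "\<beta> \<in> paths \<Lambda>" "src \<Lambda> \<beta> = v" "deg \<Lambda> \<beta> = N - deg \<Lambda> \<mu>'" "star (T \<nu>) * T \<mu>' = scaleC w (star (T \<beta>))"
      using star_T_mult_prefix[OF \<kappa>(1) \<mu>(1) le(1)] star_T_mult_prefix[OF \<nu>(1) \<mu>'(1) le(2)] N \<kappa>(2) \<nu>(2)
      by auto
    have "deg \<Lambda> \<alpha> \<noteq> deg \<Lambda> \<beta>"
    proof
      assume "deg \<Lambda> \<alpha> = deg \<Lambda> \<beta>"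
      then have "N - deg \<Lambda> \<mu> = N - deg \<Lambda> \<mu>'" by (simp only: \<alpha>(3) \<beta>(3))
      from fun_cong[OF this] have diff: "N i - deg \<Lambda> \<mu> i = N i - deg \<Lambda> \<mu>' i" for i
        by simp
      have "deg \<Lambda> \<mu> i = deg \<Lambda> \<mu>' i" for i
        using diff[of i] le_funD[OF \<mu>(2), of i] le_funD[OF \<mu>'(2), of i] by arith
      then show False using ne by (simp add: fun_eq_iff)
    qed
    moreover have "a = scaleC (z * cnj w) (star (T \<alpha>) * T \<beta>)"
      by (simp add: a' \<alpha>(4) \<beta>(4) star_scaleC star_star mult_scaleC_left mult_scaleC_right scaleC_scaleC mult.commute)
    ultimately show False using contra \<alpha>(1,2) \<beta>(1,2) by blast
  qed
qed

section \<open>Compression projections and matrix blocks\<close>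

text \<open>On the matrix block of the vertex \<open>rng \<Lambda> \<tau>\<close> this is the
  identity matrix tensored with \<open>T \<tau> * star (T \<tau>)\<close>; on the other blocks it is
  zero. Writing \<open>T \<kappa> * T \<tau>\<close> instead of
  \<open>T (cmp \<Lambda> \<kappa> \<tau>)\<close> keeps the scalars \<open>c\<close> out.\<close>

definition compression :: "'l set \<Rightarrow> 'l \<Rightarrow> 'a" where
  "compression F \<tau> = (\<Sum>\<kappa>\<in>{\<kappa>\<in>F. src \<Lambda> \<kappa> = rng \<Lambda> \<tau>}. (T \<kappa> * T \<tau>) * star (T \<kappa> * T \<tau>))"

end

locale ck_level = ck_family k \<Lambda> c T for k and \<Lambda> :: "'l kgraph" and c and T :: "'l \<Rightarrow> 'a::cstar_algebra" +
  fixes F :: "'l set" and N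
  assumes finite_F: "finite F" and F_paths: "\<kappa> \<in> F \<Longrightarrow> \<kappa> \<in> paths \<Lambda>" and F_deg: "\<kappa> \<in> F \<Longrightarrow> deg \<Lambda> \<kappa> = N"
begin

abbreviation "F_pairs \<equiv> (F \<times> F) \<inter> cofinal_pairs \<Lambda>"

lemma F_orthogonal: "\<kappa> \<in> F \<Longrightarrow> \<nu> \<in> F \<Longrightarrow> star (T \<kappa>) * T \<nu> = (if \<kappa> = \<nu> then T (src \<Lambda> \<kappa>) else 0)"
  by (rule star_T_mult_same_degree) (simp_all add: F_paths F_deg)

lemma star_compression: "star (compression F \<tau>) = compression F \<tau>"
  by (simp add: compression_def star_sum star_mult star_star mult.assoc)

lemma compressed_orthogonal:
  assumes \<tau>: "\<tau> \<in> paths \<Lambda>" and "\<kappa> \<in> F" "\<nu> \<in> F" "src \<Lambda> \<kappa> = rng \<Lambda> \<tau>" "src \<Lambda> \<nu> = rng \<Lambda> \<tau>"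
  shows "star (T \<kappa> * T \<tau>) * (T \<nu> * T \<tau>) = (if \<kappa> = \<nu> then T (src \<Lambda> \<tau>) else 0)"
proof -
  have "star (T \<kappa> * T \<tau>) * (T \<nu> * T \<tau>) = star (T \<tau>) * (star (T \<kappa>) * T \<nu>) * T \<tau>"
    by (simp add: star_mult mult.assoc)
  then show ?thesis
    by (simp add: F_orthogonal assms star_T_rng T_star_mult_self)
qed

lemma compression_mult:
  assumes \<tau>: "\<tau> \<in> paths \<Lambda>" and \<nu>: "\<nu> \<in> F" "src \<Lambda> \<nu> = rng \<Lambda> \<tau>"
  shows "compression F \<tau> * (T \<nu> * T \<tau>) = T \<nu> * T \<tau>"
proof -
  let ?X = "{\<kappa>\<in>F. src \<Lambda> \<kappa> = rng \<Lambda> \<tau>}"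
  have "compression F \<tau> * (T \<nu> * T \<tau>) = (\<Sum>\<kappa>\<in>?X. (T \<kappa> * T \<tau>) * (star (T \<kappa> * T \<tau>) * (T \<nu> * T \<tau>)))"
    unfolding compression_def sum_distrib_right by (simp only: mult.assoc)
  also have "\<dots> = (\<Sum>\<kappa>\<in>?X. if \<kappa> = \<nu> then T \<nu> * T \<tau> else 0)"
  proof (rule sum.cong[OF refl])
    fix \<kappa> assume "\<kappa> \<in> ?X"
    then have *: "star (T \<kappa> * T \<tau>) * (T \<nu> * T \<tau>) = (if \<kappa> = \<nu> then T (src \<Lambda> \<tau>) else 0)"
      using compressed_orthogonal[OF \<tau>] \<nu> by simp
    show "(T \<kappa> * T \<tau>) * (star (T \<kappa> * T \<tau>) * (T \<nu> * T \<tau>)) = (if \<kappa> = \<nu> then T \<nu> * T \<tau> else 0)"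
      unfolding * by (simp add: mult.assoc T_src[OF \<tau>])
  qed
  also have "\<dots> = T \<nu> * T \<tau>" using finite_F \<nu> by simp
  finally show ?thesis .
qed

lemma compression_idem:
  assumes \<tau>: "\<tau> \<in> paths \<Lambda>"
  shows "compression F \<tau> * compression F \<tau> = compression F \<tau>"
proof -
  let ?X = "{\<kappa>\<in>F. src \<Lambda> \<kappa> = rng \<Lambda> \<tau>}"
  have "compression F \<tau> * compression F \<tau>
      = (\<Sum>\<kappa>\<in>?X. (compression F \<tau> * (T \<kappa> * T \<tau>)) * star (T \<kappa> * T \<tau>))"
    by (subst (2) compression_def) (simp only: sum_distrib_left mult.assoc)
  also have "\<dots> = compression F \<tau>"
    unfolding compression_def[of F \<tau>, symmetric]
    by (subst (2) compression_def, rule sum.cong[OF refl]) (simp add: compression_mult[OF \<tau>])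
  finally show ?thesis .
qed

text \<open>Multiplying on either side inserts \<open>T \<tau> * star (T \<tau>)\<close> between the
  factors of \<open>T \<kappa> * star (T \<nu>)\<close>, or gives 0 when their source is not
  \<open>rng \<Lambda> \<tau>\<close>.\<close>

lemma compression_commutes:
  assumes \<tau>: "\<tau> \<in> paths \<Lambda>" and "x \<in> mspan F_pairs"
  shows "compression F \<tau> * x = x * compression F \<tau>"
  using assms(2)
proof (induction rule: mspan_induct)
  case (monomial z p)
  define \<kappa> where "\<kappa> = fst p"
  define \<nu> where "\<nu> = snd p"
  have p: "\<kappa> \<in> F" "\<nu> \<in> F" "src \<Lambda> \<kappa> = src \<Lambda> \<nu>"
    using monomial by (auto simp: cofinal_pairs_def \<kappa>_def \<nu>_def)
  let ?X = "{\<omega>\<in>F. src \<Lambda> \<omega> = rng \<Lambda> \<tau>}"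
  have L: "star (T \<nu>) * compression F \<tau> = (if src \<Lambda> \<nu> = rng \<Lambda> \<tau> then T \<tau> * star (T \<nu> * T \<tau>) else 0)" if "\<nu> \<in> F" for \<nu>
  proof -
    have "star (T \<nu>) * compression F \<tau> = (\<Sum>\<omega>\<in>?X. (star (T \<nu>) * T \<omega>) * T \<tau> * star (T \<omega> * T \<tau>))"
      unfolding compression_def sum_distrib_left by (simp only: mult.assoc)
    also have "\<dots> = (\<Sum>\<omega>\<in>?X. if \<omega> = \<nu> then T \<tau> * star (T \<nu> * T \<tau>) else 0)"
    proof (rule sum.cong[OF refl])
      fix \<omega> assume "\<omega> \<in> ?X"
      then show "star (T \<nu>) * T \<omega> * T \<tau> * star (T \<omega> * T \<tau>) = (if \<omega> = \<nu> then T \<tau> * star (T \<nu> * T \<tau>) else 0)"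
        using that by (auto simp: F_orthogonal T_rng[OF \<tau>])
    qed
    also have "\<dots> = (if src \<Lambda> \<nu> = rng \<Lambda> \<tau> then T \<tau> * star (T \<nu> * T \<tau>) else 0)"
      using finite_F that by simp
    finally show ?thesis .
  qed
  have R: "compression F \<tau> * T \<kappa> = (if src \<Lambda> \<kappa> = rng \<Lambda> \<tau> then T \<kappa> * T \<tau> * star (T \<tau>) else 0)"
    using arg_cong[OF L[OF p(1)], of star] by (simp add: star_mult star_star star_compression mult.assoc split: if_splits)
  have "compression F \<tau> * (T \<kappa> * star (T \<nu>)) = (T \<kappa> * star (T \<nu>)) * compression F \<tau>"
    unfolding mult.assoc L[OF p(2)] unfolding mult.assoc[symmetric] R
    by (simp add: p(3) star_mult mult.assoc)
  then show ?case by (simp add: mult_scaleC_left mult_scaleC_right \<kappa>_def \<nu>_def)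
qed (simp_all add: distrib_left distrib_right)

lemma compression_annihilates:
  assumes y: "y \<in> mspan E"
    and E: "\<And>p \<kappa> \<nu>. p \<in> E \<Longrightarrow> \<kappa> \<in> F \<Longrightarrow> \<nu> \<in> F \<Longrightarrow> src \<Lambda> \<kappa> = rng \<Lambda> \<tau> \<Longrightarrow> src \<Lambda> \<nu> = rng \<Lambda> \<tau> \<Longrightarrow>
      star (T \<tau>) * (star (T \<kappa>) * (T (fst p) * star (T (snd p))) * T \<nu>) * T \<tau> = 0"
  shows "compression F \<tau> * y * compression F \<tau> = 0"
  using y
proof (induction rule: mspan_induct)
  case (monomial z p)
  let ?X = "{\<kappa>\<in>F. src \<Lambda> \<kappa> = rng \<Lambda> \<tau>}"
  define g where "g = T (fst p) * star (T (snd p))"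
  have "compression F \<tau> * g * compression F \<tau>
      = (\<Sum>\<nu>\<in>?X. \<Sum>\<kappa>\<in>?X. (T \<kappa> * T \<tau>) * (star (T \<tau>) * (star (T \<kappa>) * g * T \<nu>) * T \<tau>) * star (T \<nu> * T \<tau>))"
    unfolding compression_def sum_distrib_left sum_distrib_right by (simp add: star_mult mult.assoc)
  also have "\<dots> = 0"
    by (intro sum.neutral ballI) (simp add: E[OF monomial] g_def)
  finally show ?case by (simp add: mult_scaleC_left mult_scaleC_right g_def)
qed (simp_all add: distrib_left distrib_right)

lemma F_pairs_mult: "x \<in> mspan F_pairs \<Longrightarrow> y \<in> mspan F_pairs \<Longrightarrow> x * y \<in> mspan F_pairs"
proof (erule mspan_mult, assumption)
  fix p q assume p: "p \<in> F_pairs" and q: "q \<in> F_pairs"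
  have "(T (fst p) * star (T (snd p))) * (T (fst q) * star (T (snd q)))
      = T (fst p) * (star (T (snd p)) * T (fst q)) * star (T (snd q))"
    by (simp only: mult.assoc)
  also have "\<dots> \<in> mspan F_pairs"
  proof (cases "snd p = fst q")
    case True
    have "T (fst p) * T (src \<Lambda> (snd p)) = T (fst p)"
      using p T_src[of "fst p"] by (auto simp: cofinal_pairs_def)
    moreover have "(fst p, snd q) \<in> F_pairs"
      using p q True by (auto simp: cofinal_pairs_def)
    ultimately show ?thesis
      using p q True monomial_in_mspan[of "(fst p, snd q)" F_pairs 1] by (auto simp: F_orthogonal)
  next
    case False
    moreover have "snd p \<in> F" "fst q \<in> F" using p q by auto
    ultimately show ?thesis by (simp add: F_orthogonal subspace_0[OF subspace_mspan])
  qed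
  finally show "(T (fst p) * star (T (snd p))) * (T (fst q) * star (T (snd q))) \<in> mspan F_pairs" .
qed

lemma F_pairs_star:
  assumes "x \<in> mspan F_pairs"
  shows "star x \<in> mspan F_pairs"
proof -
  have "prod.swap ` F_pairs \<subseteq> F_pairs" by (auto simp: cofinal_pairs_def)
  from subsetD[OF mspan_mono[OF this] mspan_star[OF assms]] show ?thesis .
qed

lemma F_pairs_iterated_square: "x \<in> mspan F_pairs \<Longrightarrow> iterated_square x j \<in> mspan F_pairs"
  by (induction j) (simp_all add: F_pairs_mult F_pairs_star)

text \<open>Orthogonality leaves only the matrix entry at (\<kappa>, \<nu>), attached to a vertex
  projection; its modulus can then be recovered after a homomorphism that does not kill the
  projection.\<close>

lemma F_pairs_coefficient:
  assumes "x \<in> mspan F_pairs" and \<kappa>: "\<kappa> \<in> F" and \<nu>: "\<nu> \<in> F"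
  shows "\<exists>a. star (T \<kappa>) * x * T \<nu> = scaleC a (T (src \<Lambda> \<kappa>))"
  using assms(1)
proof (induction rule: mspan_induct)
  case (monomial z p)
  have p: "fst p \<in> F" "snd p \<in> F" "src \<Lambda> (fst p) = src \<Lambda> (snd p)"
    using monomial by (auto simp: cofinal_pairs_def)
  have "star (T \<kappa>) * scaleC z (T (fst p) * star (T (snd p))) * T \<nu>
      = scaleC z ((star (T \<kappa>) * T (fst p)) * (star (T (snd p)) * T \<nu>))"
    by (simp only: mult_scaleC_left mult_scaleC_right mult.assoc)
  moreover have "(star (T \<kappa>) * T (fst p)) * (star (T (snd p)) * T \<nu>) = (if \<kappa> = fst p \<and> snd p = \<nu> then T (src \<Lambda> \<kappa>) else 0)"
    using \<kappa> \<nu> p F_paths by (simp add: F_orthogonal T_vertex(1) src_vertex)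
  ultimately show ?case
    by (cases "\<kappa> = fst p \<and> snd p = \<nu>") (auto intro: exI[of _ 0])
next
  case zero
  show ?case by (intro exI[of _ 0]) simp
next
  case (add x y)
  then show ?case by (auto simp: distrib_left distrib_right simp flip: scaleC_add_left)
next
  case (scale r x)
  then obtain a where "star (T \<kappa>) * x * T \<nu> = scaleC a (T (src \<Lambda> \<kappa>))" by blast
  then show ?case
    by (intro exI[of _ "complex_of_real r * a"])
       (simp add: scaleC_of_real[symmetric] mult_scaleC_left mult_scaleC_right scaleC_scaleC)
qed

lemma F_pairs_expand:
  assumes "x \<in> mspan F_pairs"
  shows "x = (\<Sum>\<kappa>\<in>F. \<Sum>\<nu>\<in>F. T \<kappa> * (star (T \<kappa>) * x * T \<nu>) * star (T \<nu>))"
proof -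
  define Q where "Q = (\<Sum>\<kappa>\<in>F. T \<kappa> * star (T \<kappa>))"
  have sQ: "star Q = Q" by (simp add: Q_def star_sum star_mult star_star)
  have QT: "Q * T \<nu> = T \<nu>" if "\<nu> \<in> F" for \<nu>
  proof -
    have "Q * T \<nu> = (\<Sum>\<kappa>\<in>F. T \<kappa> * (star (T \<kappa>) * T \<nu>))"
      unfolding Q_def sum_distrib_right by (simp only: mult.assoc)
    also have "\<dots> = (\<Sum>\<kappa>\<in>F. if \<kappa> = \<nu> then T \<nu> else 0)"
      using that by (intro sum.cong refl) (simp add: F_orthogonal T_src F_paths)
    finally show ?thesis using finite_F that by simp
  qed
  have left: "Q * x = x" if "x \<in> mspan F_pairs" for x
    using that
  proof (induction rule: mspan_induct)
    case (monomial z p)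
    then have "Q * T (fst p) = T (fst p)" by (intro QT) auto
    then show ?case by (simp add: mult_scaleC_right mult.assoc[symmetric])
  qed (simp_all add: distrib_left)
  have "star (Q * star x) = star (star x)"
    by (simp only: left[OF F_pairs_star[OF assms]])
  then have "x * Q = x" by (simp add: star_mult star_star sQ)
  with left[OF assms] have "x = Q * x * Q" by simp
  also have "\<dots> = (\<Sum>\<nu>\<in>F. \<Sum>\<kappa>\<in>F. T \<kappa> * (star (T \<kappa>) * x * T \<nu>) * star (T \<nu>))"
    unfolding Q_def sum_distrib_left sum_distrib_right by (simp only: mult.assoc)
  also have "\<dots> = (\<Sum>\<kappa>\<in>F. \<Sum>\<nu>\<in>F. T \<kappa> * (star (T \<kappa>) * x * T \<nu>) * star (T \<nu>))"
    by (rule sum.swap)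
  finally show ?thesis .
qed

end

section \<open>Isometry on the core\<close>

text \<open>In the application \<open>T\<close> is the family \<open>t\<close> in C*(B(\<sigma>))
  and \<phi> is \<pi>T. Non-vanishing is imposed on the images, which are then projections of norm
  exactly 1.\<close>

locale ck_morphism = ck_family k \<Lambda> c T for k and \<Lambda> :: "'l kgraph" and c and T :: "'l \<Rightarrow> 'd::cstar_algebra" +
  fixes \<phi> :: "'d \<Rightarrow> 'a::cstar_algebra"
  assumes hom: "star_hom full_algebra full_algebra \<phi>"
    and aperiodic: "aperiodic k \<Lambda>"
    and nonzero: "v \<in> vertices \<Lambda> \<Longrightarrow> \<phi> (T v) \<noteq> 0"
begin

lemma hom_add: "\<phi> (x + y) = \<phi> x + \<phi> y"
  and hom_mult: "\<phi> (x * y) = \<phi> x * \<phi> y"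
  and hom_star: "\<phi> (star x) = star (\<phi> x)"
  and hom_scaleC: "\<phi> (scaleC z x) = scaleC z (\<phi> x)"
  using hom by (simp_all add: star_hom_def)

lemma hom_scaleR: "\<phi> (r *\<^sub>R x) = r *\<^sub>R \<phi> x"
  by (simp add: scaleC_of_real[symmetric] hom_scaleC)

lemma hom_diff: "\<phi> (x - y) = \<phi> x - \<phi> y"
  using hom_add[of x "- y"] hom_scaleR[of "-1" y] by simp

lemma hom_contractive: "norm (\<phi> x) \<le> norm x"
  by (rule star_homomorphism_contractive[of UNIV])
     (simp_all add: star_subalgebra_def hom_add hom_mult hom_star hom_scaleR)

lemma hom_iterated_square: "\<phi> (iterated_square x j) = iterated_square (\<phi> x) j"
  by (induction j) (simp_all add: hom_mult hom_star)

text \<open>Cutting \<open>x * compression F \<tau>\<close> by the paths \<kappa>\<tau> and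
  \<nu>\<tau> returns the entry \<open>a\<close> of \<open>x\<close> times the projection at
  \<open>src \<Lambda> \<tau>\<close>, whose image has norm 1. If \<kappa> and \<nu> have different
  sources, the entry vanishes.\<close>

lemma core_entry_bound:
  assumes F: "finite F" "\<And>\<kappa>. \<kappa> \<in> F \<Longrightarrow> \<kappa> \<in> paths \<Lambda>" "\<And>\<kappa>. \<kappa> \<in> F \<Longrightarrow> deg \<Lambda> \<kappa> = N"
    and x: "x \<in> mspan (F \<times> F \<inter> cofinal_pairs \<Lambda>)" and \<kappa>: "\<kappa> \<in> F" and \<nu>: "\<nu> \<in> F"
    and \<tau>: "\<tau> \<in> paths \<Lambda>" "rng \<Lambda> \<tau> = src \<Lambda> \<kappa>"
  shows "norm (T \<kappa> * (star (T \<kappa>) * x * T \<nu>) * star (T \<nu>)) \<le> norm (\<phi> (x * compression F \<tau>))"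
proof -
  interpret ck_level k \<Lambda> c T F N
    by unfold_locales (fact F)+
  have P: "\<kappa> \<in> paths \<Lambda>" "\<nu> \<in> paths \<Lambda>" using F(2) \<kappa> \<nu> by blast+
  obtain a where a: "star (T \<kappa>) * x * T \<nu> = scaleC a (T (src \<Lambda> \<kappa>))"
    using F_pairs_coefficient[OF x \<kappa> \<nu>] by blast
  show ?thesis
  proof (cases "src \<Lambda> \<kappa> = src \<Lambda> \<nu>")
    case False
    have "star (T \<kappa>) * x * T \<nu> = star (T \<kappa>) * x * T \<nu> * T (src \<Lambda> \<nu>)"
      by (simp only: mult.assoc T_src[OF P(2)])
    also have "\<dots> = 0"
      unfolding a using False by (simp add: mult_scaleC_left T_vertex_orthogonal src_vertex P)
    finally show ?thesis by simp
  next
    case True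
    have nT: "norm (T (src \<Lambda> \<kappa>)) \<le> 1" by (rule norm_T_le_1[OF src_closed[OF P(1)]])
    have "norm (T \<kappa> * (star (T \<kappa>) * x * T \<nu>) * star (T \<nu>)) \<le> norm (T \<kappa> * (star (T \<kappa>) * x * T \<nu>)) * norm (star (T \<nu>))"
      by (rule norm_mult_ineq)
    also have "\<dots> \<le> norm (T \<kappa> * (star (T \<kappa>) * x * T \<nu>))"
      using norm_T_le_1[OF P(2)] by (simp add: mult_left_le)
    also have "\<dots> \<le> norm (T \<kappa>) * norm (star (T \<kappa>) * x * T \<nu>)"
      by (rule norm_mult_ineq)
    also have "\<dots> \<le> norm (star (T \<kappa>) * x * T \<nu>)"
      using norm_T_le_1[OF P(1)] by (simp add: mult_left_le_one_le)
    also have "\<dots> \<le> cmod a"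
      unfolding a using nT by (simp add: norm_scaleC mult_left_le)
    finally have 1: "norm (T \<kappa> * (star (T \<kappa>) * x * T \<nu>) * star (T \<nu>)) \<le> cmod a" .
    let ?P = "compression F \<tau>"
    have W: "norm (\<phi> (T \<omega> * T \<tau>)) \<le> 1" if "\<omega> \<in> paths \<Lambda>" for \<omega>
    proof -
      have "norm (\<phi> (T \<omega> * T \<tau>)) \<le> norm (T \<omega> * T \<tau>)" by (rule hom_contractive)
      also have "\<dots> \<le> norm (T \<omega>) * norm (T \<tau>)" by (rule norm_mult_ineq)
      also have "\<dots> \<le> 1" using norm_T_le_1[OF that] norm_T_le_1[OF \<tau>(1)] by (simp add: mult_le_one)
      finally show ?thesis .
    qed
    have "star (T \<kappa> * T \<tau>) * (x * ?P) * (T \<nu> * T \<tau>) = star (T \<kappa> * T \<tau>) * x * (?P * (T \<nu> * T \<tau>))"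
      by (simp only: mult.assoc)
    also have "\<dots> = star (T \<tau>) * (star (T \<kappa>) * x * T \<nu>) * T \<tau>"
      unfolding compression_mult[OF \<tau>(1) \<nu> True[symmetric, folded \<tau>(2)]] by (simp only: star_mult mult.assoc)
    also have "\<dots> = scaleC a (T (src \<Lambda> \<tau>))"
      by (simp add: a mult_scaleC_left mult_scaleC_right \<tau>(2)[symmetric] star_T_rng[OF \<tau>(1)] T_star_mult_self[OF \<tau>(1)])
    finally have eq: "\<phi> (star (T \<kappa> * T \<tau>)) * \<phi> (x * ?P) * \<phi> (T \<nu> * T \<tau>) = scaleC a (\<phi> (T (src \<Lambda> \<tau>)))"
      by (simp only: hom_mult[symmetric] hom_scaleC[symmetric])
    have "norm (\<phi> (T (src \<Lambda> \<tau>))) = 1"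
      using T_vertex[OF src_vertex[OF \<tau>(1)]] nonzero[OF src_vertex[OF \<tau>(1)]]
      by (intro norm_projection) (simp_all add: hom_star[symmetric] hom_mult[symmetric])
    then have "cmod a = norm (\<phi> (star (T \<kappa> * T \<tau>)) * \<phi> (x * ?P) * \<phi> (T \<nu> * T \<tau>))"
      by (simp add: eq norm_scaleC)
    also have "\<dots> \<le> norm (\<phi> (star (T \<kappa> * T \<tau>)) * \<phi> (x * ?P)) * norm (\<phi> (T \<nu> * T \<tau>))"
      by (rule norm_mult_ineq)
    also have "\<dots> \<le> norm (\<phi> (star (T \<kappa> * T \<tau>)) * \<phi> (x * ?P))"
      using W[OF P(2)] by (intro mult_left_le) auto
    also have "\<dots> \<le> norm (\<phi> (star (T \<kappa> * T \<tau>))) * norm (\<phi> (x * ?P))"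
      by (rule norm_mult_ineq)
    also have "\<dots> \<le> norm (\<phi> (x * ?P))"
      unfolding hom_star norm_star using W[OF P(1)] by (intro mult_left_le_one_le) auto
    finally show ?thesis using 1 by (rule order_trans[rotated])
  qed
qed

text \<open>Estimating a matrix by its entries costs the factor \<open>card F * card F\<close>. As
  the compressions commute with \<open>x\<close>, the estimate applies to all iterated squares with
  the same factor, and passing to roots removes it.\<close>

lemma core_norm_bound:
  assumes F: "finite F" "\<And>\<kappa>. \<kappa> \<in> F \<Longrightarrow> \<kappa> \<in> paths \<Lambda>" "\<And>\<kappa>. \<kappa> \<in> F \<Longrightarrow> deg \<Lambda> \<kappa> = N"
    and x: "x \<in> mspan (F \<times> F \<inter> cofinal_pairs \<Lambda>)"
    and \<tau>: "\<And>v. v \<in> src \<Lambda> ` F \<Longrightarrow> \<tau> v \<in> paths \<Lambda>" "\<And>v. v \<in> src \<Lambda> ` F \<Longrightarrow> rng \<Lambda> (\<tau> v) = v"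
    and K: "K \<ge> 0" "\<And>v. v \<in> src \<Lambda> ` F \<Longrightarrow> norm (\<phi> (x * compression F (\<tau> v))) \<le> K"
  shows "norm x \<le> K"
proof -
  interpret ck_level k \<Lambda> c T F N
    by unfold_locales (fact F)+
  have pw: "iterated_square x j * compression F (\<tau> v) = iterated_square (x * compression F (\<tau> v)) j"
    if v: "v \<in> src \<Lambda> ` F" for v j
  proof (induction j)
    case 0
    let ?P = "compression F (\<tau> v)"
    have cm: "?P * (star x * x) = star x * x * ?P"
      by (rule compression_commutes[OF \<tau>(1)[OF v] F_pairs_mult[OF F_pairs_star[OF x] x]])
    have "iterated_square (x * ?P) 0 = ?P * (star x * x) * ?P"
      by (simp add: star_mult star_compression mult.assoc)
    then show ?case
      by (simp only: cm mult.assoc compression_idem[OF \<tau>(1)[OF v]] iterated_square.simps)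
  next
    case (Suc j)
    let ?P = "compression F (\<tau> v)" and ?y = "iterated_square x j"
    have cm: "?P * ?y = ?y * ?P"
      by (rule compression_commutes[OF \<tau>(1)[OF v] F_pairs_iterated_square[OF x]])
    have "(?y * ?P) * (?y * ?P) = ?y * (?P * ?y) * ?P" by (simp only: mult.assoc)
    also have "\<dots> = ?y * ?y * ?P"
      unfolding cm by (simp only: mult.assoc compression_idem[OF \<tau>(1)[OF v]])
    finally show ?case by (simp only: iterated_square.simps Suc[symmetric])
  qed
  have "norm (iterated_square x j) \<le> real (card F * card F) * 1 ^ j * K ^ (2 ^ Suc j)" for j
  proof -
    let ?y = "iterated_square x j"
    have y: "?y \<in> mspan F_pairs" by (rule F_pairs_iterated_square[OF x])
    have entry: "norm (T \<kappa> * (star (T \<kappa>) * ?y * T \<nu>) * star (T \<nu>)) \<le> K ^ (2 ^ Suc j)"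
      if "\<kappa> \<in> F" "\<nu> \<in> F" for \<kappa> \<nu>
    proof -
      have v: "src \<Lambda> \<kappa> \<in> src \<Lambda> ` F" using that by blast
      have "norm (T \<kappa> * (star (T \<kappa>) * ?y * T \<nu>) * star (T \<nu>)) \<le> norm (\<phi> (?y * compression F (\<tau> (src \<Lambda> \<kappa>))))"
        by (rule core_entry_bound[OF F y that \<tau>(1,2)[OF v]])
      also have "\<dots> = norm (\<phi> (x * compression F (\<tau> (src \<Lambda> \<kappa>)))) ^ (2 ^ Suc j)"
        by (simp only: pw[OF v] hom_iterated_square norm_iterated_square)
      also have "\<dots> \<le> K ^ (2 ^ Suc j)"
        by (rule power_mono[OF K(2)[OF v] norm_ge_zero])
      finally show ?thesis .
    qed
    have "norm ?y = norm (\<Sum>\<kappa>\<in>F. \<Sum>\<nu>\<in>F. T \<kappa> * (star (T \<kappa>) * ?y * T \<nu>) * star (T \<nu>))"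
      by (subst F_pairs_expand[OF y]) (rule refl)
    also have "\<dots> \<le> (\<Sum>\<kappa>\<in>F. \<Sum>\<nu>\<in>F. K ^ (2 ^ Suc j))"
      by (intro sum_norm_le entry)
    also have "\<dots> = real (card F * card F) * 1 ^ j * K ^ (2 ^ Suc j)" by simp
    finally show ?thesis .
  qed
  then show ?thesis by (rule norm_le_of_iterated_square_bound[OF K(1)])
qed

lemma exists_common_level:
  assumes "finite E" "E \<subseteq> cofinal_pairs \<Lambda>" "N0 \<in> Nk k"
  shows "\<exists>N\<in>Nk k. N0 \<le> N \<and> (\<forall>p\<in>E. deg \<Lambda> (fst p) \<le> N \<and> deg \<Lambda> (snd p) \<le> N)"
  using assms(1,2)
proof (induction E)
  case empty
  show ?case using assms(3) by blast
next
  case (insert p E)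
  then obtain N where N: "N \<in> Nk k" "N0 \<le> N" "\<And>p. p \<in> E \<Longrightarrow> deg \<Lambda> (fst p) \<le> N \<and> deg \<Lambda> (snd p) \<le> N"
    by auto
  define M where "M = sup N (sup (deg \<Lambda> (fst p)) (deg \<Lambda> (snd p)))"
  have "M \<in> Nk k"
    unfolding M_def using insert.prems by (intro Nk_sup N(1) deg_closed) (auto simp: cofinal_pairs_def)
  moreover have le: "N \<le> M" "deg \<Lambda> (fst p) \<le> M" "deg \<Lambda> (snd p) \<le> M"
    unfolding M_def by (rule sup_ge1 le_supI2[OF sup_ge1] le_supI2[OF sup_ge2])+
  ultimately show ?case
    using N(2,3) order_trans[OF _ le(1)] by (intro bexI[of _ M] conjI ballI) (auto 4 4)
qed

text \<open>The analogue of the contractivity of the conditional expectation onto the core.\<close>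
lemma degree_zero_bound:
  assumes x: "x \<in> mspan {p \<in> cofinal_pairs \<Lambda>. ddeg \<Lambda> p = 0}"
    and y: "y \<in> mspan {p \<in> cofinal_pairs \<Lambda>. ddeg \<Lambda> p \<noteq> 0}"
  shows "norm x \<le> norm (\<phi> (x + y))"
proof -
  obtain E where E: "finite E" "E \<subseteq> {p \<in> cofinal_pairs \<Lambda>. ddeg \<Lambda> p \<noteq> 0}" "y \<in> mspan E"
    using mspan_finite_support[OF y] by blast
  obtain N0 where N0: "N0 \<in> Nk k" "\<And>N. N \<in> Nk k \<Longrightarrow> N0 \<le> N \<Longrightarrow> x \<in> mspan (level_pairs N)"
    using degree_zero_in_level[OF x] by blast
  have "E \<subseteq> cofinal_pairs \<Lambda>" using E(2) by blast
  \<comment> \<open>The level must dominate the degrees in \<open>y\<close>, so that every monomial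
    of \<open>y\<close> can be cut by paths of degree \<open>N\<close>.\<close>
  from exists_common_level[OF E(1) this N0(1)]
  obtain N where N: "N \<in> Nk k" "N0 \<le> N" "\<And>p. p \<in> E \<Longrightarrow> deg \<Lambda> (fst p) \<le> N \<and> deg \<Lambda> (snd p) \<le> N"
    by blast
  obtain E0 where E0: "finite E0" "E0 \<subseteq> level_pairs N" "x \<in> mspan E0"
    using mspan_finite_support[OF N0(2)[OF N(1,2)]] by blast
  define F where "F = fst ` E0 \<union> snd ` E0"
  have F: "finite F" "\<And>\<kappa>. \<kappa> \<in> F \<Longrightarrow> \<kappa> \<in> paths \<Lambda>" "\<And>\<kappa>. \<kappa> \<in> F \<Longrightarrow> deg \<Lambda> \<kappa> = N"
    using E0(1,2) by (auto simp: F_def level_pairs_def cofinal_pairs_def)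
  interpret ck_level k \<Lambda> c T F N
    by unfold_locales (fact F)+
  have "E0 \<subseteq> F_pairs"
    using E0(2) by (force simp: F_def level_pairs_def)
  then have xF: "x \<in> mspan F_pairs"
    using E0(3) mspan_mono by blast
  have "\<exists>\<tau>. \<tau> \<in> paths \<Lambda> \<and> rng \<Lambda> \<tau> = v \<and> compression F \<tau> * y * compression F \<tau> = 0"
    if v: "v \<in> src \<Lambda> ` F" for v
  proof -
    \<comment> \<open>The values of \<open>f\<close> on \<open>D\<close> are the compressed
      monomials of \<open>y\<close> at \<open>v\<close>; being finitely many, they are annihilated
      by one path.\<close>
    define f where "f = (\<lambda>(p, \<kappa>, \<nu>). star (T \<kappa>) * (T (fst p) * star (T (snd p))) * T \<nu>)"
    define D where "D = E \<times> {\<kappa>\<in>F. src \<Lambda> \<kappa> = v} \<times> {\<kappa>\<in>F. src \<Lambda> \<kappa> = v}"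
    have fin: "finite (f ` D)" unfolding D_def using E(1) F(1) by auto
    have vv: "v \<in> vertices \<Lambda>" using v F(2) src_vertex by auto
    have "a = 0 \<or> (\<exists>z \<alpha> \<beta>. \<alpha> \<in> paths \<Lambda> \<and> \<beta> \<in> paths \<Lambda> \<and> src \<Lambda> \<alpha> = v \<and> src \<Lambda> \<beta> = v \<and>
      deg \<Lambda> \<alpha> \<noteq> deg \<Lambda> \<beta> \<and> a = scaleC z (star (T \<alpha>) * T \<beta>))" if "a \<in> f ` D" for a
    proof -
      obtain p \<kappa> \<nu> where p: "p \<in> E" "\<kappa> \<in> F" "src \<Lambda> \<kappa> = v" "\<nu> \<in> F" "src \<Lambda> \<nu> = v"
        and a: "a = star (T \<kappa>) * (T (fst p) * star (T (snd p))) * T \<nu>"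
        using \<open>a \<in> f ` D\<close> by (auto simp: D_def f_def)
      have q: "fst p \<in> paths \<Lambda>" "snd p \<in> paths \<Lambda>" "ddeg \<Lambda> p \<noteq> 0"
        using E(2) p(1) by (auto simp: cofinal_pairs_def)
      then have "deg \<Lambda> (fst p) \<noteq> deg \<Lambda> (snd p)" by (auto simp: ddeg_def fun_eq_iff)
      then show ?thesis
        using compressed_monomial[OF F(2)[OF p(2)] p(3) F(2)[OF p(4)] p(5) F(3)[OF p(2)] F(3)[OF p(4)]
            q(1) _ q(2) _ _ a] N(3)[OF p(1)] by blast
    qed
    from aperiodic_annihilates_finite[OF aperiodic vv fin this]
    obtain \<tau> where \<tau>: "\<tau> \<in> paths \<Lambda>" "rng \<Lambda> \<tau> = v" "\<And>a. a \<in> f ` D \<Longrightarrow> star (T \<tau>) * a * T \<tau> = 0"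
      by blast
    have "compression F \<tau> * y * compression F \<tau> = 0"
    proof (rule compression_annihilates[OF E(3)])
      fix p \<kappa> \<nu> assume p: "p \<in> E" "\<kappa> \<in> F" "\<nu> \<in> F" "src \<Lambda> \<kappa> = rng \<Lambda> \<tau>" "src \<Lambda> \<nu> = rng \<Lambda> \<tau>"
      have "f (p, \<kappa>, \<nu>) \<in> f ` D" using p by (intro imageI) (simp add: D_def \<tau>(2))
      from \<tau>(3)[OF this] show "star (T \<tau>) * (star (T \<kappa>) * (T (fst p) * star (T (snd p))) * T \<nu>) * T \<tau> = 0"
        by (simp add: f_def)
    qed
    with \<tau>(1,2) show ?thesis by blast
  qed
  then obtain \<tau> where \<tau>: "\<And>v. v \<in> src \<Lambda> ` F \<Longrightarrow> \<tau> v \<in> paths \<Lambda>" "\<And>v. v \<in> src \<Lambda> ` F \<Longrightarrow> rng \<Lambda> (\<tau> v) = v"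
    "\<And>v. v \<in> src \<Lambda> ` F \<Longrightarrow> compression F (\<tau> v) * y * compression F (\<tau> v) = 0"
    by metis
  show ?thesis
  proof (rule core_norm_bound[OF F xF \<tau>(1,2) norm_ge_zero])
    fix v assume v: "v \<in> src \<Lambda> ` F"
    let ?P = "compression F (\<tau> v)"
    have P: "star ?P = ?P" "?P * ?P = ?P"
      by (rule star_compression, rule compression_idem[OF \<tau>(1)[OF v]])
    have n: "norm (\<phi> ?P) \<le> 1"
      using P by (intro norm_projection_le_one) (simp_all add: hom_star[symmetric] hom_mult[symmetric])
    \<comment> \<open>The compression kills \<open>y\<close> and commutes with \<open>x\<close>, so
      it turns \<open>x + y\<close> into the single block \<open>x * ?P\<close>.\<close>
    have "?P * (x + y) * ?P = ?P * x * ?P + ?P * y * ?P"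
      by (simp only: distrib_left distrib_right)
    also have "\<dots> = x * (?P * ?P)"
      unfolding \<tau>(3)[OF v] compression_commutes[OF \<tau>(1)[OF v] xF] by (simp add: mult.assoc)
    also have "\<dots> = x * ?P" by (simp only: P(2))
    finally have "norm (\<phi> (x * ?P)) = norm (\<phi> ?P * \<phi> (x + y) * \<phi> ?P)"
      by (simp only: hom_mult[symmetric])
    also have "\<dots> \<le> norm (\<phi> ?P * \<phi> (x + y)) * norm (\<phi> ?P)"
      by (rule norm_mult_ineq)
    also have "\<dots> \<le> norm (\<phi> ?P * \<phi> (x + y))"
      using n by (intro mult_left_le) auto
    also have "\<dots> \<le> norm (\<phi> ?P) * norm (\<phi> (x + y))"
      by (rule norm_mult_ineq)
    also have "\<dots> \<le> norm (\<phi> (x + y))"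
      using n by (intro mult_left_le_one_le) auto
    finally show "norm (\<phi> (x * ?P)) \<le> norm (\<phi> (x + y))" .
  qed
qed

section \<open>Homogeneous parts and their reassembly\<close>

text \<open>The box is symmetric to be stable under adjoints, and its coordinates from
  \<open>k\<close> on vanish to make it finite.\<close>

definition degree_box :: "nat \<Rightarrow> (nat \<Rightarrow> int) set" where
  "degree_box R = {n. (\<forall>i. \<bar>n i\<bar> \<le> int R) \<and> (\<forall>i\<ge>k. n i = 0)}"

lemma finite_degree_box: "finite (degree_box R)"
  and card_degree_box: "card (degree_box R) \<le> (2 * R + 1) ^ k"
proof -
  let ?r = "\<lambda>n. restrict n {..<k}" and ?P = "{..<k} \<rightarrow>\<^sub>E {- int R..int R}"
  have inj: "inj_on ?r (degree_box R)"
  proof (rule inj_onI, rule ext)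
    fix m n i assume "m \<in> degree_box R" "n \<in> degree_box R" and e: "?r m = ?r n"
    then have "m i = n i" if "i \<ge> k" using that by (simp add: degree_box_def)
    moreover have "m i = n i" if "i < k" using fun_cong[OF e, of i] that by simp
    ultimately show "m i = n i" by (cases "i < k") auto
  qed
  have sub: "?r ` degree_box R \<subseteq> ?P"
  proof (rule image_subsetI, rule PiE_I)
    show "?r n i \<in> {- int R..int R}" if "n \<in> degree_box R" "i \<in> {..<k}" for n i
      using that by (simp add: degree_box_def abs_le_iff minus_le_iff)
  qed simp
  have fin: "finite ?P" by (intro finite_PiE) auto
  show "finite (degree_box R)" by (rule inj_on_finite[OF inj sub fin])
  have "card (degree_box R) \<le> card ?P" by (rule card_inj_on_le[OF inj sub fin])
  also have "\<dots> = (2 * R + 1) ^ k"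
    by (simp add: card_PiE nat_add_distrib nat_mult_distrib)
  finally show "card (degree_box R) \<le> (2 * R + 1) ^ k" .
qed

lemma ddeg_in_degree_box:
  assumes "p \<in> cofinal_pairs \<Lambda>"
  shows "\<exists>R. ddeg \<Lambda> p \<in> degree_box R"
proof -
  define R where "R = (\<Sum>i<k. deg \<Lambda> (fst p) i + deg \<Lambda> (snd p) i)"
  have z: "deg \<Lambda> (fst p) i = 0" "deg \<Lambda> (snd p) i = 0" if "i \<ge> k" for i
    using assms deg_closed that by (auto simp: cofinal_pairs_def Nk_def)
  have "deg \<Lambda> (fst p) i + deg \<Lambda> (snd p) i \<le> R" if "i < k" for i
    unfolding R_def using that member_le_sum[of i "{..<k}" "\<lambda>i. deg \<Lambda> (fst p) i + deg \<Lambda> (snd p) i"] by simp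
  then have "\<bar>ddeg \<Lambda> p i\<bar> \<le> int R" for i
    using z[of i] by (cases "i < k") (force simp: ddeg_def)+
  then have "ddeg \<Lambda> p \<in> degree_box R"
    using z by (simp add: degree_box_def ddeg_def)
  then show ?thesis by blast
qed

abbreviation "box_pairs R \<equiv> {p \<in> cofinal_pairs \<Lambda>. ddeg \<Lambda> p \<in> degree_box R}"

lemma box_mult: "x \<in> mspan (box_pairs R) \<Longrightarrow> y \<in> mspan (box_pairs S) \<Longrightarrow> x * y \<in> mspan (box_pairs (R + S))"
proof (erule mspan_mult, assumption)
  fix p q assume p: "p \<in> box_pairs R" and q: "q \<in> box_pairs S"
  have "ddeg \<Lambda> p + ddeg \<Lambda> q \<in> degree_box (R + S)"
    using p q abs_triangle_ineq[of "ddeg \<Lambda> p i" "ddeg \<Lambda> q i" for i]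
    by (fastforce simp: degree_box_def intro: order_trans[OF abs_triangle_ineq] add_mono)
  then have "{r \<in> cofinal_pairs \<Lambda>. ddeg \<Lambda> r = ddeg \<Lambda> p + ddeg \<Lambda> q} \<subseteq> box_pairs (R + S)" by auto
  from subsetD[OF mspan_mono[OF this] monomial_mult_in_mspan] p q
  show "(T (fst p) * star (T (snd p))) * (T (fst q) * star (T (snd q))) \<in> mspan (box_pairs (R + S))"
    by blast
qed

lemma box_star:
  assumes "x \<in> mspan (box_pairs R)"
  shows "star x \<in> mspan (box_pairs R)"
proof -
  have "prod.swap ` box_pairs R \<subseteq> box_pairs R"
    by (auto simp: cofinal_pairs_def degree_box_def ddeg_def abs_minus_commute)
  from subsetD[OF mspan_mono[OF this] mspan_star[OF assms]] show ?thesis .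
qed

text \<open>Squaring adds the box to itself, so the width doubles: the number of degrees grows like
  a fixed power of \<open>2 ^ j\<close>, whereas norms are raised to the exponent
  \<open>2 ^ Suc j\<close>.\<close>

lemma box_iterated_square: "x \<in> mspan (box_pairs R) \<Longrightarrow> iterated_square x j \<in> mspan (box_pairs (2 ^ Suc j * R))"
proof (induction j)
  case 0
  then show ?case using box_mult[OF box_star, of x R x R] by (simp add: mult_2)
next
  case (Suc j)
  then have "iterated_square x j * iterated_square x j \<in> mspan (box_pairs (2 ^ Suc j * R + 2 ^ Suc j * R))"
    by (intro box_mult)
  moreover have "2 ^ Suc j * R + 2 ^ Suc j * R = 2 ^ Suc (Suc j) * R" by simp
  ultimately show ?case by (simp only: iterated_square.simps)
qed

text \<open>Multiplication by \<open>star (f n)\<close> shifts degree \<open>n\<close> to degree 0,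
  where \<open>degree_zero_bound\<close> applies; the C*-identity produces
  \<open>(norm (f n))^2\<close>, and contractivity of \<phi> lets one factor cancel.\<close>

lemma graded_component_bound:
  assumes f: "\<And>n. n \<in> I \<Longrightarrow> f n \<in> mspan {p \<in> cofinal_pairs \<Lambda>. ddeg \<Lambda> p = n}"
    and I: "finite I" "n \<in> I"
  shows "norm (f n) \<le> norm (\<phi> (\<Sum>m\<in>I. f m))"
proof -
  have prod: "star (f n) * f m \<in> mspan {p \<in> cofinal_pairs \<Lambda>. ddeg \<Lambda> p = m - n}" if "m \<in> I" for m
  proof (rule mspan_mult[OF mspan_star[OF f[OF I(2)]] f[OF that]])
    fix p q assume p: "p \<in> prod.swap ` {p \<in> cofinal_pairs \<Lambda>. ddeg \<Lambda> p = n}" and q: "q \<in> {p \<in> cofinal_pairs \<Lambda>. ddeg \<Lambda> p = m}"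
    have "p \<in> cofinal_pairs \<Lambda>" "ddeg \<Lambda> p = - n"
      using p by (auto simp: cofinal_pairs_def ddeg_def)
    then show "(T (fst p) * star (T (snd p))) * (T (fst q) * star (T (snd q)))
        \<in> mspan {p \<in> cofinal_pairs \<Lambda>. ddeg \<Lambda> p = m - n}"
      using monomial_mult_in_mspan[of p q] q by simp
  qed
  have x: "star (f n) * f n \<in> mspan {p \<in> cofinal_pairs \<Lambda>. ddeg \<Lambda> p = 0}"
    using prod[OF I(2)] by simp
  have y: "(\<Sum>m\<in>I - {n}. star (f n) * f m) \<in> mspan {p \<in> cofinal_pairs \<Lambda>. ddeg \<Lambda> p \<noteq> 0}"
  proof (rule subspace_sum[OF subspace_mspan])
    fix m assume m: "m \<in> I - {n}"
    then have "{p \<in> cofinal_pairs \<Lambda>. ddeg \<Lambda> p = m - n} \<subseteq> {p \<in> cofinal_pairs \<Lambda>. ddeg \<Lambda> p \<noteq> 0}" by auto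
    from subsetD[OF mspan_mono[OF this] prod] m
    show "star (f n) * f m \<in> mspan {p \<in> cofinal_pairs \<Lambda>. ddeg \<Lambda> p \<noteq> 0}" by blast
  qed
  have "(norm (f n))\<^sup>2 = norm (star (f n) * f n)" by (simp only: norm_star_mult_self)
  also have "\<dots> \<le> norm (\<phi> (star (f n) * f n + (\<Sum>m\<in>I - {n}. star (f n) * f m)))"
    by (rule degree_zero_bound[OF x y])
  also have "star (f n) * f n + (\<Sum>m\<in>I - {n}. star (f n) * f m) = star (f n) * (\<Sum>m\<in>I. f m)"
    using sum.remove[OF I, of "\<lambda>m. star (f n) * f m"] by (simp only: sum_distrib_left)
  also have "norm (\<phi> (star (f n) * (\<Sum>m\<in>I. f m))) \<le> norm (\<phi> (star (f n))) * norm (\<phi> (\<Sum>m\<in>I. f m))"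
    unfolding hom_mult by (rule norm_mult_ineq)
  also have "\<dots> \<le> norm (f n) * norm (\<phi> (\<Sum>m\<in>I. f m))"
    using hom_contractive[of "star (f n)"] by (intro mult_right_mono) simp_all
  finally show ?thesis
    by (cases "f n = 0") (simp_all add: power2_eq_square)
qed

lemma graded_bound:
  assumes "x \<in> mspan (box_pairs R)"
  shows "norm x \<le> (2 * real R + 1) ^ k * norm (\<phi> x)"
proof -
  have "box_pairs R = (\<Union>n\<in>degree_box R. {p \<in> cofinal_pairs \<Lambda>. ddeg \<Lambda> p = n})" by auto
  from mspan_UN_decompose[OF assms[unfolded this] finite_degree_box] obtain f where f: "\<And>n. n \<in> degree_box R \<Longrightarrow> f n \<in> mspan {p \<in> cofinal_pairs \<Lambda>. ddeg \<Lambda> p = n}"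
    and x: "x = (\<Sum>n\<in>degree_box R. f n)"
    by blast
  have "norm x \<le> (\<Sum>n\<in>degree_box R. norm (\<phi> x))"
    using sum_norm_le[of "degree_box R" f "\<lambda>_. norm (\<phi> x)"] graded_component_bound[OF f finite_degree_box] unfolding x by blast
  also have "\<dots> = real (card (degree_box R)) * norm (\<phi> x)" by simp
  also have "\<dots> \<le> real ((2 * R + 1) ^ k) * norm (\<phi> x)"
    using card_degree_box[of R] by (intro mult_right_mono of_nat_mono) auto
  finally show ?thesis by (simp add: add.commute)
qed

lemma hom_isometric_on_mspan:
  assumes x: "x \<in> mspan (cofinal_pairs \<Lambda>)"
  shows "norm x \<le> norm (\<phi> x)"
proof -
  obtain E where E: "finite E" "E \<subseteq> cofinal_pairs \<Lambda>" "x \<in> mspan E"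
    using mspan_finite_support[OF x] by blast
  have "\<exists>R. E \<subseteq> box_pairs R"
    using E(1,2)
  proof (induction E)
    case (insert p E)
    then obtain R where R: "E \<subseteq> box_pairs R" by auto
    obtain S where S: "ddeg \<Lambda> p \<in> degree_box S" using ddeg_in_degree_box insert.prems by blast
    have mono: "degree_box R \<subseteq> degree_box (max R S)" "degree_box S \<subseteq> degree_box (max R S)" by (auto simp: degree_box_def le_max_iff_disj of_nat_max)
    then show ?case using R S insert.prems by (intro exI[of _ "max R S"]) blast
  qed simp
  then obtain R where "E \<subseteq> box_pairs R" by blast
  then have xR: "x \<in> mspan (box_pairs R)" using E(3) mspan_mono by blast
  show ?thesis
  proof (rule norm_le_of_iterated_square_bound[OF norm_ge_zero])
    fix j
    have "norm (iterated_square x j) \<le> (2 * real (2 ^ Suc j * R) + 1) ^ k * norm (\<phi> (iterated_square x j))"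
      by (rule graded_bound[OF box_iterated_square[OF xR]])
    \<comment> \<open>Since \<open>1 \<le> 2 ^ j\<close>, the number of degrees is at most
      \<open>(4 R + 1) ^ k * (2 ^ k) ^ j\<close>; this fixes the constant
      \<open>(4 R + 1) ^ k\<close> and the growth rate \<open>2 ^ k\<close>.\<close>
    also have "\<dots> \<le> (2 ^ j * (4 * real R + 1)) ^ k * norm (\<phi> (iterated_square x j))"
    proof (intro mult_right_mono power_mono)
      have "1 \<le> (2::real) ^ j" by simp
      then show "2 * real (2 ^ Suc j * R) + 1 \<le> 2 ^ j * (4 * real R + 1)"
        by (simp add: algebra_simps)
    qed auto
    also have "\<dots> = (4 * real R + 1) ^ k * (2 ^ k) ^ j * norm (\<phi> x) ^ (2 ^ Suc j)"
      unfolding hom_iterated_square norm_iterated_square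
      by (simp add: power_mult_distrib power_mult[symmetric] mult.commute)
    finally show "norm (iterated_square x j) \<le> (4 * real R + 1) ^ k * (2 ^ k) ^ j * norm (\<phi> x) ^ (2 ^ Suc j)" .
  qed
qed

text \<open>Contractivity makes \<phi> continuous, so the lower bound passes from the dense span to
  the whole algebra.\<close>

lemma hom_injective:
  assumes dense: "closure (mspan (cofinal_pairs \<Lambda>)) = UNIV"
  shows "inj \<phi>"
proof -
  have "norm x \<le> norm (\<phi> x)" for x
  proof -
    have "continuous_on UNIV \<phi>"
    proof (rule continuous_onI)
      fix x and e :: real assume "e > 0"
      then show "\<exists>d>0. \<forall>x'\<in>UNIV. dist x' x < d \<longrightarrow> dist (\<phi> x') (\<phi> x) \<le> e"
        using hom_contractive by (intro exI[of _ e]) (auto simp: dist_norm hom_diff[symmetric] intro: order_trans less_imp_le)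
    qed
    then have "closed {x. norm x \<le> norm (\<phi> x)}"
      by (intro closed_Collect_le continuous_intros) auto
    then have "closure (mspan (cofinal_pairs \<Lambda>)) \<subseteq> {x. norm x \<le> norm (\<phi> x)}"
      by (intro closure_minimal) (auto intro: hom_isometric_on_mspan)
    then show ?thesis using dense by auto
  qed
  then have "x = y" if "\<phi> x = \<phi> y" for x y
    using that by (metis diff_self hom_diff norm_le_zero_iff norm_zero right_minus_eq)
  then show ?thesis by (rule injI)
qed

end

section \<open>The deformed bundle of a graph algebra\<close>

lemma a_inv_full_algebra: "\<ominus>\<^bsub>full_algebra\<^esub> x = - (x :: 'a::cstar_algebra)"
proof -
  interpret F: abelian_group "full_algebra :: 'a cstar"
    by (rule abelian_group_full_algebra)
  show ?thesis using F.minus_equality[of "- x" x] by simp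
qed

lemma submodule_full_algebraI:
  fixes M :: "'a::cstar_algebra set"
  assumes "0 \<in> M" "\<And>x y. x \<in> M \<Longrightarrow> y \<in> M \<Longrightarrow> x + y \<in> M" "\<And>z x. x \<in> M \<Longrightarrow> scaleC z x \<in> M"
  shows "submodule M complex_ring full_algebra"
proof -
  interpret F: Module.module complex_ring "full_algebra :: 'a cstar"
    by (rule module_full_algebra)
  show ?thesis
  proof (rule F.submoduleI)
    fix x assume "x \<in> M"
    then show "\<ominus>\<^bsub>full_algebra\<^esub> x \<in> M"
      using assms(3)[of x "-1"] by (simp add: a_inv_full_algebra)
  qed (use assms in simp_all)
qed

lemma submodule_full_algebraD:
  fixes M :: "'a::cstar_algebra set"
  assumes "submodule M complex_ring full_algebra"
  shows "0 \<in> M" "x \<in> M \<Longrightarrow> y \<in> M \<Longrightarrow> x + y \<in> M" "x \<in> M \<Longrightarrow> scaleC z x \<in> M"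
proof -
  interpret F: Module.module complex_ring "full_algebra :: 'a cstar"
    by (rule module_full_algebra)
  show scale: "x \<in> M \<Longrightarrow> scaleC z x \<in> M" for x z
    using F.submoduleE(4)[OF assms, of z x] by (simp add: complex_ring_def)
  show "x \<in> M \<Longrightarrow> y \<in> M \<Longrightarrow> x + y \<in> M"
    using F.submoduleE(5)[OF assms, of x y] by simp
  obtain y where "y \<in> M" using F.submoduleE(2)[OF assms] by blast
  then show "0 \<in> M" using scale[of y 0] by simp
qed

lemma closure_mult:
  fixes V W U :: "'a::real_normed_algebra set"
  assumes "\<And>x y. x \<in> V \<Longrightarrow> y \<in> W \<Longrightarrow> x * y \<in> U" "x \<in> closure V" "y \<in> closure W"
  shows "x * y \<in> closure U"
proof -
  obtain f g where "\<forall>n. f n \<in> V" "f \<longlonglongrightarrow> x" "\<forall>n. g n \<in> W" "g \<longlonglongrightarrow> y"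
    using assms(2,3) unfolding closure_sequential by (elim exE conjE)
  then show ?thesis
    unfolding closure_sequential
    by (intro exI[of _ "\<lambda>n. f n * g n"] conjI allI tendsto_mult) (simp_all add: assms(1))
qed

lemma bounded_linear_image_in_closure:
  assumes "bounded_linear f" "\<And>x. x \<in> V \<Longrightarrow> f x \<in> U" "x \<in> closure V"
  shows "f x \<in> closure U"
  using closure_bounded_linear_image_subset[OF assms(1), of V] closure_mono[of "f ` V" U] assms(2,3) by blast

lemma subspace_closure:
  fixes V :: "'a::real_normed_vector set"
  assumes V: "subspace V"
  shows "subspace (closure V)"
proof (intro subspaceI)
  show "0 \<in> closure V" using subspace_0[OF V] closure_subset by blast
  show "r *\<^sub>R x \<in> closure V" if "x \<in> closure V" for r x
    by (rule bounded_linear_image_in_closure[OF bounded_linear_scaleR_right subspace_scale[OF V] that])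
  fix x y assume "x \<in> closure V" "y \<in> closure V"
  then obtain f g where fg: "\<forall>n. f n \<in> V" "f \<longlonglongrightarrow> x" "\<forall>n. g n \<in> V" "g \<longlonglongrightarrow> y"
    unfolding closure_sequential by (elim exE conjE)
  then show "x + y \<in> closure V"
    unfolding closure_sequential
    by (intro exI[of _ "\<lambda>n. f n + g n"] conjI allI tendsto_add) (simp_all add: subspace_add[OF V])
qed

text \<open>This is the group identity behind the grading by \<open>G\<close>: in a product of two
  monomials, \<open>a, b, c, d\<close> are the values of \<eta> on the four paths and
  \<open>u, w\<close> those on the two tails of a common extension.\<close>

lemma (in group) quotient_of_equal_products:
  assumes "a \<in> carrier G" "b \<in> carrier G" "c \<in> carrier G" "d \<in> carrier G" "u \<in> carrier G" "w \<in> carrier G"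
    and e: "b \<otimes> u = c \<otimes> w"
  shows "(a \<otimes> u) \<otimes> inv (d \<otimes> w) = (a \<otimes> inv b) \<otimes> (c \<otimes> inv d)"
proof -
  have "u = inv b \<otimes> (c \<otimes> w)" using inv_solve_left[of u b "c \<otimes> w"] assms by simp
  moreover have "w \<otimes> (inv w \<otimes> inv d) = inv d" using assms by (simp add: m_assoc[symmetric])
  ultimately show ?thesis using assms(1-4,6) by (simp add: inv_mult_group m_assoc)
qed

context ck_family begin

text \<open>The complex submodule hull agrees with a real span because \<open>monomials\<close>
  already contains all complex multiples.\<close>

lemma closed_span_monomials:
  "closed_span full_algebra {T \<kappa> * star (T \<mu>) | \<kappa> \<mu>. (\<kappa>, \<mu>) \<in> E} = closure (mspan E)" (is "closed_span _ ?X = _")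
proof -
  have "(\<lambda>H. submodule H complex_ring full_algebra) hull ?X = mspan E"
  proof (rule hull_unique)
    show "?X \<subseteq> mspan E"
      using monomial_in_mspan[of "(\<kappa>, \<mu>)" E 1 for \<kappa> \<mu>] by auto
    show "submodule (mspan E) complex_ring full_algebra"
      by (intro submodule_full_algebraI mspan_scaleC subspace_0[OF subspace_mspan] subspace_add[OF subspace_mspan])
    fix H assume H: "?X \<subseteq> H" "submodule H complex_ring full_algebra"
    note D = submodule_full_algebraD[OF H(2)]
    have "x \<in> H" if "x \<in> mspan E" for x
      using that
    proof (induction rule: mspan_induct)
      case (monomial z p)
      then have "T (fst p) * star (T (snd p)) \<in> ?X" by (intro CollectI exI[of _ "fst p"] exI[of _ "snd p"]) simp
      then show ?case using H(1) D(3) by blast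
    next
      case (scale r x)
      then show ?case using D(3)[of x "complex_of_real r"] by (simp only: scaleC_of_real)
    qed (use D in auto)
    then show "mspan E \<subseteq> H" by blast
  qed
  then show ?thesis by (simp add: closed_span_def)
qed

lemma mspan_Int_cofinal:
  assumes "E \<subseteq> paths \<Lambda> \<times> paths \<Lambda>"
  shows "mspan (E \<inter> cofinal_pairs \<Lambda>) = mspan E"
proof
  show "mspan E \<subseteq> mspan (E \<inter> cofinal_pairs \<Lambda>)"
  proof
    fix x assume "x \<in> mspan E"
    then show "x \<in> mspan (E \<inter> cofinal_pairs \<Lambda>)"
    proof (induction rule: mspan_induct)
      case (monomial z p)
      then have P: "fst p \<in> paths \<Lambda>" "snd p \<in> paths \<Lambda>" using assms by auto
      show ?case
      proof (cases "src \<Lambda> (fst p) = src \<Lambda> (snd p)")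
        case True
        then show ?thesis using P monomial by (intro monomial_in_mspan) (simp add: cofinal_pairs_def)
      next
        case False
        then show ?thesis by (simp add: T_mult_star_eq_0[OF P] subspace_0[OF subspace_mspan])
      qed
    qed (simp_all add: subspace_mspan subspace_0 subspace_add subspace_scale)
  qed
qed (rule mspan_mono, blast)

end

section \<open>Representations of the deformed bundle\<close>

locale deformed_representation = ck_family k \<Lambda> "\<lambda>_ _. 1" s + group G
  for k and \<Lambda> :: "'l kgraph" and s :: "'l \<Rightarrow> 'c::cstar_algebra" and G :: "'g monoid" +
  fixes \<eta> :: "'l \<Rightarrow> 'g" and \<sigma> :: "'g \<Rightarrow> 'g \<Rightarrow> complex" and \<pi> :: "'g \<times> 'c \<Rightarrow> 'd::cstar_algebra"
  assumes \<eta>_functor: "functor_to_group \<Lambda> G \<eta>" and cocycle: "circle_cocycle G \<sigma>"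
    and rep: "fell_representation G (deformed_bundle G \<sigma> (graph_bundle \<Lambda> G \<eta> full_algebra s)) full_algebra \<pi>"
begin

abbreviation "B \<equiv> graph_fibre \<Lambda> G \<eta> full_algebra s"

abbreviation "D \<equiv> deformed_bundle G \<sigma> (graph_bundle \<Lambda> G \<eta> full_algebra s)"

definition gdeg :: "'l \<times> 'l \<Rightarrow> 'g" where
  "gdeg p = \<eta> (fst p) \<otimes>\<^bsub>G\<^esub> inv\<^bsub>G\<^esub> \<eta> (snd p)"

abbreviation "fibre_pairs g \<equiv> {p \<in> cofinal_pairs \<Lambda>. gdeg p = g}"

lemma \<eta>_closed: "\<kappa> \<in> paths \<Lambda> \<Longrightarrow> \<eta> \<kappa> \<in> carrier G"
  and \<eta>_cmp: "\<kappa> \<in> paths \<Lambda> \<Longrightarrow> \<mu> \<in> paths \<Lambda> \<Longrightarrow> src \<Lambda> \<kappa> = rng \<Lambda> \<mu> \<Longrightarrow> \<eta> (cmp \<Lambda> \<kappa> \<mu>) = \<eta> \<kappa> \<otimes>\<^bsub>G\<^esub> \<eta> \<mu>"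
  and \<eta>_vertex: "v \<in> vertices \<Lambda> \<Longrightarrow> \<eta> v = \<one>\<^bsub>G\<^esub>"
  using \<eta>_functor by (auto simp: functor_to_group_def)

lemma cmod_\<sigma>: "g \<in> carrier G \<Longrightarrow> h \<in> carrier G \<Longrightarrow> cmod (\<sigma> g h) = 1"
  and \<sigma>_one: "g \<in> carrier G \<Longrightarrow> \<sigma> \<one>\<^bsub>G\<^esub> g = 1" "g \<in> carrier G \<Longrightarrow> \<sigma> g \<one>\<^bsub>G\<^esub> = 1"
  using cocycle by (auto simp: circle_cocycle_def)

text \<open>The cocycle identity at \<open>g\<close>, the inverse of \<open>g\<close>, and
  \<open>g\<close> again. It cancels the scalars of the deformed product and involution in
  \<open>star (\<pi> b) * \<pi> b\<close>.\<close>

lemma \<sigma>_inv: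
  assumes g: "g \<in> carrier G"
  shows "\<sigma> (inv\<^bsub>G\<^esub> g) g = \<sigma> g (inv\<^bsub>G\<^esub> g)"
proof -
  have "\<sigma> g (inv\<^bsub>G\<^esub> g) * \<sigma> (g \<otimes>\<^bsub>G\<^esub> inv\<^bsub>G\<^esub> g) g = \<sigma> g (inv\<^bsub>G\<^esub> g \<otimes>\<^bsub>G\<^esub> g) * \<sigma> (inv\<^bsub>G\<^esub> g) g"
    using cocycle g unfolding circle_cocycle_def by blast
  then show ?thesis using g by (simp add: \<sigma>_one)
qed

lemma \<sigma>_unit:
  assumes "g \<in> carrier G" "h \<in> carrier G"
  shows "\<sigma> g h * cnj (\<sigma> g h) = 1" "cnj (\<sigma> g h) * \<sigma> g h = 1"
  using cmod_\<sigma>[OF assms] complex_norm_square[of "\<sigma> g h"] by (simp_all add: mult.commute)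

lemma gdeg_swap: "p \<in> cofinal_pairs \<Lambda> \<Longrightarrow> gdeg (prod.swap p) = inv\<^bsub>G\<^esub> gdeg p"
  by (simp add: gdeg_def cofinal_pairs_def \<eta>_closed inv_mult_group)

lemma fibre_eq: "B g = closure (mspan (fibre_pairs g))"
proof -
  let ?E = "{p \<in> paths \<Lambda> \<times> paths \<Lambda>. gdeg p = g}"
  have "{s \<kappa> * star (s \<mu>) | \<kappa> \<mu>. \<kappa> \<in> paths \<Lambda> \<and> \<mu> \<in> paths \<Lambda> \<and> \<eta> \<kappa> \<otimes>\<^bsub>G\<^esub> inv\<^bsub>G\<^esub> \<eta> \<mu> = g}
      = {s \<kappa> * star (s \<mu>) | \<kappa> \<mu>. (\<kappa>, \<mu>) \<in> ?E}"
    by (simp add: gdeg_def conj_assoc)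
  then have "B g = closure (mspan ?E)"
    unfolding graph_fibre_def full_algebra_simps by (simp only: closed_span_monomials)
  also have "mspan ?E = mspan (?E \<inter> cofinal_pairs \<Lambda>)"
    by (rule mspan_Int_cofinal[symmetric]) blast
  also have "?E \<inter> cofinal_pairs \<Lambda> = fibre_pairs g"
    by (auto simp: cofinal_pairs_def)
  finally show ?thesis .
qed

lemma mspan_subset_fibre: "mspan (fibre_pairs g) \<subseteq> B g"
  unfolding fibre_eq by (rule closure_subset)

lemma closed_fibre: "closed (B g)"
  unfolding fibre_eq by simp

lemma subspace_fibre: "subspace (B g)"
  unfolding fibre_eq by (rule subspace_closure[OF subspace_mspan])

lemma fibre_scaleC: "x \<in> B g \<Longrightarrow> scaleC z x \<in> B g"
  unfolding fibre_eq
  by (rule bounded_linear_image_in_closure[OF bounded_linear_scaleC]) (rule mspan_scaleC)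

lemma fibre_star:
  assumes "x \<in> B g"
  shows "star x \<in> B (inv\<^bsub>G\<^esub> g)"
  using assms unfolding fibre_eq
proof (rule bounded_linear_image_in_closure[OF bounded_linear_star, rotated])
  have sub: "prod.swap ` fibre_pairs g \<subseteq> fibre_pairs (inv\<^bsub>G\<^esub> g)"
  proof (rule image_subsetI)
    fix p assume "p \<in> fibre_pairs g"
    then show "prod.swap p \<in> fibre_pairs (inv\<^bsub>G\<^esub> g)"
      using gdeg_swap[of p] by (simp add: cofinal_pairs_def)
  qed
  show "star x \<in> mspan (fibre_pairs (inv\<^bsub>G\<^esub> g))" if "x \<in> mspan (fibre_pairs g)" for x
    by (rule subsetD[OF mspan_mono[OF sub] mspan_star[OF that]])
qed

lemma monomial_mult_gdeg:
  assumes p: "p \<in> cofinal_pairs \<Lambda>" and q: "q \<in> cofinal_pairs \<Lambda>"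
  shows "(s (fst p) * star (s (snd p))) * (s (fst q) * star (s (snd q))) \<in> mspan (fibre_pairs (gdeg p \<otimes>\<^bsub>G\<^esub> gdeg q))"
proof (rule subsetD[OF mspan_mono monomial_mult[OF p q]], clarify, intro conjI)
  have P: "fst p \<in> paths \<Lambda>" "snd p \<in> paths \<Lambda>" "src \<Lambda> (fst p) = src \<Lambda> (snd p)"
    "fst q \<in> paths \<Lambda>" "snd q \<in> paths \<Lambda>" "src \<Lambda> (fst q) = src \<Lambda> (snd q)"
    using p q by (simp_all add: cofinal_pairs_def)
  fix \<alpha> \<beta> assume R: "\<alpha> \<in> paths \<Lambda>" "\<beta> \<in> paths \<Lambda>" "src \<Lambda> \<alpha> = src \<Lambda> \<beta>" "rng \<Lambda> \<alpha> = src \<Lambda> (snd p)"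
    "rng \<Lambda> \<beta> = src \<Lambda> (fst q)" and e: "cmp \<Lambda> (snd p) \<alpha> = cmp \<Lambda> (fst q) \<beta>"
  have S: "src \<Lambda> (fst p) = rng \<Lambda> \<alpha>" "src \<Lambda> (snd q) = rng \<Lambda> \<beta>" "src \<Lambda> (snd p) = rng \<Lambda> \<alpha>" "src \<Lambda> (fst q) = rng \<Lambda> \<beta>"
    by (simp_all only: R P)
  show "(cmp \<Lambda> (fst p) \<alpha>, cmp \<Lambda> (snd q) \<beta>) \<in> cofinal_pairs \<Lambda>"
    using cmp_closed[OF P(1) R(1) S(1)] cmp_closed[OF P(5) R(2) S(2)] R(3)
    by (simp add: cofinal_pairs_def src_cmp[OF P(1) R(1) S(1)] src_cmp[OF P(5) R(2) S(2)])
  have "\<eta> (snd p) \<otimes>\<^bsub>G\<^esub> \<eta> \<alpha> = \<eta> (fst q) \<otimes>\<^bsub>G\<^esub> \<eta> \<beta>"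
    using arg_cong[OF e, of \<eta>] by (simp only: \<eta>_cmp[OF P(2) R(1) S(3)] \<eta>_cmp[OF P(4) R(2) S(4)])
  then show "gdeg (cmp \<Lambda> (fst p) \<alpha>, cmp \<Lambda> (snd q) \<beta>) = gdeg p \<otimes>\<^bsub>G\<^esub> gdeg q"
    unfolding gdeg_def fst_conv snd_conv \<eta>_cmp[OF P(1) R(1) S(1)] \<eta>_cmp[OF P(5) R(2) S(2)]
    by (intro quotient_of_equal_products \<eta>_closed P R)
qed

lemma fibre_mult: "x \<in> B g \<Longrightarrow> y \<in> B h \<Longrightarrow> x * y \<in> B (g \<otimes>\<^bsub>G\<^esub> h)"
  unfolding fibre_eq
proof (erule closure_mult[rotated], assumption, erule mspan_mult, assumption)
  fix p q assume "p \<in> fibre_pairs g" "q \<in> fibre_pairs h"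
  then show "(s (fst p) * star (s (snd p))) * (s (fst q) * star (s (snd q))) \<in> mspan (fibre_pairs (g \<otimes>\<^bsub>G\<^esub> h))"
    using monomial_mult_gdeg[of p q] by simp
qed

lemma D_simps:
  "total D = Sigma (carrier G) B"
  "fadd D b c = (fst b, snd b + snd c)"
  "fsmult D z b = (fst b, scaleC z (snd b))"
  "fmult D b c = (fst b \<otimes>\<^bsub>G\<^esub> fst c, scaleC (\<sigma> (fst b) (fst c)) (snd b * snd c))"
  "fstar D b = (inv\<^bsub>G\<^esub> fst b, scaleC (cnj (\<sigma> (fst b) (inv\<^bsub>G\<^esub> fst b))) (star (snd b)))"
  "g \<in> carrier G \<Longrightarrow> b \<in> fibre D g \<longleftrightarrow> fst b = g \<and> snd b \<in> B g"
  by (cases b; force simp: deformed_bundle_def graph_bundle_def fibre_def)+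

lemma rep_add: "g \<in> carrier G \<Longrightarrow> x \<in> B g \<Longrightarrow> y \<in> B g \<Longrightarrow> \<pi> (g, x + y) = \<pi> (g, x) + \<pi> (g, y)"
proof -
  assume g: "g \<in> carrier G" and xy: "x \<in> B g" "y \<in> B g"
  have "\<forall>b\<in>fibre D g. \<forall>c\<in>fibre D g. \<pi> (fadd D b c) = \<pi> b + \<pi> c"
    using rep g by (simp add: fell_representation_def)
  then have "\<pi> (fadd D (g, x) (g, y)) = \<pi> (g, x) + \<pi> (g, y)"
    using g xy by (simp add: D_simps(6))
  then show ?thesis by (simp add: D_simps(2))
qed

lemma rep_scaleC: "g \<in> carrier G \<Longrightarrow> x \<in> B g \<Longrightarrow> \<pi> (g, scaleC z x) = scaleC z (\<pi> (g, x))"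
proof -
  assume g: "g \<in> carrier G" and x: "x \<in> B g"
  have "\<forall>b\<in>total D. \<forall>z. \<pi> (fsmult D z b) = scaleC z (\<pi> b)"
    using rep by (simp add: fell_representation_def)
  then have "\<pi> (fsmult D z (g, x)) = scaleC z (\<pi> (g, x))"
    using g x by (simp add: D_simps(1))
  then show ?thesis by (simp add: D_simps(3))
qed

lemma rep_mult:
  assumes g: "g \<in> carrier G" "x \<in> B g" and h: "h \<in> carrier G" "y \<in> B h"
  shows "\<pi> (g, x) * \<pi> (h, y) = scaleC (\<sigma> g h) (\<pi> (g \<otimes>\<^bsub>G\<^esub> h, x * y))"
proof -
  have "\<forall>b\<in>total D. \<forall>c\<in>total D. \<pi> (fmult D b c) = \<pi> b * \<pi> c"
    using rep by (simp add: fell_representation_def)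
  then have "\<pi> (fmult D (g, x) (h, y)) = \<pi> (g, x) * \<pi> (h, y)"
    using g h by (simp add: D_simps(1))
  then show ?thesis
    using rep_scaleC[OF m_closed[OF g(1) h(1)] fibre_mult[OF g(2) h(2)]] by (simp add: D_simps(4))
qed

lemma rep_star:
  assumes g: "g \<in> carrier G" "x \<in> B g"
  shows "star (\<pi> (g, x)) = scaleC (cnj (\<sigma> g (inv\<^bsub>G\<^esub> g))) (\<pi> (inv\<^bsub>G\<^esub> g, star x))"
proof -
  have "\<forall>b\<in>total D. \<pi> (fstar D b) = star (\<pi> b)"
    using rep by (simp add: fell_representation_def)
  then have "\<pi> (fstar D (g, x)) = star (\<pi> (g, x))"
    using g by (simp add: D_simps(1))
  then show ?thesis
    using rep_scaleC[OF inv_closed[OF g(1)] fibre_star[OF g(2)]] by (simp add: D_simps(5))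
qed

lemma rep_zero: "g \<in> carrier G \<Longrightarrow> \<pi> (g, 0) = 0"
  using rep_scaleC[of g 0 0] subspace_0[OF subspace_fibre] by simp

lemma rep_scaleR: "g \<in> carrier G \<Longrightarrow> x \<in> B g \<Longrightarrow> \<pi> (g, r *\<^sub>R x) = r *\<^sub>R \<pi> (g, x)"
  using rep_scaleC[of g x "complex_of_real r"] by (simp only: scaleC_of_real)

lemma rep_sum: "g \<in> carrier G \<Longrightarrow> (\<And>i. i \<in> I \<Longrightarrow> f i \<in> B g) \<Longrightarrow> \<pi> (g, \<Sum>i\<in>I. f i) = (\<Sum>i\<in>I. \<pi> (g, f i))"
  by (induction I rule: infinite_finite_induct)
     (simp_all add: rep_zero rep_add subspace_sum[OF subspace_fibre])

text \<open>On the unit fibre \<sigma> is 1, so \<pi> restricts to a star-homomorphism on a closed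
  star-subalgebra.\<close>

lemma norm_rep_unit: "x \<in> B \<one>\<^bsub>G\<^esub> \<Longrightarrow> norm (\<pi> (\<one>\<^bsub>G\<^esub>, x)) \<le> norm x"
proof (rule star_homomorphism_contractive[of "B \<one>\<^bsub>G\<^esub>"])
  show "star_subalgebra (B \<one>\<^bsub>G\<^esub>)"
    using fibre_mult[of _ "\<one>\<^bsub>G\<^esub>" _ "\<one>\<^bsub>G\<^esub>"] fibre_star[of _ "\<one>\<^bsub>G\<^esub>"]
    by (simp add: star_subalgebra_def subspace_fibre)
  show "closed (B \<one>\<^bsub>G\<^esub>)" by (rule closed_fibre)
  fix x assume x: "x \<in> B \<one>\<^bsub>G\<^esub>"
  show "\<pi> (\<one>\<^bsub>G\<^esub>, star x) = star (\<pi> (\<one>\<^bsub>G\<^esub>, x))"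
    using rep_star[OF one_closed x] by (simp add: \<sigma>_one)
  show "\<pi> (\<one>\<^bsub>G\<^esub>, r *\<^sub>R x) = r *\<^sub>R \<pi> (\<one>\<^bsub>G\<^esub>, x)" for r
    by (rule rep_scaleR[OF one_closed x])
  fix y assume y: "y \<in> B \<one>\<^bsub>G\<^esub>"
  show "\<pi> (\<one>\<^bsub>G\<^esub>, x + y) = \<pi> (\<one>\<^bsub>G\<^esub>, x) + \<pi> (\<one>\<^bsub>G\<^esub>, y)"
    by (rule rep_add[OF one_closed x y])
  show "\<pi> (\<one>\<^bsub>G\<^esub>, x * y) = \<pi> (\<one>\<^bsub>G\<^esub>, x) * \<pi> (\<one>\<^bsub>G\<^esub>, y)"
    using rep_mult[OF one_closed x one_closed y] by (simp add: \<sigma>_one)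
qed

lemma rep_star_mult:
  assumes g: "g \<in> carrier G" "x \<in> B g"
  shows "star (\<pi> (g, x)) * \<pi> (g, x) = \<pi> (\<one>\<^bsub>G\<^esub>, star x * x)"
    "\<pi> (g, x) * star (\<pi> (g, x)) = \<pi> (\<one>\<^bsub>G\<^esub>, x * star x)"
  unfolding rep_star[OF g] mult_scaleC_left mult_scaleC_right
    rep_mult[OF inv_closed[OF g(1)] fibre_star[OF g(2)] g] rep_mult[OF g inv_closed[OF g(1)] fibre_star[OF g(2)]]
    scaleC_scaleC \<sigma>_inv[OF g(1)] \<sigma>_unit[OF g(1) inv_closed[OF g(1)]]
  using g by simp_all

text \<open>The C*-identity reduces any fibre to the unit fibre, where the scalars of the twist have
  cancelled.\<close>

lemma norm_rep:
  assumes g: "g \<in> carrier G" "x \<in> B g"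
  shows "norm (\<pi> (g, x)) \<le> norm x"
proof -
  have "star x * x \<in> B \<one>\<^bsub>G\<^esub>"
    using fibre_mult[OF fibre_star[OF g(2)] g(2)] g(1) by simp
  then have "(norm (\<pi> (g, x)))\<^sup>2 \<le> (norm x)\<^sup>2"
    unfolding norm_star_mult_self[symmetric] rep_star_mult(1)[OF g] by (rule norm_rep_unit)
  then show ?thesis by simp
qed

section \<open>The twisted family inside C*(B(\<sigma>)) and density of its monomials\<close>

definition t :: "'l \<Rightarrow> 'd" where
  "t \<kappa> = \<pi> (\<eta> \<kappa>, s \<kappa>)"

text \<open>\<open>s \<kappa>\<close> is itself a monomial: the second path is the vertex
  \<open>src \<Lambda> \<kappa>\<close>, on which \<eta> is trivial.\<close>

lemma generator_in_fibre:
  assumes \<kappa>: "\<kappa> \<in> paths \<Lambda>"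
  shows "s \<kappa> \<in> B (\<eta> \<kappa>)"
proof -
  have v: "src \<Lambda> \<kappa> \<in> vertices \<Lambda>" by (rule src_vertex[OF \<kappa>])
  have "(\<kappa>, src \<Lambda> \<kappa>) \<in> fibre_pairs (\<eta> \<kappa>)"
    using \<kappa> vertex_path[OF v] by (simp add: cofinal_pairs_def gdeg_def \<eta>_vertex[OF v] src_src \<eta>_closed)
  from subsetD[OF mspan_subset_fibre monomial_in_mspan[OF this, of 1]]
  show ?thesis by (simp add: T_vertex(2)[OF v] T_src[OF \<kappa>])
qed

text \<open>The products in (CK1), (CK3) and (CK4) land in the unit fibre, where the scalars cancel;
  only (CK2) retains one.\<close>

lemma t_relations: "ck_relations k \<Lambda> (\<lambda>\<kappa> \<mu>. \<sigma> (\<eta> \<kappa>) (\<eta> \<mu>)) full_algebra t"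
proof -
  have vB: "s v \<in> B \<one>\<^bsub>G\<^esub>" and tv: "t v = \<pi> (\<one>\<^bsub>G\<^esub>, s v)" if "v \<in> vertices \<Lambda>" for v
    using generator_in_fibre[OF vertex_path[OF that]] by (simp_all add: t_def \<eta>_vertex[OF that])
  have prod: "t v * t w = \<pi> (\<one>\<^bsub>G\<^esub>, s v * s w)" if "v \<in> vertices \<Lambda>" "w \<in> vertices \<Lambda>" for v w
    using rep_mult[OF one_closed vB[OF that(1)] one_closed vB[OF that(2)]] by (simp add: tv that \<sigma>_one)
  have 1: "t v * t v = t v" "star (t v) = t v" if "v \<in> vertices \<Lambda>" for v
    using prod[OF that that] rep_star[OF one_closed vB[OF that]] T_vertex[OF that]
    by (simp_all add: tv[OF that] \<sigma>_one)
  have 2: "t v * t w = 0" if "v \<in> vertices \<Lambda>" "w \<in> vertices \<Lambda>" "v \<noteq> w" for v w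
    using prod[OF that(1,2)] T_vertex_orthogonal[OF that] by (simp add: rep_zero)
  have 3: "t \<kappa> * t \<mu> = scaleC (\<sigma> (\<eta> \<kappa>) (\<eta> \<mu>)) (t (cmp \<Lambda> \<kappa> \<mu>))"
    if "\<kappa> \<in> paths \<Lambda>" "\<mu> \<in> paths \<Lambda>" "src \<Lambda> \<kappa> = rng \<Lambda> \<mu>" for \<kappa> \<mu>
    using rep_mult[OF \<eta>_closed[OF that(1)] generator_in_fibre[OF that(1)] \<eta>_closed[OF that(2)] generator_in_fibre[OF that(2)]]
    by (simp add: t_def \<eta>_cmp[OF that] T_mult[OF that])
  have 4: "star (t \<kappa>) * t \<kappa> = t (src \<Lambda> \<kappa>)" if "\<kappa> \<in> paths \<Lambda>" for \<kappa>
    using rep_star_mult(1)[OF \<eta>_closed[OF that] generator_in_fibre[OF that]]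
    by (simp add: t_def T_star_mult_self[OF that] \<eta>_vertex[OF src_vertex[OF that]])
  have 5: "t v = finsum full_algebra (\<lambda>\<kappa>. t \<kappa> * star (t \<kappa>)) (paths_into \<Lambda> v \<inter> paths_of_degree \<Lambda> n)"
    if v: "v \<in> vertices \<Lambda>" and n: "n \<in> Nk k" for v n
  proof -
    let ?X = "paths_into \<Lambda> v \<inter> paths_of_degree \<Lambda> n"
    have X: "\<kappa> \<in> paths \<Lambda>" if "\<kappa> \<in> ?X" for \<kappa> using that by (simp add: paths_into_def)
    have mem: "s \<kappa> * star (s \<kappa>) \<in> B \<one>\<^bsub>G\<^esub>" if "\<kappa> \<in> ?X" for \<kappa>
      using fibre_mult[OF generator_in_fibre[OF X[OF that]] fibre_star[OF generator_in_fibre[OF X[OF that]]]]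
        \<eta>_closed[OF X[OF that]] by simp
    have "t v = \<pi> (\<one>\<^bsub>G\<^esub>, \<Sum>\<kappa>\<in>?X. s \<kappa> * star (s \<kappa>))"
      using tv[OF v] T_vertex_sum[OF v n] by simp
    also have "\<dots> = (\<Sum>\<kappa>\<in>?X. \<pi> (\<one>\<^bsub>G\<^esub>, s \<kappa> * star (s \<kappa>)))"
      by (rule rep_sum[OF one_closed mem])
    also have "\<dots> = (\<Sum>\<kappa>\<in>?X. t \<kappa> * star (t \<kappa>))"
    proof (rule sum.cong[OF refl])
      fix \<kappa> assume "\<kappa> \<in> ?X"
      then have \<kappa>: "\<kappa> \<in> paths \<Lambda>" by (rule X)
      show "\<pi> (\<one>\<^bsub>G\<^esub>, s \<kappa> * star (s \<kappa>)) = t \<kappa> * star (t \<kappa>)"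
        unfolding t_def by (rule rep_star_mult(2)[OF \<eta>_closed[OF \<kappa>] generator_in_fibre[OF \<kappa>], symmetric])
    qed
    finally show ?thesis by (simp only: finsum_full_algebra[OF finite_paths[OF v n]])
  qed
  show ?thesis
    unfolding ck_relations_def full_algebra_simps
    by (intro conjI ballI impI Pi_I UNIV_I 1 2 3 4 5; assumption)
qed

sublocale t: ck_family k \<Lambda> "\<lambda>\<kappa> \<mu>. \<sigma> (\<eta> \<kappa>) (\<eta> \<mu>)" t
proof unfold_locales
  show "cmod (\<sigma> (\<eta> \<kappa>) (\<eta> \<mu>)) = 1" if "\<kappa> \<in> paths \<Lambda>" "\<mu> \<in> paths \<Lambda>" for \<kappa> \<mu>
    using that by (intro cmod_\<sigma> \<eta>_closed)
  show "\<sigma> (\<eta> (rng \<Lambda> \<kappa>)) (\<eta> \<kappa>) = 1" "\<sigma> (\<eta> \<kappa>) (\<eta> (src \<Lambda> \<kappa>)) = 1" if "\<kappa> \<in> paths \<Lambda>" for \<kappa>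
    using that by (simp_all add: \<eta>_vertex rng_vertex src_vertex \<sigma>_one \<eta>_closed)
qed (rule row_finite, rule t_relations)

text \<open>On monomials \<pi> turns \<open>s \<kappa> * star (s \<mu>)\<close> into
  \<open>t \<kappa> * star (t \<mu>)\<close> up to a scalar of modulus one, made of \<open>a\<close>
  from the deformed involution and \<open>b\<close> from the deformed product.\<close>

lemma rep_mspan:
  assumes g: "g \<in> carrier G" and "x \<in> mspan (fibre_pairs g)"
  shows "\<pi> (g, x) \<in> t.mspan (cofinal_pairs \<Lambda>)"
proof -
  \<comment> \<open>Membership in the fibre is carried through the induction because additivity of
    \<pi> is available only within a fibre.\<close>
  have "x \<in> B g \<and> \<pi> (g, x) \<in> t.mspan (cofinal_pairs \<Lambda>)"
    using assms(2)
  proof (induction rule: mspan_induct)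
    case (monomial z p)
    then have P: "fst p \<in> paths \<Lambda>" "snd p \<in> paths \<Lambda>" and p: "p \<in> cofinal_pairs \<Lambda>"
      and g: "g = \<eta> (fst p) \<otimes>\<^bsub>G\<^esub> inv\<^bsub>G\<^esub> \<eta> (snd p)"
      by (auto simp: cofinal_pairs_def gdeg_def)
    note e = \<eta>_closed[OF P(1)] \<eta>_closed[OF P(2)]
    note G = generator_in_fibre[OF P(1)] generator_in_fibre[OF P(2)]
    define a where "a = cnj (\<sigma> (\<eta> (snd p)) (inv\<^bsub>G\<^esub> \<eta> (snd p)))"
    define b where "b = \<sigma> (\<eta> (fst p)) (inv\<^bsub>G\<^esub> \<eta> (snd p))"
    have "cmod (b * a) = 1"
      by (simp add: a_def b_def norm_mult cmod_\<sigma> e)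
    moreover have "cnj (b * a) * (b * a) = complex_of_real ((cmod (b * a))\<^sup>2)"
      by (simp only: complex_norm_square mult.commute)
    ultimately have ab: "cnj (b * a) * (b * a) = 1" by (simp only:) simp
    have m: "s (fst p) * star (s (snd p)) \<in> B g"
      unfolding g by (rule fibre_mult[OF G(1) fibre_star[OF G(2)]])
    have "t (fst p) * star (t (snd p)) = scaleC (b * a) (\<pi> (g, s (fst p) * star (s (snd p))))"
      unfolding t_def rep_star[OF e(2) G(2)] mult_scaleC_right
        rep_mult[OF e(1) G(1) inv_closed[OF e(2)] fibre_star[OF G(2)]] scaleC_scaleC g
      by (simp add: a_def b_def mult.commute)
    then have "\<pi> (g, s (fst p) * star (s (snd p))) = scaleC (cnj (b * a)) (t (fst p) * star (t (snd p)))"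
      by (simp only: scaleC_scaleC ab scaleC_one)
    then have "\<pi> (g, scaleC z (s (fst p) * star (s (snd p)))) = scaleC (z * cnj (b * a)) (t (fst p) * star (t (snd p)))"
      by (simp only: rep_scaleC[OF assms(1) m] scaleC_scaleC)
    then show ?case
      using t.monomial_in_mspan[OF p] fibre_scaleC[OF m] by simp
  next
    case (scale r x)
    then show ?case
      using rep_scaleR[OF g] subspace_scale[OF subspace_fibre] subspace_scale[OF t.subspace_mspan] by simp
  next
    case (add x y)
    then show ?case
      using rep_add[OF g] subspace_add[OF subspace_fibre] subspace_add[OF t.subspace_mspan] by simp
  qed (simp_all add: rep_zero[OF g] subspace_0 subspace_fibre t.subspace_mspan)
  then show ?thesis by blast
qed

text \<open>Contractivity makes \<pi> continuous on each fibre, so its values on the closure are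
  limits of values on the span.\<close>

lemma rep_in_closure:
  assumes g: "g \<in> carrier G" and x: "x \<in> B g"
  shows "\<pi> (g, x) \<in> closure (t.mspan (cofinal_pairs \<Lambda>))"
proof -
  obtain f where "\<forall>n. f n \<in> mspan (fibre_pairs g)" and f_lim: "f \<longlonglongrightarrow> x"
    using x unfolding fibre_eq closure_sequential by (elim exE conjE)
  then have f: "f n \<in> mspan (fibre_pairs g)" for n by blast
  have fB: "f n \<in> B g" for n by (rule subsetD[OF mspan_subset_fibre f])
  have "norm (\<pi> (g, f n) - \<pi> (g, x)) \<le> norm (f n - x)" for n
  proof -
    have "- x \<in> B g" "f n - x \<in> B g"
      by (rule subspace_neg[OF subspace_fibre x], rule subspace_diff[OF subspace_fibre fB x])
    then have "\<pi> (g, f n - x) = \<pi> (g, f n) - \<pi> (g, x)"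
      using rep_add[OF g fB \<open>- x \<in> B g\<close>] rep_scaleR[OF g x, of "-1"] by simp
    then show ?thesis using norm_rep[OF g \<open>f n - x \<in> B g\<close>] by simp
  qed
  then have "(\<lambda>n. \<pi> (g, f n) - \<pi> (g, x)) \<longlonglongrightarrow> 0"
    by (intro Lim_null_comparison[OF _ tendsto_norm_zero[OF LIM_zero[OF f_lim]]]) simp
  then have "(\<lambda>n. \<pi> (g, f n)) \<longlonglongrightarrow> \<pi> (g, x)"
    by (rule LIM_zero_cancel)
  moreover have "\<pi> (g, f n) \<in> t.mspan (cofinal_pairs \<Lambda>)" for n
    by (rule rep_mspan[OF g f])
  ultimately show ?thesis unfolding closure_sequential by (intro exI conjI allI)
qed

text \<open>The closed span is a C*-subalgebra containing the image of the bundle; here the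
  generation of C*(B(\<sigma>)) by \<pi> enters.\<close>

lemma dense_monomials:
  assumes gen: "cstar_generates full_algebra (\<pi> ` total D)"
  shows "closure (t.mspan (cofinal_pairs \<Lambda>)) = UNIV"
proof -
  let ?M = "closure (t.mspan (cofinal_pairs \<Lambda>))"
  have sub: "subspace ?M" by (rule subspace_closure[OF t.subspace_mspan])
  have scale: "scaleC z x \<in> ?M" if "x \<in> ?M" for z x
    by (rule bounded_linear_image_in_closure[OF bounded_linear_scaleC t.mspan_scaleC that])
  have mult: "x * y \<in> ?M" if "x \<in> ?M" "y \<in> ?M" for x y
  proof (rule closure_mult[OF _ that])
    show "x * y \<in> t.mspan (cofinal_pairs \<Lambda>)" if "x \<in> t.mspan (cofinal_pairs \<Lambda>)" "y \<in> t.mspan (cofinal_pairs \<Lambda>)" for x y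
      by (rule t.mspan_mult[OF that], rule subsetD[OF t.mspan_mono t.monomial_mult_in_mspan]) auto
  qed
  have star: "star x \<in> ?M" if "x \<in> ?M" for x
  proof (rule bounded_linear_image_in_closure[OF bounded_linear_star _ that])
    have sub: "prod.swap ` cofinal_pairs \<Lambda> \<subseteq> cofinal_pairs \<Lambda>" by (auto simp: cofinal_pairs_def)
    show "star x \<in> t.mspan (cofinal_pairs \<Lambda>)" if "x \<in> t.mspan (cofinal_pairs \<Lambda>)" for x
      by (rule subsetD[OF t.mspan_mono[OF sub] t.mspan_star[OF that]])
  qed
  have "cstar_subalgebra ?M full_algebra"
    unfolding cstar_subalgebra_def
    using sub scale mult star by (simp add: submodule_full_algebraI subspace_0 subspace_add)
  moreover have "\<pi> ` total D \<subseteq> ?M"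
    using rep_in_closure by (auto simp: D_simps(1))
  ultimately show ?thesis using gen by (simp add: cstar_generates_def)
qed

end

section \<open>Injectivity of \<pi>T on C*(B(\<sigma>))\<close>

theorem theorem5p4:
  fixes k :: nat
    and \<Lambda> :: "'l kgraph"
    and G :: "'g monoid"
    and \<eta> :: "'l \<Rightarrow> 'g"
    and \<sigma> :: "'g \<Rightarrow> 'g \<Rightarrow> complex"
    and s :: "'l \<Rightarrow> 'c::cstar_algebra"
    and B :: "('g, 'g \<times> 'c) fell_bundle"
    and \<pi>\<sigma> :: "'g \<times> 'c \<Rightarrow> 'd::cstar_algebra"
    and t :: "'l \<Rightarrow> 'd"
    and T :: "'l \<Rightarrow> 'a::cstar_algebra"
    and \<pi>T :: "'d \<Rightarrow> 'a"
  assumes "k_graph k \<Lambda>"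
    and "row_finite_no_sources k \<Lambda>"
    and "aperiodic k \<Lambda>"
    and "group G"
    and "functor_to_group \<Lambda> G \<eta>"
    and "circle_cocycle G \<sigma>"
    and "is_kgraph_algebra k \<Lambda> (full_algebra :: 'c cstar) s"
    and "B = graph_bundle \<Lambda> G \<eta> (full_algebra :: 'c cstar) s"
    and "is_fell_bundle_algebra G (deformed_bundle G \<sigma> B) (full_algebra :: 'd cstar) \<pi>\<sigma>"
    and "\<And>\<kappa>. \<kappa> \<in> paths \<Lambda> \<Longrightarrow> t \<kappa> = \<pi>\<sigma> (\<eta> \<kappa>, s \<kappa>)"
    and "twisted_ck_family k \<Lambda> \<eta> \<sigma> (full_algebra :: 'a cstar) T"
    and "\<And>v. v \<in> vertices \<Lambda> \<Longrightarrow> T v \<noteq> 0"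
    and "star_hom (full_algebra :: 'd cstar) (full_algebra :: 'a cstar) \<pi>T"
    and "\<And>\<kappa>. \<kappa> \<in> paths \<Lambda> \<Longrightarrow> \<pi>T (t \<kappa>) = T \<kappa>"
  shows "inj \<pi>T"
proof -
  interpret k_graph k \<Lambda> by (rule assms(1))
  interpret group G by (rule assms(4))
  have "ck_relations k \<Lambda> (\<lambda>_ _. 1) full_algebra s"
    using assms(7) by (simp add: is_kgraph_algebra_def cuntz_krieger_family_def)
  moreover have "fell_representation G (deformed_bundle G \<sigma> (graph_bundle \<Lambda> G \<eta> full_algebra s)) full_algebra \<pi>\<sigma>"
    and gen: "cstar_generates full_algebra (\<pi>\<sigma> ` total (deformed_bundle G \<sigma> (graph_bundle \<Lambda> G \<eta> full_algebra s)))"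
    using assms(9) by (simp_all add: assms(8) is_fell_bundle_algebra_def)
  ultimately interpret R: deformed_representation k \<Lambda> s G \<eta> \<sigma> \<pi>\<sigma>
    using assms(2,5,6) by unfold_locales simp_all
  \<comment> \<open>On a vertex \<open>v\<close>, \<open>\<pi>T (t v) = T v\<close> is non-zero; so
    \<pi>T kills no vertex projection of the family \<open>t\<close>.\<close>
  interpret M: ck_morphism k \<Lambda> "\<lambda>\<kappa> \<mu>. \<sigma> (\<eta> \<kappa>) (\<eta> \<mu>)" R.t \<pi>T
  proof unfold_locales
    show "\<pi>T (R.t v) \<noteq> 0" if "v \<in> vertices \<Lambda>" for v
      using assms(10)[of v] assms(12)[of v] assms(14)[of v] vertex_path[OF that] that by (simp add: R.t_def)
  qed (rule assms(13), rule assms(3))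
  show ?thesis by (rule M.hom_injective[OF R.dense_monomials[OF gen]])
qed

end
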